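(* Let $b,\omega:\mathbb{R}\to\mathbb{R}^+$ be continuous with $0<b_0\le b(t)\le b_1$ and $0\le\omega_0\le\omega(t)\le\omega_1<\pi^2$ for all $t$, let $U$ be the multivalued process on $L^2(0,1)$ generated by the strong solutions of problem $(P)$ (stated in the context), let $\{\mathcal{A}(t)\}_{t\in\mathbb{R}}$ be its pullback attractor, and let $v_1^+$ and $v_1^-=-v_1^+$ be the positive and negative stationary points of the autonomous problem $(P_{b_1,\omega_1})$. Then there exist bounded complete trajectories $\gamma_\ast(\cdot),\gamma^\ast(\cdot)$ of $(P)$ such that: 1. $v_1^-\le\gamma_\ast(t)\le\gamma^\ast(t)\le v_1^+$ for all $t\in\mathbb{R}$. 2. $\mathcal{A}(t)\subset I_{\gamma_\ast}^{\gamma^\ast}(t):=\{y\in L^2(0,1):\gamma_\ast(t)\le y\le\gamma^\ast(t)\}$ for all $t\in\mathbb{R}$. 3. $\gamma_\ast$ is minimal in the sense that there is no complete trajectory $\gamma$ other than $\gamma_\ast$ with $v_1^-\le\gamma(t)\le\gamma_\ast(t)$ for all $t\in\mathbb{R}$, and $\gamma^\ast$ is maximal in the sense that there is no complete trajectory $\gamma$ other than $\gamma^\ast$ with $\gamma^\ast(t)\le\gamma(t)\le v_1^+$ for all $t\in\mathbb{R}$. 4. If, in addition, $b,\omega\in W^{1,2}_{loc}(\mathbb{R})$, then $\gamma_\ast$ is globally asymptotically stable from below, i.e. for every $t\in\mathbb{R}$, $\lim_{\tau\to-\infty}dist_X(U(t,\tau,v_\tau),\gamma_\ast(t))=0$ whenever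 $v_\tau\in L^2(0,1)$ with $v_1^-\le v_\tau\le\gamma_\ast(\tau)$ for all $\tau\in\mathbb{R}$; and $\gamma^\ast$ is globally asymptotically stable from above, i.e. for every $t\in\mathbb{R}$, $\lim_{\tau\to-\infty}dist_X(U(t,\tau,v_\tau),\gamma^\ast(t))=0$ whenever $v_\tau\in L^2(0,1)$ with $v_1^+\ge v_\tau\ge\gamma^\ast(\tau)$ for all $\tau\in\mathbb{R}$.
   Context: $X=L^2(0,1)$ with its norm metric $\rho$ and the order $u\le v\Leftrightarrow u(x)\le v(x)$ for a.a. $x\in(0,1)$; $\mathbb{R}^+=[0,\infty)$; $dist_X(B,A)=\sup_{b\in B}\inf_{a\in A}\rho(b,a)$ (a point is identified with its singleton). $H_0$ is the set-valued Heaviside function: $H_0(u)=-1$ if $u<0$, $H_0(u)=[-1,1]$ if $u=0$, $H_0(u)=1$ if $u>0$. Problem $(P)$ with initial time $\tau\in\mathbb{R}$ and initial datum $u_\tau\in L^2(0,1)$: $$\frac{\partial u}{\partial t}-\frac{\partial^2u}{\partial x^2}\in b(t)H_0(u)+\omega(t)u\ \text{ on }(\tau,\infty)\times(0,1),\quad u(t,0)=u(t,1)=0,\quad u(\tau,x)=u_\tau(x).$$ $(P_{b_1,\omega_1})$ denotes the same problem with $b(t)\equiv b_1$, $\omega(t)\equiv\omega_1$. Let $A=-d^2/dx^2$ with $D(A)=H^2(0,1)\cap H_0^1(0,1)$. A function $u\in C([\tau,+\infty),L^2(0,1))$ is a strong solution of $(P)$ if $u(\tau)=u_\tau$; $u$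 is absolutely continuous on $[T_1,T_2]$ and $u(t)\in D(A)$ for a.a. $t\in(T_1,T_2)$, for any $\tau<T_1<T_2$; and there exists $f\in L^2_{loc}(\tau,+\infty;L^2(0,1))$ with $f(t,x)\in H_0(u(t,x))$ for a.e. $(t,x)\in(\tau,+\infty)\times(0,1)$ and $\frac{du}{dt}(t)+Au(t)=b(t)f(t)+\omega(t)u(t)$ in $L^2(0,1)$ for a.e. $t\in(\tau,+\infty)$. $\mathcal{R}_\tau$ is the set of all strong solutions of $(P)$ with initial time $\tau$ and initial datum in $L^2(0,1)$, and $U(t,s,x)=\{u(t):u\in\mathcal{R}_s,\ u(s)=x\}$ for $t\ge s$, $x\in X$ (with $U(t,s,B)=\cup_{x\in B}U(t,s,x)$). A complete trajectory (complete orbit) is a map $\gamma:\mathbb{R}\to X$ with $\gamma|_{[\tau,\infty)}\in\mathcal{R}_\tau$ for all $\tau\in\mathbb{R}$; it is bounded if $\cup_{t\in\mathbb{R}}\gamma(t)$ is bounded in $X$. A pullback attractor for $U$ is a family of compact sets $\{\mathcal{A}(t)\}_{t\in\mathbb{R}}$ such that $dist_X(U(t,s,B),\mathcal{A}(t))\to0$ as $s\to-\infty$ for all $t$ and all bounded $B$; $\mathcal{A}(t)\subset U(t,s,\mathcal{A}(s))$ for $s\le t$; and it is contained in any other such attracting family of closed sets. It is known that $U$ has a pullback attractor, that $\mathcal{A}(t)=U(t,s,\mathcal{A}(s))$ for $s\le t$, that $\cup_{t}\mathcal{A}(t)$ is bounded in $H_0^1(0,1)$ with compact closure in $L^2(0,1)$,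 and that $\mathcal{A}(t)=\{\gamma(t):\gamma\text{ is a bounded complete trajectory}\}$. A stationary point (fixed point) of $(P_{b_1,\omega_1})$ is a $v\in X$ such that the constant-in-time function $u(t)\equiv v$ is a strong solution. It is known that $(P_{b_1,\omega_1})$ has exactly one positive stationary point $v_1^+$ ($v_1^+(x)>0$ for $x\in(0,1)$) and exactly one negative one, $v_1^-=-v_1^+$. *)

theory Defs
  imports "HOL-Analysis.Analysis"
begin

section \<open>The space \<open>L\<^sup>2(0,1)\<close>\<close>

abbreviation I01 :: "real measure" where
  "I01 \<equiv> lebesgue_on {0<..<1::real}"

definition sq_int :: "'a measure \<Rightarrow> ('a \<Rightarrow> real) \<Rightarrow> bool" where
  "sq_int M f \<longleftrightarrow> f \<in> borel_measurable M \<and> integrable M (\<lambda>x. (f x)\<^sup>2)"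

lemma sq_int_measurable: "sq_int M f \<Longrightarrow> f \<in> borel_measurable M"
  by (simp add: sq_int_def)

lemma sq_int_mult:
  assumes "sq_int M f" "sq_int M g"
  shows "integrable M (\<lambda>x. f x * g x)"
proof (rule Bochner_Integration.integrable_bound[where f = "\<lambda>x. (f x)\<^sup>2 + (g x)\<^sup>2"])
  show "integrable M (\<lambda>x. (f x)\<^sup>2 + (g x)\<^sup>2)"
    using assms by (simp add: sq_int_def)
  show "(\<lambda>x. f x * g x) \<in> borel_measurable M"
    using assms by (auto dest!: sq_int_measurable)
  show "AE x in M. norm (f x * g x) \<le> norm ((f x)\<^sup>2 + (g x)\<^sup>2)"
  proof (rule AE_I2)
    fix x
    have "2 * (\<bar>f x\<bar> * \<bar>g x\<bar>) \<le> (f x)\<^sup>2 + (g x)\<^sup>2"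
      using sum_squares_bound[of "\<bar>f x\<bar>" "\<bar>g x\<bar>"] by (simp add: mult.assoc)
    moreover have "0 \<le> \<bar>f x\<bar> * \<bar>g x\<bar>" by simp
    ultimately show "norm (f x * g x) \<le> norm ((f x)\<^sup>2 + (g x)\<^sup>2)"
      unfolding real_norm_def abs_mult by linarith
  qed
qed

lemma sq_int_zero: "sq_int M (\<lambda>x. 0)"
  by (simp add: sq_int_def)

lemma sq_int_scale: "sq_int M f \<Longrightarrow> sq_int M (\<lambda>x. c * f x)"
  by (auto simp: sq_int_def power_mult_distrib intro!: borel_measurable_times)

lemma sq_int_add:
  assumes "sq_int M f" "sq_int M g"
  shows "sq_int M (\<lambda>x. f x + g x)"
  using assms sq_int_mult[OF assms]
  by (auto simp: sq_int_def power2_sum mult.assoc)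

lemma sq_int_uminus: "sq_int M f \<Longrightarrow> sq_int M (\<lambda>x. - f x)"
  using sq_int_scale[of M f "-1"] by simp

lemma sq_int_diff: "sq_int M f \<Longrightarrow> sq_int M g \<Longrightarrow> sq_int M (\<lambda>x. f x - g x)"
  using sq_int_add[of M f "\<lambda>x. - g x"] sq_int_uminus[of M g] by simp

definition L2_rel :: "(real \<Rightarrow> real) \<Rightarrow> (real \<Rightarrow> real) \<Rightarrow> bool" where
  "L2_rel f g \<longleftrightarrow> sq_int I01 f \<and> sq_int I01 g \<and> (AE x in I01. f x = g x)"

quotient_type L2 = "real \<Rightarrow> real" / partial: L2_rel
proof (rule part_equivpI)
  show "\<exists>f. L2_rel f f" by (auto simp: L2_rel_def intro: sq_int_zero)
  show "symp L2_rel" by (auto simp: symp_def L2_rel_def)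
  show "transp L2_rel" unfolding transp_def L2_rel_def by auto
qed

instantiation L2 :: real_inner
begin

lift_definition zero_L2 :: L2 is "\<lambda>x. 0"
  by (simp add: L2_rel_def sq_int_zero)

lift_definition plus_L2 :: "L2 \<Rightarrow> L2 \<Rightarrow> L2" is "\<lambda>f g x. f x + g x"
  by (auto simp: L2_rel_def intro: sq_int_add)

lift_definition minus_L2 :: "L2 \<Rightarrow> L2 \<Rightarrow> L2" is "\<lambda>f g x. f x - g x"
  by (auto simp: L2_rel_def intro: sq_int_diff)

lift_definition uminus_L2 :: "L2 \<Rightarrow> L2" is "\<lambda>f x. - f x"
  by (auto simp: L2_rel_def intro: sq_int_uminus)

lift_definition scaleR_L2 :: "real \<Rightarrow> L2 \<Rightarrow> L2" is "\<lambda>c f x. c * f x"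
  by (auto simp: L2_rel_def intro: sq_int_scale)

lift_definition inner_L2 :: "L2 \<Rightarrow> L2 \<Rightarrow> real" is "\<lambda>f g. LINT x|I01. f x * g x"
  unfolding L2_rel_def
  by (intro integral_cong_AE) (auto intro!: borel_measurable_times dest!: sq_int_measurable)

definition norm_L2 :: "L2 \<Rightarrow> real" where
  "norm_L2 u = sqrt (inner u u)"

definition dist_L2 :: "L2 \<Rightarrow> L2 \<Rightarrow> real" where
  "dist_L2 u v = norm (u - v)"

definition sgn_L2 :: "L2 \<Rightarrow> L2" where
  "sgn_L2 u = inverse (norm u) *\<^sub>R u"

definition uniformity_L2 :: "(L2 \<times> L2) filter" where
  "uniformity_L2 = (INF e\<in>{0<..}. principal {(u, v). dist u v < e})"

definition open_L2 :: "L2 set \<Rightarrow> bool" where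
  "open_L2 S \<longleftrightarrow> (\<forall>u\<in>S. \<forall>\<^sub>F (u', v) in uniformity. u' = u \<longrightarrow> v \<in> S)"

instance
proof
  fix u v w :: L2 and a c :: real
  show "u + v + w = u + (v + w)"
    by transfer (auto simp: L2_rel_def add.assoc intro!: sq_int_add)
  show "u + v = v + u"
    by transfer (auto simp: L2_rel_def add.commute intro!: sq_int_add)
  show "0 + u = u"
    by transfer (auto simp: L2_rel_def)
  show "- u + u = 0"
    by transfer (auto simp: L2_rel_def sq_int_zero)
  show "u - v = u + - v"
    by transfer (auto simp: L2_rel_def intro: sq_int_diff)
  show "a *\<^sub>R (u + v) = a *\<^sub>R u + a *\<^sub>R v"
    by transfer (auto simp: L2_rel_def distrib_left intro!: sq_int_add sq_int_scale)
  show "(a + c) *\<^sub>R u = a *\<^sub>R u + c *\<^sub>R u"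
    by transfer (auto simp: L2_rel_def distrib_right intro!: sq_int_add sq_int_scale)
  show "a *\<^sub>R c *\<^sub>R u = (a * c) *\<^sub>R u"
    by transfer (auto simp: L2_rel_def mult.assoc intro!: sq_int_scale)
  show "1 *\<^sub>R u = u"
    by transfer (auto simp: L2_rel_def)
  show "sgn u = inverse (norm u) *\<^sub>R u" by (fact sgn_L2_def)
  show "dist u v = norm (u - v)" by (fact dist_L2_def)
  show "(uniformity :: (L2 \<times> L2) filter) = (INF e\<in>{0<..}. principal {(u, v). dist u v < e})"
    by (fact uniformity_L2_def)
  show "open S \<longleftrightarrow> (\<forall>u\<in>S. \<forall>\<^sub>F (u', v) in uniformity. u' = u \<longrightarrow> v \<in> S)" for S :: "L2 set"
    by (fact open_L2_def)
  show "inner u v = inner v u"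
    by transfer (simp add: mult.commute)
  show "inner (u + v) w = inner u w + inner v w"
    by transfer (simp add: L2_rel_def distrib_right sq_int_mult)
  show "inner (a *\<^sub>R u) v = a * inner u v"
    by transfer (simp add: mult.assoc)
  show "0 \<le> inner u u"
    by transfer simp
  show "inner u u = 0 \<longleftrightarrow> u = 0"
  proof transfer
    fix f assume "L2_rel f f"
    hence f: "sq_int I01 f" by (simp add: L2_rel_def)
    hence "integrable I01 (\<lambda>x. f x * f x)" by (rule sq_int_mult[OF _ f])
    hence "(LINT x|I01. f x * f x) = 0 \<longleftrightarrow> (AE x in I01. f x * f x = 0)"
      by (intro integral_nonneg_eq_0_iff_AE) auto
    thus "(LINT x|I01. f x * f x) = 0 \<longleftrightarrow> L2_rel f (\<lambda>x. 0)"
      using f by (simp add: L2_rel_def sq_int_zero)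
  qed
  show "norm u = sqrt (inner u u)" by (fact norm_L2_def)
qed

end

instantiation L2 :: order
begin

lift_definition less_eq_L2 :: "L2 \<Rightarrow> L2 \<Rightarrow> bool" is "\<lambda>f g. AE x in I01. f x \<le> g x"
  unfolding L2_rel_def by (intro iffI) (auto elim: AE_mp)

definition less_L2 :: "L2 \<Rightarrow> L2 \<Rightarrow> bool" where
  "less_L2 u v \<longleftrightarrow> u \<le> v \<and> \<not> v \<le> u"

instance
proof
  fix u v w :: L2
  show "u < v \<longleftrightarrow> u \<le> v \<and> \<not> v \<le> u" by (fact less_L2_def)
  show "u \<le> u" by transfer simp
  show "u \<le> v \<Longrightarrow> v \<le> w \<Longrightarrow> u \<le> w"
    by transfer (auto elim: AE_mp)
  show "u \<le> v \<Longrightarrow> v \<le> u \<Longrightarrow> u = v"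
    by transfer (auto simp: L2_rel_def elim: AE_mp)
qed

end

lemma sq_int_rep_L2: "sq_int I01 (rep_L2 u)"
  using Quotient_rep_reflp[OF Quotient_L2] by (auto simp: L2_rel_def)

lemma abs_rep_L2 [simp]: "abs_L2 (rep_L2 u) = u"
  by (rule Quotient_abs_rep[OF Quotient_L2])

lemma rep_abs_L2: "sq_int I01 f \<Longrightarrow> AE x in I01. rep_L2 (abs_L2 f) x = f x"
  using Quotient_rep_abs[OF Quotient_L2, of f] by (auto simp: L2_rel_def)

lemma L2_eq_iff: "u = v \<longleftrightarrow> (AE x in I01. rep_L2 u x = rep_L2 v x)"
  using Quotient_rel_rep[OF Quotient_L2, of u v] by (auto simp: L2_rel_def sq_int_rep_L2)

lemma less_eq_L2_iff: "u \<le> v \<longleftrightarrow> (AE x in I01. rep_L2 u x \<le> rep_L2 v x)"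
  by (simp add: less_eq_L2_def)

lemma inner_L2_iff: "inner u v = (LINT x|I01. rep_L2 u x * rep_L2 v x)"
  by (simp add: inner_L2_def)

section \<open>Weak derivatives and the operator \<open>-d\<^sup>2/dx\<^sup>2\<close>\<close>

definition test_fun :: "real set \<Rightarrow> (real \<Rightarrow> real) \<Rightarrow> bool" where
  "test_fun S \<phi> \<longleftrightarrow>
     (\<forall>n x. (deriv ^^ n) \<phi> field_differentiable (at x)) \<and>
     compact (closure {x. \<phi> x \<noteq> 0}) \<and> closure {x. \<phi> x \<noteq> 0} \<subseteq> S"

lemma test_fun_sq_int:
  assumes "test_fun S \<phi>"
  shows "sq_int I01 \<phi>" and "sq_int I01 (deriv \<phi>)"
proof -
  have d: "(deriv ^^ n) \<phi> field_differentiable (at x)" for n x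
    using assms by (simp add: test_fun_def)
  have c: "continuous_on UNIV ((deriv ^^ n) \<phi>)" for n
    using d field_differentiable_imp_continuous_at continuous_at_imp_continuous_on by blast
  have sq: "sq_int I01 ((deriv ^^ n) \<phi>)" for n
  proof -
    have "continuous_on {0..1} (\<lambda>x. ((deriv ^^ n) \<phi> x)\<^sup>2)"
      by (intro continuous_intros continuous_on_subset[OF c]) auto
    hence "set_integrable lebesgue {0..1} (\<lambda>x. ((deriv ^^ n) \<phi> x)\<^sup>2)"
      by (rule absolutely_integrable_continuous_real)
    hence "set_integrable lebesgue {0<..<1} (\<lambda>x. ((deriv ^^ n) \<phi> x)\<^sup>2)"
      by (rule set_integrable_subset) auto
    hence "integrable I01 (\<lambda>x. ((deriv ^^ n) \<phi> x)\<^sup>2)"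
      by (simp add: integrable_restrict_space set_integrable_def)
    moreover have "(deriv ^^ n) \<phi> \<in> borel_measurable I01"
      by (intro continuous_imp_measurable_on_sets_lebesgue continuous_on_subset[OF c]) auto
    ultimately show ?thesis by (simp add: sq_int_def)
  qed
  show "sq_int I01 \<phi>" using sq[of 0] by simp
  show "sq_int I01 (deriv \<phi>)" using sq[of 1] by simp
qed

definition has_weak_deriv :: "real set \<Rightarrow> (real \<Rightarrow> real) \<Rightarrow> (real \<Rightarrow> real) \<Rightarrow> bool" where
  "has_weak_deriv S f g \<longleftrightarrow> (\<forall>\<phi>. test_fun S \<phi> \<longrightarrow>
     (LINT x|lebesgue_on S. f x * deriv \<phi> x) = - (LINT x|lebesgue_on S. g x * \<phi> x))"

definition wderiv_L2 :: "L2 \<Rightarrow> L2 \<Rightarrow> bool" where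
  "wderiv_L2 v g \<longleftrightarrow> has_weak_deriv {0<..<1} (rep_L2 v) (rep_L2 g)"

definition H2_01 :: "L2 set" where
  "H2_01 = {v. \<exists>g h. wderiv_L2 v g \<and> wderiv_L2 g h}"

text \<open>\<open>H\<^sub>0\<^sup>1(0,1)\<close> is the closure of the test functions in the \<open>H\<^sup>1\<close> norm.\<close>

definition H10_01 :: "L2 set" where
  "H10_01 = {v. \<exists>g. wderiv_L2 v g \<and>
     (\<exists>\<phi>. (\<forall>n. test_fun {0<..<1} (\<phi> n)) \<and>
          (\<lambda>n. abs_L2 (\<phi> n)) \<longlonglongrightarrow> v \<and>
          (\<lambda>n. abs_L2 (deriv (\<phi> n))) \<longlonglongrightarrow> g)}"

definition DA :: "L2 set" where
  "DA = H2_01 \<inter> H10_01"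

text \<open>Weak derivatives are unique, so the description is proper on \<open>DA\<close>; outside \<open>DA\<close>
  the value is irrelevant.\<close>

definition A_op :: "L2 \<Rightarrow> L2" where
  "A_op v = - (THE h. \<exists>g. wderiv_L2 v g \<and> wderiv_L2 g h)"

definition W12_loc :: "(real \<Rightarrow> real) \<Rightarrow> bool" where
  "W12_loc f \<longleftrightarrow> (\<forall>a c. sq_int (lebesgue_on {a..c}) f) \<and>
     (\<exists>g. (\<forall>a c. sq_int (lebesgue_on {a..c}) g) \<and> has_weak_deriv UNIV f g)"

section \<open>Strong solutions\<close>

definition H0 :: "real \<Rightarrow> real set" where
  "H0 u = (if u < 0 then {-1} else if u = 0 then {-1..1} else {1})"

definition abs_continuous_on :: "real \<Rightarrow> real \<Rightarrow> (real \<Rightarrow> 'a::real_normed_vector) \<Rightarrow> bool" where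
  "abs_continuous_on a c u \<longleftrightarrow> (\<forall>\<epsilon>>0. \<exists>\<delta>>0. \<forall>(n::nat) p q.
     (\<forall>i<n. a \<le> p i \<and> p i \<le> q i \<and> q i \<le> c) \<and>
     (\<forall>i<n. \<forall>j<n. i \<noteq> j \<longrightarrow> {p i<..<q i} \<inter> {p j<..<q j} = {}) \<and>
     (\<Sum>i<n. q i - p i) < \<delta>
     \<longrightarrow> (\<Sum>i<n. norm (u (q i) - u (p i))) < \<epsilon>)"

text \<open>Since \<open>L\<^sup>2(0,1)\<close> is separable, Borel measurability of an \<open>L\<^sup>2(0,1)\<close>-valued function
  is the same as strong measurability.\<close>

definition L2loc :: "real \<Rightarrow> (real \<Rightarrow> L2) \<Rightarrow> bool" where
  "L2loc \<tau> f \<longleftrightarrow> (\<forall>T1 T2. \<tau> < T1 \<and> T1 < T2 \<longrightarrow>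
     f \<in> borel_measurable (lebesgue_on {T1..T2}) \<and>
     integrable (lebesgue_on {T1..T2}) (\<lambda>t. (norm (f t))\<^sup>2))"

text \<open>A jointly measurable real function on \<open>(\<tau>,\<infinity>) \<times> (0,1)\<close> that represents an
  \<open>L\<^sup>2(0,1)\<close>-valued function of time; it is unique up to null sets of the product.\<close>

definition joint_rep :: "real \<Rightarrow> (real \<Rightarrow> L2) \<Rightarrow> (real \<times> real \<Rightarrow> real) \<Rightarrow> bool" where
  "joint_rep \<tau> f F \<longleftrightarrow>
     F \<in> borel_measurable (lebesgue_on ({\<tau><..} \<times> {0<..<1})) \<and>
     (AE t in lebesgue_on {\<tau><..}. AE x in I01. F (t, x) = rep_L2 (f t) x)"

definition strong_solution ::
  "(real \<Rightarrow> real) \<Rightarrow> (real \<Rightarrow> real) \<Rightarrow> real \<Rightarrow> L2 \<Rightarrow> (real \<Rightarrow> L2) \<Rightarrow> bool" where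
  "strong_solution b \<omega> \<tau> u\<^sub>\<tau> u \<longleftrightarrow>
     continuous_on {\<tau>..} u \<and> u \<tau> = u\<^sub>\<tau> \<and>
     (\<forall>T1 T2. \<tau> < T1 \<and> T1 < T2 \<longrightarrow>
        abs_continuous_on T1 T2 u \<and> (AE t in lebesgue_on {T1<..<T2}. u t \<in> DA)) \<and>
     (\<exists>f. L2loc \<tau> f \<and>
        (\<exists>F W. joint_rep \<tau> f F \<and> joint_rep \<tau> u W \<and>
           (AE z in lebesgue_on ({\<tau><..} \<times> {0<..<1}). F z \<in> H0 (W z))) \<and>
        (AE t in lebesgue_on {\<tau><..}. \<exists>u'. (u has_vector_derivative u') (at t) \<and>
           u' + A_op (u t) = b t *\<^sub>R f t + \<omega> t *\<^sub>R u t))"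

definition stationary_point :: "real \<Rightarrow> real \<Rightarrow> L2 \<Rightarrow> bool" where
  "stationary_point b1 \<omega>1 v \<longleftrightarrow>
     (\<forall>\<tau>. strong_solution (\<lambda>_. b1) (\<lambda>_. \<omega>1) \<tau> v (\<lambda>_. v))"

text \<open>Pointwise signs refer to the continuous representative.\<close>

definition positive_L2 :: "L2 \<Rightarrow> bool" where
  "positive_L2 v \<longleftrightarrow> (\<exists>g. continuous_on {0<..<1} g \<and> (AE x in I01. rep_L2 v x = g x) \<and>
     (\<forall>x\<in>{0<..<1}. g x > 0))"

definition negative_L2 :: "L2 \<Rightarrow> bool" where
  "negative_L2 v \<longleftrightarrow> (\<exists>g. continuous_on {0<..<1} g \<and> (AE x in I01. rep_L2 v x = g x) \<and>
     (\<forall>x\<in>{0<..<1}. g x < 0))"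

section \<open>The multivalued process and its pullback attractor\<close>

definition solutions :: "(real \<Rightarrow> real) \<Rightarrow> (real \<Rightarrow> real) \<Rightarrow> real \<Rightarrow> (real \<Rightarrow> L2) set" where
  "solutions b \<omega> \<tau> = {u. \<exists>u\<^sub>\<tau>. strong_solution b \<omega> \<tau> u\<^sub>\<tau> u}"

text \<open>Solutions with initial time \<open>s\<close> are constrained only on \<open>[s,\<infinity>)\<close>, so
  \<open>process b \<omega> t s x\<close> is meaningful for \<open>s \<le> t\<close> only.\<close>

definition process :: "(real \<Rightarrow> real) \<Rightarrow> (real \<Rightarrow> real) \<Rightarrow> real \<Rightarrow> real \<Rightarrow> L2 \<Rightarrow> L2 set" where
  "process b \<omega> t s x = {u t |u. u \<in> solutions b \<omega> s \<and> u s = x}"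

definition complete_trajectory ::
  "(real \<Rightarrow> real) \<Rightarrow> (real \<Rightarrow> real) \<Rightarrow> (real \<Rightarrow> L2) \<Rightarrow> bool" where
  "complete_trajectory b \<omega> \<gamma> \<longleftrightarrow> (\<forall>\<tau>. \<gamma> \<in> solutions b \<omega> \<tau>)"

text \<open>With values in \<open>ennreal\<close>, unbounded suprema are \<open>\<infinity>\<close> and the distance of a point to
  the empty set is \<open>\<infinity>\<close>.\<close>

definition dist_X :: "'a::metric_space set \<Rightarrow> 'a set \<Rightarrow> ennreal" where
  "dist_X B A = (SUP b\<in>B. INF a\<in>A. ennreal (dist b a))"

definition pullback_attracting ::
  "(real \<Rightarrow> real \<Rightarrow> 'a::metric_space \<Rightarrow> 'a set) \<Rightarrow> (real \<Rightarrow> 'a set) \<Rightarrow> bool" where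
  "pullback_attracting U \<A> \<longleftrightarrow>
     (\<forall>t B. bounded B \<longrightarrow> ((\<lambda>s. dist_X (\<Union>x\<in>B. U t s x) (\<A> t)) \<longlongrightarrow> 0) at_bot)"

definition pullback_attractor ::
  "(real \<Rightarrow> real \<Rightarrow> 'a::metric_space \<Rightarrow> 'a set) \<Rightarrow> (real \<Rightarrow> 'a set) \<Rightarrow> bool" where
  "pullback_attractor U \<A> \<longleftrightarrow>
     (\<forall>t. compact (\<A> t)) \<and>
     pullback_attracting U \<A> \<and>
     (\<forall>s t. s \<le> t \<longrightarrow> \<A> t \<subseteq> (\<Union>x\<in>\<A> s. U t s x)) \<and>
     (\<forall>\<C>. (\<forall>t. closed (\<C> t)) \<and> pullback_attracting U \<C> \<longrightarrow> (\<forall>t. \<A> t \<subseteq> \<C> t))"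

end

theory Submission
  imports Defs
begin

text \<open>The upper extremal trajectory is explicit. A positive solution solves the linear equation with
  \<open>f = 1\<close>, whose only bounded complete solution is \<open>upper t = (\<Sum>k. c\<^sub>k y\<^sub>k(t) e\<^sub>k)\<close>, where
  \<open>1 = (\<Sum>k. c\<^sub>k e\<^sub>k)\<close> in the sine basis and \<open>y\<^sub>k\<close> is the bounded solution of
  \<open>y' = b - (\<lambda>\<^sub>k - \<omega>) y\<close>; the lower one is \<open>- upper\<close> since the problem is odd. As \<open>f \<le> 1\<close>, testing the
  equation for \<open>w = u - upper\<close> with \<open>w\<^sup>+\<close> and using Poincare's inequality gives
  \<open>\<parallel>w\<^sup>+(t)\<parallel> \<le> exp (- (\<pi>\<^sup>2 - \<omega>\<^sub>1) (t - s)) \<parallel>w\<^sup>+(s)\<parallel>\<close> for every strong solution \<open>u\<close>. Hence the order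
  interval between \<open>- upper\<close> and \<open>upper\<close> is closed and attracting, so it contains the minimal attracting
  family \<open>\<A>\<close>, and bounded complete trajectories lie in it, which gives extremality. For stability, a solution
  starting above \<open>upper\<close> starts above \<open>b\<^sub>0 x (1 - x) / 2\<close> and, by Hardy's inequality, stays above it;
  so it is positive, solves the linear equation too, and converges to \<open>upper\<close>.\<close>

section \<open>Smooth functions\<close>

text \<open>Only odd frequencies occur, since 1 is symmetric about 1/2. As y_k = O(1/lambda_k), the
  series for \<open>upper\<close>, for its time derivative and for \<open>A_op (upper t)\<close> all
  have coefficients c_k times bounded factors, so they converge because the squares of the c_k are
  summable; differentiability, domain and equation can then be checked by hand. The obstacle is
  stability. \<open>H0\<close> jumps at 0, so the difference of two sources is not bounded by the
  difference of the solutions, and a direct Gronwall argument fails once a solution touches 0.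
  Comparison with the parabola leaves a source that does not vanish with w; its bound involves
  1/(x(1-x)), which is singular at the boundary but weaker than the critical 1/x^2, so the Dirichlet
  form absorbs every multiple of it at the cost of a multiple of the squared norm. Both inequalities
  come from one principle: if phi > 0 and p = -phi'/phi, the weight p' - p^2 = -phi''/phi is
  dominated by the Dirichlet form. Poincare takes phi = sin(pi x), Hardy takes phi = exp(4 (sqrt x +
  sqrt(1-x))).\<close>

definition smooth :: "(real \<Rightarrow> real) \<Rightarrow> bool" where
  "smooth f \<longleftrightarrow> (\<forall>n x. (deriv ^^ n) f field_differentiable (at x))"

text \<open>A set that contains a derivative of each of its members contains all iterated
  derivatives. Exhibiting such a set replaces every induction on the order of
  differentiation.\<close>

lemma smooth_coinduct:
  assumes "f \<in> S" and step: "\<And>f. f \<in> S \<Longrightarrow> \<exists>f'\<in>S. \<forall>x. (f has_real_derivative f' x) (at x)"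
  shows "smooth f"
proof -
  have "deriv g \<in> S" if g: "g \<in> S" for g
  proof -
    obtain g' where g': "g' \<in> S" "\<And>x. (g has_real_derivative g' x) (at x)"
      using step[OF g] by blast
    have "deriv g = g'" using g'(2) by (auto intro: DERIV_imp_deriv)
    with g' show ?thesis by simp
  qed
  hence "(deriv ^^ n) f \<in> S" for n
    by (induction n) (use assms(1) in auto)
  thus ?thesis
    unfolding smooth_def field_differentiable_def using step by meson
qed

lemma smooth_has_deriv: "smooth f \<Longrightarrow> (f has_real_derivative deriv f x) (at x)"
  unfolding smooth_def DERIV_deriv_iff_field_differentiable by (drule spec[of _ 0]) simp

lemma smooth_deriv: "smooth f \<Longrightarrow> smooth (deriv f)"
  unfolding smooth_def
proof (intro allI)
  fix n x assume "\<forall>n x. (deriv ^^ n) f field_differentiable at x"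
  hence "(deriv ^^ Suc n) f field_differentiable at x" by blast
  thus "(deriv ^^ n) (deriv f) field_differentiable at x" by (simp add: funpow_swap1)
qed

lemma smooth_from_deriv:
  assumes "\<And>x. (f has_real_derivative f' x) (at x)" "smooth f'"
  shows "smooth f"
proof (rule smooth_coinduct[of _ "insert f (Collect smooth)"])
  show "\<exists>f'\<in>insert f (Collect smooth). \<forall>x. (g has_real_derivative f' x) (at x)"
    if "g \<in> insert f (Collect smooth)" for g
    using that
  proof (elim insertE)
    assume "g = f"
    thus ?thesis using assms by (intro bexI[of _ f']) auto
  next
    assume "g \<in> Collect smooth"
    thus ?thesis by (intro bexI[of _ "deriv g"]) (auto intro: smooth_has_deriv smooth_deriv)
  qed
qed simp

lemma smooth_isCont: "smooth f \<Longrightarrow> isCont f x"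
  using DERIV_isCont smooth_has_deriv by blast

lemma smooth_continuous_on: "smooth f \<Longrightarrow> continuous_on S f"
  using smooth_isCont continuous_at_imp_continuous_on by blast

section \<open>Algebras of functions stable under differentiation\<close>

inductive_set fun_alg :: "(real \<Rightarrow> real) set \<Rightarrow> (real \<Rightarrow> real) set" for B where
  base: "f \<in> B \<Longrightarrow> f \<in> fun_alg B"
| const: "(\<lambda>x. c) \<in> fun_alg B"
| add: "f \<in> fun_alg B \<Longrightarrow> g \<in> fun_alg B \<Longrightarrow> (\<lambda>x. f x + g x) \<in> fun_alg B"
| mult: "f \<in> fun_alg B \<Longrightarrow> g \<in> fun_alg B \<Longrightarrow> (\<lambda>x. f x * g x) \<in> fun_alg B"

text \<open>The sum and product rules keep derivatives inside the generated algebra, so only the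
  generators have to be differentiated. Products, compositions, sin and the flat functions below are
  all obtained by choosing \<open>B\<close>.\<close>

lemma smooth_alg:
  assumes B: "\<And>f. f \<in> B \<Longrightarrow> \<exists>f'\<in>fun_alg B. \<forall>x. (f has_real_derivative f' x) (at x)"
    and "f \<in> fun_alg B"
  shows "smooth f"
proof (rule smooth_coinduct[OF \<open>f \<in> fun_alg B\<close>])
  fix f assume "f \<in> fun_alg B"
  thus "\<exists>f'\<in>fun_alg B. \<forall>x. (f has_real_derivative f' x) (at x)"
  proof induction
    case (base f) thus ?case by (rule B)
  next
    case (const c) show ?case by (rule bexI[of _ "\<lambda>x. 0"]) (auto intro: fun_alg.const)
  next
    case (add f g)
    then obtain f' g' where *: "f' \<in> fun_alg B" "\<And>x. (f has_real_derivative f' x) (at x)"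
      "g' \<in> fun_alg B" "\<And>x. (g has_real_derivative g' x) (at x)" by blast
    thus ?case
      by (intro bexI[of _ "\<lambda>x. f' x + g' x"]) (auto intro: fun_alg.add DERIV_add)
  next
    case (mult f g)
    then obtain f' g' where *: "f' \<in> fun_alg B" "\<And>x. (f has_real_derivative f' x) (at x)"
      "g' \<in> fun_alg B" "\<And>x. (g has_real_derivative g' x) (at x)" by blast
    have "(\<lambda>x. f' x * g x + g' x * f x) \<in> fun_alg B"
      by (intro fun_alg.add fun_alg.mult * mult)
    thus ?case
      using * by (auto intro!: bexI[of _ "\<lambda>x. f' x * g x + g' x * f x"] DERIV_mult)
  qed
qed

lemma smooth_const: "smooth (\<lambda>x. c)"
  by (rule smooth_alg[of "{}"]) (auto intro: fun_alg.const)

lemma smooth_ident: "smooth (\<lambda>x. x)"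
  by (rule smooth_from_deriv[OF _ smooth_const[of 1]]) auto

lemma smooth_alg_smooth: "f \<in> fun_alg (Collect smooth) \<Longrightarrow> smooth f"
proof (rule smooth_alg)
  fix f assume "f \<in> Collect smooth"
  thus "\<exists>f'\<in>fun_alg (Collect smooth). \<forall>x. (f has_real_derivative f' x) (at x)"
    by (intro bexI[of _ "deriv f"]) (auto intro: fun_alg.base smooth_has_deriv smooth_deriv)
qed

lemma smooth_add: "smooth f \<Longrightarrow> smooth g \<Longrightarrow> smooth (\<lambda>x. f x + g x)"
  by (intro smooth_alg_smooth fun_alg.add fun_alg.base) auto

lemma smooth_mult: "smooth f \<Longrightarrow> smooth g \<Longrightarrow> smooth (\<lambda>x. f x * g x)"
  by (intro smooth_alg_smooth fun_alg.mult fun_alg.base) auto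

lemma smooth_compose:
  assumes "smooth f" "smooth g"
  shows "smooth (\<lambda>x. f (g x))"
\<comment> \<open>The compositions with \<open>g\<close> alone are not closed under the chain rule;
  the factor \<open>deriv g\<close> is supplied by the smooth functions among the
  generators.\<close>
proof (rule smooth_alg[of "Collect smooth \<union> {\<lambda>x. f (g x) |f. smooth f}"])
  let ?B = "Collect smooth \<union> {\<lambda>x. f (g x) |f. smooth f}"
  show "(\<lambda>x. f (g x)) \<in> fun_alg ?B" using assms by (auto intro: fun_alg.base)
  fix h assume "h \<in> ?B"
  then consider "smooth h" | k where "h = (\<lambda>x. k (g x))" "smooth k" by blast
  thus "\<exists>f'\<in>fun_alg ?B. \<forall>x. (h has_real_derivative f' x) (at x)"
  proof cases
    case 1 thus ?thesis
      by (intro bexI[of _ "deriv h"]) (auto intro: fun_alg.base smooth_has_deriv smooth_deriv)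
  next
    case 2
    have "(\<lambda>x. deriv k (g x) * deriv g x) \<in> fun_alg ?B"
      using 2 assms by (intro fun_alg.mult fun_alg.base) (auto intro: smooth_deriv)
    moreover have "\<forall>x. (h has_real_derivative deriv k (g x) * deriv g x) (at x)"
      unfolding 2 using DERIV_chain2 smooth_has_deriv[OF 2(2)] smooth_has_deriv[OF assms(2)] by blast
    ultimately show ?thesis by (intro bexI[of _ "\<lambda>x. deriv k (g x) * deriv g x"])
  qed
qed

lemma smooth_cmult: "smooth f \<Longrightarrow> smooth (\<lambda>x. c * f x)"
  by (intro smooth_mult smooth_const)

lemma smooth_minus: "smooth f \<Longrightarrow> smooth (\<lambda>x. - f x)"
  using smooth_cmult[of f "-1"] by simp

lemma smooth_diff: "smooth f \<Longrightarrow> smooth g \<Longrightarrow> smooth (\<lambda>x. f x - g x)"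
  using smooth_add[of f "\<lambda>x. - g x"] smooth_minus[of g] by simp

lemma smooth_affine: "smooth (\<lambda>x. c * x + d)"
  by (intro smooth_add smooth_cmult smooth_ident smooth_const)

lemma smooth_sin: "smooth sin"
proof (rule smooth_alg[of "{sin, cos}"])
  fix f :: "real \<Rightarrow> real" assume "f \<in> {sin, cos}"
  thus "\<exists>f'\<in>fun_alg {sin, cos}. \<forall>x. (f has_real_derivative f' x) (at x)"
  proof (elim insertE emptyE)
    assume "f = sin"
    thus ?thesis by (intro bexI[of _ cos]) (auto intro: fun_alg.base)
  next
    have "(\<lambda>x. (-1) * sin x) \<in> fun_alg {sin, cos::real\<Rightarrow>real}"
      by (intro fun_alg.mult fun_alg.const fun_alg.base) simp
    moreover assume "f = cos"
    ultimately show ?thesis by (intro bexI[of _ "\<lambda>x. (-1) * sin x"]) auto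
  qed
qed (auto intro: fun_alg.base)

section \<open>Smooth steps and smooth positive parts from flat functions\<close>

definition flat :: "nat \<Rightarrow> real \<Rightarrow> real" where
  "flat k x = (if x > 0 then (1 / x) ^ k * exp (- (1 / x)) else 0)"

lemma flat_tendsto_0: "((flat k) \<longlongrightarrow> 0) (at 0)"
proof -
  have "((\<lambda>x::real. x ^ k / exp x) \<longlongrightarrow> 0) at_top" by (rule tendsto_power_div_exp_0)
  hence "((\<lambda>x::real. inverse x ^ k / exp (inverse x)) \<longlongrightarrow> 0) (at_right 0)"
    by (rule filterlim_compose[OF _ filterlim_inverse_at_top_right])
  hence "(flat k \<longlongrightarrow> 0) (at_right 0)"
  proof (rule Lim_transform_eventually)
    show "\<forall>\<^sub>F x in at_right 0. inverse x ^ k / exp (inverse x) = flat k x"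
      using eventually_at_right_less
      by eventually_elim (auto simp: flat_def exp_minus field_simps)
  qed
  moreover have "(flat k \<longlongrightarrow> 0) (at_left 0)"
  proof (rule Lim_transform_eventually[OF tendsto_const])
    show "\<forall>\<^sub>F x in at_left 0. 0 = flat k x"
      unfolding eventually_at_filter by (rule always_eventually) (auto simp: flat_def)
  qed
  ultimately show ?thesis by (simp add: filterlim_split_at)
qed

text \<open>Differentiating exp(-1/x) produces powers of 1/x. Building these powers into the family
  makes the derivative of a member a linear combination of members, as \<open>smooth_alg\<close>
  requires.\<close>

lemma flat_deriv:
  "(flat k has_real_derivative (- real k) * flat (Suc k) x + flat (Suc (Suc k)) x) (at x)"
proof (cases x "0::real" rule: linorder_cases)
  case less
  have "((\<lambda>x. 0) has_real_derivative 0) (at x)" by simp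
  moreover have "\<forall>\<^sub>F y in nhds x. flat k y = 0"
    using eventually_nhds_in_open[OF open_lessThan, of x 0] less by (auto simp: flat_def elim: eventually_mono)
  ultimately have "(flat k has_real_derivative 0) (at x)"
    using DERIV_cong_ev[of x x "flat k" "\<lambda>x. 0" 0 0] by simp
  thus ?thesis using less by (simp add: flat_def)
next
  case equal
  \<comment> \<open>At 0 the difference quotient of \<open>flat k\<close> is
    \<open>flat (Suc k)\<close> itself, on both sides, so the derivative there is a limit already
    known to be 0.\<close>
  have "((\<lambda>h. (flat k (0 + h) - flat k 0) / h) \<longlongrightarrow> 0) (at 0)"
  proof (rule Lim_transform_eventually[OF flat_tendsto_0[of "Suc k"]])
    show "\<forall>\<^sub>F h in at 0. flat (Suc k) h = (flat k (0 + h) - flat k 0) / h"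
      by (rule always_eventually) (auto simp: flat_def)
  qed
  thus ?thesis unfolding equal DERIV_def by (simp add: flat_def)
next
  case greater
  have "((\<lambda>x. (1 / x) ^ k) has_real_derivative - (real k * (1 / x) ^ Suc k)) (at x)"
  proof (induction k)
    case (Suc k)
    have "((\<lambda>x. (1 / x) * (1 / x) ^ k) has_real_derivative
        - (1 / x\<^sup>2) * (1 / x) ^ k + - (real k * (1 / x) ^ Suc k) * (1 / x)) (at x)"
    proof -
      have "((\<lambda>x. 1 / x) has_real_derivative - (1 / x\<^sup>2)) (at x)"
        using greater by (auto intro!: derivative_eq_intros simp: power2_eq_square)
      from DERIV_mult'[OF this Suc] show ?thesis by (simp add: add.commute mult.commute)
    qed
    thus ?case by (simp add: field_simps power2_eq_square add_divide_distrib)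
  qed simp
  moreover have "((\<lambda>x. exp (- (1 / x))) has_real_derivative exp (- (1 / x)) * (1 / x)\<^sup>2) (at x)"
    using greater by (auto intro!: derivative_eq_intros simp: power2_eq_square)
  ultimately have "((\<lambda>x. (1 / x) ^ k * exp (- (1 / x))) has_real_derivative
      (1 / x) ^ k * (exp (- (1 / x)) * (1 / x)\<^sup>2) + - (real k * (1 / x) ^ Suc k) * exp (- (1 / x))) (at x)"
    by (rule DERIV_mult')
  hence "((\<lambda>x. (1 / x) ^ k * exp (- (1 / x))) has_real_derivative
      (- real k) * ((1 / x) ^ Suc k * exp (- (1 / x))) + (1 / x) ^ Suc (Suc k) * exp (- (1 / x))) (at x)"
    by (simp add: algebra_simps power2_eq_square)
  moreover have "\<forall>\<^sub>F y in nhds x. flat k y = (1 / y) ^ k * exp (- (1 / y))"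
    using eventually_nhds_in_open[OF open_greaterThan, of x 0] greater by (auto simp: flat_def elim: eventually_mono)
  ultimately show ?thesis
    using DERIV_cong_ev[of x x "flat k" "\<lambda>y. (1 / y) ^ k * exp (- (1 / y))"] greater
    by (simp add: flat_def)
qed

lemma smooth_flat: "smooth (flat k)"
proof (rule smooth_alg[of "range flat"])
  fix f assume "f \<in> range flat"
  then obtain k where "f = flat k" by blast
  moreover have "(\<lambda>x. (- real k) * flat (Suc k) x + flat (Suc (Suc k)) x) \<in> fun_alg (range flat)"
    by (intro fun_alg.add fun_alg.mult fun_alg.const fun_alg.base) auto
  ultimately show "\<exists>f'\<in>fun_alg (range flat). \<forall>x. (f has_real_derivative f' x) (at x)"
    by (intro bexI[of _ "\<lambda>x. (- real k) * flat (Suc k) x + flat (Suc (Suc k)) x"]) (use flat_deriv in simp_all)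
qed (auto intro: fun_alg.base)

lemma continuous_antiderivative:
  fixes f :: "real \<Rightarrow> real"
  assumes "continuous_on UNIV f"
  obtains F where "\<And>x. (F has_real_derivative f x) (at x)"
proof
  fix x :: real
  \<comment> \<open>The interval from -R to R has the base point 0 and the point x in its interior,
    so the derivative within the interval is a full derivative.\<close>
  let ?R = "\<bar>x\<bar> + 1"
  have "((\<lambda>u. LBINT y=ereal 0..ereal u. f y) has_vector_derivative f x) (at x within {- ?R..?R})"
    by (rule interval_integral_FTC2) (auto intro: continuous_on_subset[OF assms])
  moreover have "at x within {- ?R..?R} = at x"
    by (rule at_within_interior) auto
  ultimately show "((\<lambda>u. LBINT y=ereal 0..ereal u. f y) has_real_derivative f x) (at x)"
    by (simp only: has_real_derivative_iff_has_vector_derivative)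
qed

lemma DERIV_zero_imp_eq:
  fixes f :: "real \<Rightarrow> real"
  assumes "a \<le> b" "\<And>x. a \<le> x \<Longrightarrow> x \<le> b \<Longrightarrow> (f has_real_derivative 0) (at x)"
  shows "f a = f b"
proof (cases "a = b")
  case False
  have "continuous_on {a..b} f"
    using assms(2) by (auto intro!: continuous_at_imp_continuous_on DERIV_isCont)
  thus ?thesis using DERIV_isconst_end[of a b f] assms False by auto
qed simp

text \<open>\<open>E\<close> is the normalised antiderivative of the bump exp(-1/x) exp(-1/(1-x)) on
  (0,1). The slope bound \<open>C\<close> is recorded for the rescaled cut-offs near the
  boundary.\<close>

lemma smooth_step:
  "\<exists>E C. smooth E \<and> (\<forall>x\<le>0. E x = 0) \<and> (\<forall>x\<ge>1. E x = 1) \<and> (\<forall>x. 0 \<le> E x \<and> E x \<le> 1) \<and>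
     (\<forall>x. \<bar>deriv E x\<bar> \<le> C)"
proof -
  define \<beta> where "\<beta> x = flat 0 x * flat 0 (1 - x)" for x
  have sm: "smooth \<beta>" unfolding \<beta>_def
    by (intro smooth_mult smooth_flat smooth_compose[OF smooth_flat, of "\<lambda>x. 1 - x"] smooth_diff
        smooth_const smooth_ident)
  have b0: "\<beta> x \<ge> 0" for x by (simp add: \<beta>_def flat_def)
  have bp: "\<beta> x > 0" if "0 < x" "x < 1" for x using that by (simp add: \<beta>_def flat_def)
  have bz: "\<beta> x = 0" if "x \<le> 0 \<or> x \<ge> 1" for x using that by (auto simp: \<beta>_def flat_def)
  have bl: "\<beta> x \<le> 1" for x
  proof -
    have "0 \<le> flat 0 y \<and> flat 0 y \<le> 1" for y by (simp add: flat_def)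
    thus ?thesis unfolding \<beta>_def by (intro mult_le_one) auto
  qed
  obtain G where G: "\<And>x. (G has_real_derivative \<beta> x) (at x)"
    using continuous_antiderivative[OF smooth_continuous_on[OF sm]] by blast
  have Gm: "G x \<le> G y" if "x \<le> y" for x y
    using DERIV_nonneg_imp_nondecreasing[OF that] G b0 by blast
  have dz: "(G has_real_derivative 0) (at x)" if "x \<le> 0 \<or> x \<ge> 1" for x
    using G[of x] bz[OF that] by simp
  have G0: "G x = G 0" if "x \<le> 0" for x
    by (rule DERIV_zero_imp_eq[OF that]) (auto intro: dz)
  have G1: "G x = G 1" if "x \<ge> 1" for x
    by (rule DERIV_zero_imp_eq[OF that, symmetric]) (auto intro: dz)
  have c: "G 0 < G 1"
    by (rule DERIV_pos_imp_increasing_open[of 0 1 G])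
       (use G bp in \<open>auto intro!: continuous_at_imp_continuous_on DERIV_isCont\<close>)
  define E where "E x = inverse (G 1 - G 0) * (G x - G 0)" for x
  have dE: "(E has_real_derivative inverse (G 1 - G 0) * \<beta> x) (at x)" for x
    unfolding E_def[abs_def] by (rule derivative_eq_intros G refl | simp)+
  show ?thesis
  proof (intro exI conjI allI impI)
    show "smooth E" by (rule smooth_from_deriv[OF dE]) (intro smooth_cmult sm)
    show "E x = 0" if "x \<le> 0" for x using G0[OF that] by (simp add: E_def)
    show "E x = 1" if "x \<ge> 1" for x using G1[OF that] c by (simp add: E_def)
    have "G 0 \<le> G x" for x using Gm[of 0 x] G0[of x] by (cases "x \<le> 0") simp_all
    moreover have "G x \<le> G 1" for x using Gm[of x 1] G1[of x] by (cases "x \<le> 1") simp_all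
    ultimately show "0 \<le> E x" "E x \<le> 1" for x using c by (auto simp: E_def field_simps)
    show "\<bar>deriv E x\<bar> \<le> inverse (G 1 - G 0)" for x
      using DERIV_imp_deriv[OF dE] c b0[of x] bl[of x] by (simp add: abs_mult mult_left_le)
  qed
qed

text \<open>\<open>j\<close> is the antiderivative of s \<mapsto> E(s/\<epsilon>). Its slope lies in
  [0,1] and equals 1 beyond \<epsilon>, so s - j s grows from 0 at s = 0 only up to s = \<epsilon>,
  by at most \<epsilon> in total. The slope bounds are what the energy estimate for positive parts
  uses.\<close>

lemma smooth_pos_part:
  assumes "\<epsilon> > 0"
  obtains j where "smooth j" "\<And>s. s \<le> 0 \<Longrightarrow> j s = 0" "\<And>s. 0 \<le> deriv j s" "\<And>s. deriv j s \<le> 1"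
    "\<And>s. \<bar>j s - max 0 s\<bar> \<le> \<epsilon>"
proof -
  obtain E where sE: "smooth E" and E: "\<forall>x\<le>0. E x = 0" "\<forall>x\<ge>1. E x = 1"
    "\<forall>x. 0 \<le> E x \<and> E x \<le> 1" using smooth_step by blast
  have smE: "smooth (\<lambda>x. E (x / \<epsilon>))"
    using smooth_compose[OF sE smooth_cmult[OF smooth_ident, of "inverse \<epsilon>"]]
    by (simp add: field_simps)
  obtain G where G: "\<And>x. (G has_real_derivative E (x / \<epsilon>)) (at x)"
    using continuous_antiderivative[OF smooth_continuous_on[OF smE]] by blast
  define j where "j s = G s - G 0" for s
  have dj: "(j has_real_derivative E (s / \<epsilon>)) (at s)" for s
    unfolding j_def[abs_def] by (rule derivative_eq_intros G refl | simp)+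
  have djd: "((\<lambda>s. s - j s) has_real_derivative 1 - E (s / \<epsilon>)) (at s)" for s
    by (rule derivative_eq_intros dj refl | simp)+
  have m1: "j x \<le> j y" if "x \<le> y" for x y
    using DERIV_nonneg_imp_nondecreasing[OF that] dj E(3) by blast
  have m2: "x - j x \<le> y - j y" if "x \<le> y" for x y
  proof (rule DERIV_nonneg_imp_nondecreasing[OF that])
    show "\<exists>y. ((\<lambda>s. s - j s) has_real_derivative y) (at x) \<and> 0 \<le> y" for x
      using djd[of x] E(3) by (intro exI[of _ "1 - E (x / \<epsilon>)"]) simp
  qed
  have dz: "(j has_real_derivative 0) (at s)" if "s \<le> 0" for s
    using dj[of s] E(1) that assms by (simp add: divide_nonpos_pos)
  have z: "j s = 0" if "s \<le> 0" for s
    using DERIV_zero_imp_eq[OF that, of j] dz by (simp add: j_def[of 0])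
  have do: "((\<lambda>s. s - j s) has_real_derivative 0) (at s)" if "s \<ge> \<epsilon>" for s
    using djd[of s] E(2) that assms by simp
  have o: "\<epsilon> - j \<epsilon> = s - j s" if "s \<ge> \<epsilon>" for s
    by (rule DERIV_zero_imp_eq[OF that]) (rule do)
  show thesis
  proof
    show "smooth j" by (rule smooth_from_deriv[OF dj smE])
    show "0 \<le> deriv j s" "deriv j s \<le> 1" for s using DERIV_imp_deriv[OF dj] E by auto
    show "\<bar>j s - max 0 s\<bar> \<le> \<epsilon>" for s
    proof (cases "s \<le> 0")
      case True thus ?thesis using z[of s] assms by simp
    next
      case False
      hence "0 \<le> s - j s" using m2[of 0 s] z[of 0] by simp
      moreover have "s - j s \<le> \<epsilon>"
      proof (cases "s \<ge> \<epsilon>")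
        case True thus ?thesis using o[OF True] m1[of 0 \<epsilon>] z[of 0] assms by simp
      next
        case False thus ?thesis using m1[of 0 s] z[of 0] \<open>\<not> s \<le> 0\<close> by simp
      qed
      ultimately show ?thesis using False by simp
    qed
  qed (use z in auto)
qed

section \<open>The Hilbert space \<open>L\<^sup>2(0,1)\<close>\<close>

lemma finite_measure_I01: "finite_measure I01"
  by (rule finite_measure_lebesgue_on) simp

lemma AE_I01_I: "(\<And>x. 0 < x \<Longrightarrow> x < 1 \<Longrightarrow> P x) \<Longrightarrow> AE x in I01. P x"
  by (rule AE_I2) auto

lemma continuous_measurable_I01: "continuous_on {0<..<1} f \<Longrightarrow> f \<in> borel_measurable I01"
  by (rule continuous_imp_measurable_on_sets_lebesgue) auto

lemma integrable_I01_bounded: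
  fixes f :: "real \<Rightarrow> real"
  assumes "f \<in> borel_measurable I01" "AE x in I01. \<bar>f x\<bar> \<le> B"
  shows "integrable I01 f"
  using finite_measure.integrable_const_bound[OF finite_measure_I01, of f B] assms by simp

lemma sq_int_bounded:
  assumes "f \<in> borel_measurable I01" "AE x in I01. \<bar>f x\<bar> \<le> B"
  shows "sq_int I01 f"
proof -
  have "AE x in I01. \<bar>(f x)\<^sup>2\<bar> \<le> B\<^sup>2"
    using assms(2) by eventually_elim (metis abs_ge_zero abs_power2 power2_abs power_mono)
  thus ?thesis
    unfolding sq_int_def using assms by (auto intro!: integrable_I01_bounded borel_measurable_power)
qed

lemma sq_int_continuous:
  assumes "continuous_on {0..1} f"
  shows "sq_int I01 f"
proof -
  have "compact (f ` {0..1})" using assms compact_continuous_image compact_Icc by blast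
  then obtain B where "\<And>x. x \<in> {0..1} \<Longrightarrow> \<bar>f x\<bar> \<le> B"
    using compact_imp_bounded bounded_iff by (metis imageI real_norm_def)
  thus ?thesis
    by (intro sq_int_bounded[of _ B] AE_I01_I continuous_measurable_I01 continuous_on_subset[OF assms]) auto
qed

lemma sq_int_smooth: "smooth f \<Longrightarrow> sq_int I01 f"
  by (intro sq_int_continuous smooth_continuous_on)

lemma sq_int_mult_bounded:
  assumes "sq_int I01 f" "Q \<in> borel_measurable I01" "AE x in I01. \<bar>Q x\<bar> \<le> N"
  shows "sq_int I01 (\<lambda>x. Q x * f x)"
  unfolding sq_int_def
proof
  show m: "(\<lambda>x. Q x * f x) \<in> borel_measurable I01"
    using assms sq_int_measurable by (intro borel_measurable_times) auto
  show "integrable I01 (\<lambda>x. (Q x * f x)\<^sup>2)"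
  proof (rule Bochner_Integration.integrable_bound)
    show "integrable I01 (\<lambda>x. N\<^sup>2 * (f x)\<^sup>2)" using assms by (auto simp: sq_int_def)
    show "(\<lambda>x. (Q x * f x)\<^sup>2) \<in> borel_measurable I01" using m by (rule borel_measurable_power)
    show "AE x in I01. norm ((Q x * f x)\<^sup>2) \<le> norm (N\<^sup>2 * (f x)\<^sup>2)"
      using assms(3)
    proof eventually_elim
      case (elim x)
      hence "(Q x)\<^sup>2 \<le> N\<^sup>2" by (metis abs_ge_zero power2_abs power_mono)
      thus ?case by (auto simp: power_mult_distrib intro: mult_right_mono)
    qed
  qed
qed

section \<open>Representatives, norms and dominated convergence\<close>

lemma inner_abs_L2:
  assumes "sq_int I01 f" "sq_int I01 g"
  shows "inner (abs_L2 f) (abs_L2 g) = (LINT x|I01. f x * g x)"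
  unfolding inner_L2_iff
proof (rule integral_cong_AE)
  show "AE x in I01. rep_L2 (abs_L2 f) x * rep_L2 (abs_L2 g) x = f x * g x"
    using rep_abs_L2[OF assms(1)] rep_abs_L2[OF assms(2)] by eventually_elim simp
qed (use assms sq_int_rep_L2 sq_int_measurable in \<open>auto intro!: borel_measurable_times\<close>)

lemma norm_abs_L2: "sq_int I01 f \<Longrightarrow> (norm (abs_L2 f))\<^sup>2 = (LINT x|I01. (f x)\<^sup>2)"
  unfolding power2_norm_eq_inner by (simp add: inner_abs_L2 power2_eq_square)

lemma
  assumes "sq_int I01 f" "sq_int I01 g"
  shows abs_L2_add: "abs_L2 f + abs_L2 g = abs_L2 (\<lambda>x. f x + g x)"
    and abs_L2_diff: "abs_L2 f - abs_L2 g = abs_L2 (\<lambda>x. f x - g x)"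
  using assms by (simp_all add: plus_L2.abs_eq minus_L2.abs_eq L2_rel_def)

lemma
  assumes "sq_int I01 f"
  shows abs_L2_scale: "c *\<^sub>R abs_L2 f = abs_L2 (\<lambda>x. c * f x)"
    and abs_L2_minus: "- abs_L2 f = abs_L2 (\<lambda>x. - f x)"
  using assms by (simp_all add: scaleR_L2.abs_eq uminus_L2.abs_eq L2_rel_def)

lemma rep_L2_add: "AE x in I01. rep_L2 (u + v) x = rep_L2 u x + rep_L2 v x"
  using rep_abs_L2[OF sq_int_add[OF sq_int_rep_L2[of u] sq_int_rep_L2[of v]]]
    abs_L2_add[OF sq_int_rep_L2[of u] sq_int_rep_L2[of v]] by simp

lemma rep_L2_diff: "AE x in I01. rep_L2 (u - v) x = rep_L2 u x - rep_L2 v x"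
  using rep_abs_L2[OF sq_int_diff[OF sq_int_rep_L2[of u] sq_int_rep_L2[of v]]]
    abs_L2_diff[OF sq_int_rep_L2[of u] sq_int_rep_L2[of v]] by simp

lemma rep_L2_scale: "AE x in I01. rep_L2 (c *\<^sub>R u) x = c * rep_L2 u x"
  using rep_abs_L2[OF sq_int_scale[OF sq_int_rep_L2[of u]]] abs_L2_scale[OF sq_int_rep_L2[of u]] by simp

lemma rep_L2_minus: "AE x in I01. rep_L2 (- u) x = - rep_L2 u x"
  using rep_abs_L2[OF sq_int_uminus[OF sq_int_rep_L2[of u]]] abs_L2_minus[OF sq_int_rep_L2[of u]] by simp

lemma rep_L2_zero: "AE x in I01. rep_L2 0 x = 0"
  using rep_abs_L2[OF sq_int_zero] by (simp add: zero_L2_def)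

lemma L2_eqI_AE: "AE x in I01. rep_L2 u x = rep_L2 v x \<Longrightarrow> u = v"
  by (simp add: L2_eq_iff)

lemma norm_L2_le_AE:
  assumes "AE x in I01. \<bar>rep_L2 u x\<bar> \<le> \<bar>rep_L2 v x\<bar>"
  shows "norm u \<le> norm v"
proof -
  have "(norm u)\<^sup>2 \<le> (norm v)\<^sup>2"
    unfolding power2_norm_eq_inner inner_L2_iff
  proof (rule integral_mono_AE)
    show "AE x in I01. rep_L2 u x * rep_L2 u x \<le> rep_L2 v x * rep_L2 v x"
      using assms by eventually_elim (simp add: abs_le_square_iff flip: power2_eq_square)
  qed (auto intro: sq_int_mult sq_int_rep_L2)
  thus ?thesis by (simp add: power2_le_iff_abs_le)
qed

lemma norm_L2_le_const:
  assumes "AE x in I01. \<bar>rep_L2 u x\<bar> \<le> B" "0 \<le> B"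
  shows "norm u \<le> B"
proof -
  have sq: "sq_int I01 (\<lambda>x. B)" by (intro sq_int_continuous continuous_intros)
  have "AE x in I01. \<bar>rep_L2 u x\<bar> \<le> \<bar>rep_L2 (abs_L2 (\<lambda>x. B)) x\<bar>"
    using assms(1) rep_abs_L2[OF sq] by eventually_elim simp
  hence "norm u \<le> norm (abs_L2 (\<lambda>x. B))" by (rule norm_L2_le_AE)
  also have "(norm (abs_L2 (\<lambda>x. B)))\<^sup>2 = B\<^sup>2"
    by (simp add: norm_abs_L2[OF sq] measure_restrict_space)
  hence "norm (abs_L2 (\<lambda>x. B)) = B" using assms(2) by (simp add: power2_eq_iff_nonneg)
  finally show ?thesis .
qed

lemma tendsto_abs_L2_dominated:
  assumes f: "\<And>n. sq_int I01 (f n)" and g: "sq_int I01 g"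
    and lim: "AE x in I01. (\<lambda>n. f n x) \<longlonglongrightarrow> g x"
    and bd: "\<And>n. AE x in I01. \<bar>f n x\<bar> \<le> B"
  shows "(\<lambda>n. abs_L2 (f n)) \<longlonglongrightarrow> abs_L2 g"
proof -
  have "(\<lambda>n. LINT x|I01. (f n x - g x)\<^sup>2) \<longlonglongrightarrow> (LINT x|I01. 0)"
  proof (rule integral_dominated_convergence)
    \<comment> \<open>The limit inherits the bound \<open>B\<close>, so the differences are bounded
      by \<open>2 * B\<close>.\<close>
    show "integrable I01 (\<lambda>x. (2 * B)\<^sup>2)"
      by (intro finite_measure.integrable_const finite_measure_I01)
    show "AE x in I01. (\<lambda>n. (f n x - g x)\<^sup>2) \<longlonglongrightarrow> 0"
      using lim
    proof eventually_elim
      case (elim x)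
      hence "(\<lambda>n. (f n x - g x)\<^sup>2) \<longlonglongrightarrow> (g x - g x)\<^sup>2" by (intro tendsto_intros)
      thus ?case by simp
    qed
    fix n
    have all: "AE x in I01. \<forall>n. \<bar>f n x\<bar> \<le> B" using bd by (simp add: AE_all_countable)
    show "AE x in I01. norm ((f n x - g x)\<^sup>2) \<le> (2 * B)\<^sup>2"
      using lim all
    proof eventually_elim
      case (elim x)
      have "\<bar>g x\<bar> \<le> B"
        using tendsto_rabs[OF elim(1)] elim(2) by (intro LIMSEQ_le_const2) auto
      hence "\<bar>f n x - g x\<bar> \<le> 2 * B" using elim(2)[rule_format, of n] by linarith
      hence "\<bar>f n x - g x\<bar>\<^sup>2 \<le> (2 * B)\<^sup>2" by (rule power_mono) simp
      thus ?case by simp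
    qed
  qed (use f g sq_int_measurable in \<open>auto intro!: borel_measurable_power borel_measurable_diff\<close>)
  hence "(\<lambda>n. (norm (abs_L2 (f n) - abs_L2 g))\<^sup>2) \<longlonglongrightarrow> 0"
    by (simp add: abs_L2_diff f g norm_abs_L2 sq_int_diff)
  hence "(\<lambda>n. sqrt ((norm (abs_L2 (f n) - abs_L2 g))\<^sup>2)) \<longlonglongrightarrow> sqrt 0"
    by (rule tendsto_real_sqrt)
  thus ?thesis by (simp add: LIM_zero_cancel tendsto_norm_zero_iff)
qed

text \<open>Riesz-Fischer. On an interval of length 1 a Cauchy sequence is also Cauchy in L^1, a
  subsequence converges almost everywhere, and Fatou's lemma identifies the pointwise limit as the
  norm limit. Completeness is used to sum the sine series and to show that A is closed.\<close>

instance L2 :: banach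
proof
  fix X :: "nat \<Rightarrow> L2" assume X: "Cauchy X"
  let ?s = "\<lambda>n. rep_L2 (X n)"
  have sq1: "sq_int I01 (\<lambda>x. 1)" by (intro sq_int_continuous continuous_intros)
  have sqd: "sq_int I01 (\<lambda>x. ?s i x - ?s j x)" for i j by (intro sq_int_diff sq_int_rep_L2)
  have int1: "integrable I01 f" if "sq_int I01 f" for f
    using sq_int_mult[OF that sq1] by simp
  have nd: "(norm (X i - X j))\<^sup>2 = (LINT x|I01. (?s i x - ?s j x)\<^sup>2)" for i j
    using norm_abs_L2[OF sqd[of i j]] abs_L2_diff[OF sq_int_rep_L2 sq_int_rep_L2, of "X i" "X j"] by simp
  \<comment> \<open>Cauchy-Schwarz against the constant 1, whose norm is at most 1.\<close>
  have l1: "(LINT x|I01. \<bar>?s i x - ?s j x\<bar>) \<le> norm (X i - X j)" for i j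
  proof -
    have sa: "sq_int I01 (\<lambda>x. \<bar>?s i x - ?s j x\<bar>)"
      using sqd[of i j] by (auto simp: sq_int_def)
    have "(LINT x|I01. \<bar>?s i x - ?s j x\<bar>) = inner (abs_L2 (\<lambda>x. \<bar>?s i x - ?s j x\<bar>)) (abs_L2 (\<lambda>x. 1))"
      by (simp add: inner_abs_L2[OF sa sq1])
    also have "\<dots> \<le> norm (abs_L2 (\<lambda>x. \<bar>?s i x - ?s j x\<bar>)) * norm (abs_L2 (\<lambda>x. 1))"
      by (rule norm_cauchy_schwarz)
    also have "norm (abs_L2 (\<lambda>x. 1)) \<le> 1"
      by (rule norm_L2_le_const) (use rep_abs_L2[OF sq1] in \<open>auto elim: eventually_mono\<close>)
    hence "norm (abs_L2 (\<lambda>x. \<bar>?s i x - ?s j x\<bar>)) * norm (abs_L2 (\<lambda>x. 1)) \<le> norm (abs_L2 (\<lambda>x. \<bar>?s i x - ?s j x\<bar>))"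
      by (simp add: mult_left_le)
    also have "(norm (abs_L2 (\<lambda>x. \<bar>?s i x - ?s j x\<bar>)))\<^sup>2 = (norm (X i - X j))\<^sup>2"
      by (simp add: norm_abs_L2[OF sa] nd)
    hence "norm (abs_L2 (\<lambda>x. \<bar>?s i x - ?s j x\<bar>)) = norm (X i - X j)" by simp
    finally show ?thesis .
  qed
  have l1c: "\<exists>N. \<forall>i\<ge>N. \<forall>j\<ge>N. (LINT x|I01. norm (?s i x - ?s j x)) < e" if e: "e > 0" for e
  proof -
    obtain N where "\<forall>i\<ge>N. \<forall>j\<ge>N. norm (X i - X j) < e"
      using CauchyD[OF X e] by blast
    thus ?thesis using le_less_trans[OF l1] by (intro exI[of _ N]) simp
  qed
  obtain r where r: "strict_mono r" "AE x in I01. Cauchy (\<lambda>i. ?s (r i) x)"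
    using cauchy_L1_AE_cauchy_subseq[of I01 ?s, OF int1[OF sq_int_rep_L2] l1c] by blast
  define f where "f x = lim (\<lambda>i. ?s (r i) x)" for x
  have fm: "f \<in> borel_measurable I01"
    unfolding f_def using sq_int_rep_L2 sq_int_measurable by (intro borel_measurable_lim_metric) auto
  have fl: "AE x in I01. (\<lambda>i. ?s (r i) x) \<longlonglongrightarrow> f x"
    using r(2) by eventually_elim (simp add: f_def Cauchy_convergent_iff convergent_LIMSEQ_iff)
  \<comment> \<open>Fatou along the subsequence. Since r i \<ge> i, the Cauchy index
    \<open>N\<close> also serves for the subsequence.\<close>
  have key: "integrable I01 (\<lambda>x. (f x - ?s n x)\<^sup>2) \<and> (LINT x|I01. (f x - ?s n x)\<^sup>2) \<le> e\<^sup>2"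
    if N: "\<forall>i\<ge>N. \<forall>j\<ge>N. norm (X i - X j) < e" "n \<ge> N" for n N e
  proof -
    have "(\<integral>\<^sup>+x. ennreal ((f x - ?s n x)\<^sup>2) \<partial>I01) = (\<integral>\<^sup>+x. liminf (\<lambda>i. ennreal ((?s (r i) x - ?s n x)\<^sup>2)) \<partial>I01)"
    proof (rule nn_integral_cong_AE)
      show "AE x in I01. ennreal ((f x - ?s n x)\<^sup>2) = liminf (\<lambda>i. ennreal ((?s (r i) x - ?s n x)\<^sup>2))"
        using fl
      proof eventually_elim
        case (elim x)
        hence "(\<lambda>i. ennreal ((?s (r i) x - ?s n x)\<^sup>2)) \<longlonglongrightarrow> ennreal ((f x - ?s n x)\<^sup>2)"
          by (intro tendsto_intros tendsto_ennrealI)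
        thus ?case by (intro lim_imp_Liminf[OF sequentially_bot, symmetric])
      qed
    qed
    also have "\<dots> \<le> liminf (\<lambda>i. \<integral>\<^sup>+x. ennreal ((?s (r i) x - ?s n x)\<^sup>2) \<partial>I01)"
      using sqd sq_int_measurable
      by (intro nn_integral_liminf measurable_compose[OF _ measurable_ennreal] borel_measurable_power) auto
    also have "\<dots> \<le> ennreal (e\<^sup>2)"
    proof (rule Liminf_le)
      show "\<forall>\<^sub>F i in sequentially. (\<integral>\<^sup>+x. ennreal ((?s (r i) x - ?s n x)\<^sup>2) \<partial>I01) \<le> ennreal (e\<^sup>2)"
        using eventually_ge_at_top[of N]
      proof eventually_elim
        case (elim i)
        hence "r i \<ge> N" using seq_suble[OF r(1), of i] by linarith
        hence "norm (X (r i) - X n) \<le> e" using N by (simp add: less_imp_le)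
        hence "(norm (X (r i) - X n))\<^sup>2 \<le> e\<^sup>2" by (rule power_mono) simp
        moreover have "integrable I01 (\<lambda>x. (?s (r i) x - ?s n x)\<^sup>2)"
          using sqd by (auto simp: sq_int_def)
        ultimately show ?case
          by (subst nn_integral_eq_integral) (auto simp: nd ennreal_leI)
      qed
    qed simp
    finally have le: "(\<integral>\<^sup>+x. ennreal ((f x - ?s n x)\<^sup>2) \<partial>I01) \<le> ennreal (e\<^sup>2)" .
    have m: "(\<lambda>x. (f x - ?s n x)\<^sup>2) \<in> borel_measurable I01"
      using fm sq_int_rep_L2 sq_int_measurable by (intro borel_measurable_power borel_measurable_diff) auto
    have i: "integrable I01 (\<lambda>x. (f x - ?s n x)\<^sup>2)"
      by (rule integrableI_bounded[OF m]) (use le in \<open>auto simp: order_le_less_trans\<close>)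
    moreover have "ennreal (LINT x|I01. (f x - ?s n x)\<^sup>2) \<le> ennreal (e\<^sup>2)"
      using le nn_integral_eq_integral[OF i] by simp
    ultimately show ?thesis by simp
  qed
  have sqf: "sq_int I01 f"
  proof -
    obtain N where "\<forall>i\<ge>N. \<forall>j\<ge>N. norm (X i - X j) < 1"
      using CauchyD[OF X, of 1] by auto
    hence "integrable I01 (\<lambda>x. (f x - ?s N x)\<^sup>2)" using key[of N 1 N] by blast
    hence "sq_int I01 (\<lambda>x. f x - ?s N x)"
      using fm sq_int_rep_L2[of "X N"] sq_int_measurable by (auto simp: sq_int_def)
    from sq_int_add[OF this sq_int_rep_L2[of "X N"]] show ?thesis by simp
  qed
  have "X \<longlonglongrightarrow> abs_L2 f"
  proof (rule LIMSEQ_I)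
    fix e :: real assume "e > 0"
    then obtain N where N: "\<forall>i\<ge>N. \<forall>j\<ge>N. norm (X i - X j) < e / 2"
      using CauchyD[OF X, of "e / 2"] by auto
    show "\<exists>no. \<forall>n\<ge>no. norm (X n - abs_L2 f) < e"
    proof (intro exI allI impI)
      fix n assume "n \<ge> N"
      have "(norm (X n - abs_L2 f))\<^sup>2 = (norm (abs_L2 f - abs_L2 (?s n)))\<^sup>2"
        by (simp add: norm_minus_commute)
      also have "\<dots> = (LINT x|I01. (f x - ?s n x)\<^sup>2)"
        by (simp only: abs_L2_diff[OF sqf sq_int_rep_L2] norm_abs_L2[OF sq_int_diff[OF sqf sq_int_rep_L2]])
      also have "\<dots> \<le> (e / 2)\<^sup>2" using key[OF N \<open>n \<ge> N\<close>] by blast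
      finally have "norm (X n - abs_L2 f) \<le> e / 2" using \<open>e > 0\<close> power2_le_imp_le by fastforce
      thus "norm (X n - abs_L2 f) < e" using \<open>e > 0\<close> by linarith
    qed
  qed
  thus "convergent X" by (auto simp: convergent_def)
qed

section \<open>Positive parts and multiplication operators\<close>

definition pos :: "L2 \<Rightarrow> L2" where
  "pos u = abs_L2 (\<lambda>x. max 0 (rep_L2 u x))"

definition mult_L2 :: "(real \<Rightarrow> real) \<Rightarrow> L2 \<Rightarrow> L2" where
  "mult_L2 Q u = abs_L2 (\<lambda>x. Q x * rep_L2 u x)"

lemma sq_int_lipschitz:
  assumes "sq_int I01 f" "j \<in> borel_measurable borel" "\<And>s. \<bar>j s\<bar> \<le> \<bar>s\<bar>"
  shows "sq_int I01 (\<lambda>x. j (f x))"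
  unfolding sq_int_def
proof
  show m: "(\<lambda>x. j (f x)) \<in> borel_measurable I01"
    using assms sq_int_measurable measurable_compose by blast
  show "integrable I01 (\<lambda>x. (j (f x))\<^sup>2)"
  proof (rule Bochner_Integration.integrable_bound)
    show "integrable I01 (\<lambda>x. (f x)\<^sup>2)" using assms by (auto simp: sq_int_def)
    show "(\<lambda>x. (j (f x))\<^sup>2) \<in> borel_measurable I01" using m by (rule borel_measurable_power)
    show "AE x in I01. norm ((j (f x))\<^sup>2) \<le> norm ((f x)\<^sup>2)"
      using assms(3) by (intro AE_I2) (simp add: abs_le_square_iff)
  qed
qed

lemma sq_int_pos: "sq_int I01 f \<Longrightarrow> sq_int I01 (\<lambda>x. max 0 (f x))"
  by (rule sq_int_lipschitz[of _ "max 0"]) auto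

lemma rep_pos: "AE x in I01. rep_L2 (pos u) x = max 0 (rep_L2 u x)"
  unfolding pos_def by (intro rep_abs_L2 sq_int_pos sq_int_rep_L2)

lemma rep_mult_L2:
  assumes "Q \<in> borel_measurable I01" "AE x in I01. \<bar>Q x\<bar> \<le> N"
  shows "AE x in I01. rep_L2 (mult_L2 Q u) x = Q x * rep_L2 u x"
  unfolding mult_L2_def using assms by (intro rep_abs_L2 sq_int_mult_bounded sq_int_rep_L2)

lemma pos_eq_0_iff: "pos u = 0 \<longleftrightarrow> u \<le> 0"
proof
  assume "pos u = 0"
  hence "AE x in I01. rep_L2 (pos u) x = rep_L2 0 x" by simp
  thus "u \<le> 0" unfolding less_eq_L2_iff using rep_pos[of u] rep_L2_zero by eventually_elim simp
next
  assume "u \<le> 0"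
  hence "AE x in I01. rep_L2 u x \<le> rep_L2 0 x" by (simp add: less_eq_L2_iff)
  hence "AE x in I01. rep_L2 (pos u) x = rep_L2 0 x"
    using rep_pos[of u] rep_L2_zero by eventually_elim simp
  thus "pos u = 0" by (rule L2_eqI_AE)
qed

lemma L2_le_iff_diff: "u \<le> v \<longleftrightarrow> u - v \<le> (0::L2)"
proof -
  have "(AE x in I01. rep_L2 (u - v) x \<le> rep_L2 0 x) \<longleftrightarrow> (AE x in I01. rep_L2 u x \<le> rep_L2 v x)"
  proof
    assume "AE x in I01. rep_L2 (u - v) x \<le> rep_L2 0 x"
    thus "AE x in I01. rep_L2 u x \<le> rep_L2 v x"
      using rep_L2_diff[of u v] rep_L2_zero by eventually_elim simp
  next
    assume "AE x in I01. rep_L2 u x \<le> rep_L2 v x"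
    thus "AE x in I01. rep_L2 (u - v) x \<le> rep_L2 0 x"
      using rep_L2_diff[of u v] rep_L2_zero by eventually_elim simp
  qed
  thus ?thesis by (simp add: less_eq_L2_iff)
qed

lemma L2_neg_le: "(- u \<le> - v) \<longleftrightarrow> v \<le> (u::L2)"
  using L2_le_iff_diff[of "- u" "- v"] L2_le_iff_diff[of v u] by simp

lemma inner_L2_mono:
  assumes "AE x in I01. rep_L2 u x * rep_L2 v x \<le> rep_L2 w x * rep_L2 z x"
  shows "inner u v \<le> inner w z"
  unfolding inner_L2_iff by (intro integral_mono_AE sq_int_mult sq_int_rep_L2 assms)

lemma inner_L2_eqI:
  assumes "AE x in I01. rep_L2 u x * rep_L2 v x = rep_L2 w x * rep_L2 z x"
  shows "inner u v = inner w z"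
  using assms by (intro antisym inner_L2_mono) (auto elim: eventually_mono)

lemma inner_pos_self: "inner u (pos u) = (norm (pos u))\<^sup>2"
  unfolding power2_norm_eq_inner
  by (rule inner_L2_eqI) (use rep_pos[of u] in eventually_elim, simp add: max_def)

lemma norm_pos_le: "norm (pos u) \<le> norm u"
  by (rule norm_L2_le_AE) (use rep_pos[of u] in eventually_elim, simp)

lemma pos_lipschitz: "norm (pos u - pos v) \<le> norm (u - v)"
  by (rule norm_L2_le_AE)
     (use rep_pos[of u] rep_pos[of v] rep_L2_diff[of u v] rep_L2_diff[of "pos u" "pos v"] in eventually_elim, simp add: max_def)

text \<open>u \<le> v means that the positive part of u - v vanishes, and the positive part is
  1-Lipschitz in norm, so this condition is closed.\<close>

lemma L2_le_limit:
  assumes "X \<longlonglongrightarrow> (u::L2)" "\<And>n. X n \<le> v"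
  shows "u \<le> v"
proof -
  have "pos (X n - v) = 0" for n using assms(2)[of n] by (simp add: pos_eq_0_iff L2_le_iff_diff[symmetric])
  hence "norm (pos (u - v)) \<le> norm (u - X n)" for n
    using pos_lipschitz[of "u - v" "X n - v"] by simp
  moreover have "(\<lambda>n. norm (u - X n)) \<longlonglongrightarrow> norm (u - u)"
    by (intro tendsto_intros assms)
  ultimately have "norm (pos (u - v)) \<le> 0"
    by (intro LIMSEQ_le_const[of "\<lambda>n. norm (u - X n)"]) auto
  thus ?thesis by (simp add: pos_eq_0_iff L2_le_iff_diff[symmetric])
qed

lemma norm_mult_L2:
  assumes "Q \<in> borel_measurable I01" "AE x in I01. \<bar>Q x\<bar> \<le> N" "0 \<le> N"
  shows "norm (mult_L2 Q u) \<le> N * norm u"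
proof -
  have "norm (mult_L2 Q u) \<le> norm (N *\<^sub>R u)"
  proof (rule norm_L2_le_AE)
    show "AE x in I01. \<bar>rep_L2 (mult_L2 Q u) x\<bar> \<le> \<bar>rep_L2 (N *\<^sub>R u) x\<bar>"
      using rep_mult_L2[OF assms(1,2), of u] rep_L2_scale[of N u] assms(2)
      by eventually_elim (use assms(3) in \<open>simp add: abs_mult mult_right_mono\<close>)
  qed
  thus ?thesis using assms(3) by simp
qed

lemma bounded_linear_mult_L2:
  assumes "Q \<in> borel_measurable I01" "AE x in I01. \<bar>Q x\<bar> \<le> N" "0 \<le> N"
  shows "bounded_linear (mult_L2 Q)"
proof (rule bounded_linear_intro[of _ N])
  note r = rep_mult_L2[OF assms(1,2)]
  show "mult_L2 Q (u + v) = mult_L2 Q u + mult_L2 Q v" for u v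
    by (rule L2_eqI_AE)
       (use r[of "u + v"] r[of u] r[of v] rep_L2_add[of u v] rep_L2_add[of "mult_L2 Q u" "mult_L2 Q v"]
        in eventually_elim, simp add: distrib_left)
  show "mult_L2 Q (c *\<^sub>R u) = c *\<^sub>R mult_L2 Q u" for c u
    by (rule L2_eqI_AE)
       (use r[of "c *\<^sub>R u"] r[of u] rep_L2_scale[of c u] rep_L2_scale[of c "mult_L2 Q u"]
        in eventually_elim, simp)
  show "norm (mult_L2 Q u) \<le> norm u * N" for u
    using norm_mult_L2[OF assms] by (simp add: mult.commute)
qed

section \<open>Test functions\<close>

text \<open>Trades the closed support for an explicit interval, the form in which cut-offs are built
  and boundary terms vanish.\<close>

lemma test_fun_iff:
  "test_fun {0<..<1} \<psi> \<longleftrightarrow>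
     smooth \<psi> \<and> (\<exists>a b. 0 < a \<and> a < b \<and> b < 1 \<and> (\<forall>x. x \<notin> {a..b} \<longrightarrow> \<psi> x = 0))"
proof (intro iffI conjI)
  assume t: "test_fun {0<..<1} \<psi>"
  thus "smooth \<psi>" by (simp add: test_fun_def smooth_def)
  \<comment> \<open>The extra points 1/3 and 2/3 make the compact set non-empty and force a < b even
    if the function vanishes identically.\<close>
  let ?K = "insert (1/3) (insert (2/3) (closure {x. \<psi> x \<noteq> 0}))"
  have K: "compact ?K" "?K \<subseteq> {0<..<1}" using t by (auto simp: test_fun_def)
  obtain a where a: "a \<in> ?K" "\<forall>x\<in>?K. a \<le> x"
    using compact_attains_inf[OF K(1) insert_not_empty] by blast
  obtain b where b: "b \<in> ?K" "\<forall>x\<in>?K. x \<le> b"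
    using compact_attains_sup[OF K(1) insert_not_empty] by blast
  have sub: "{x. \<psi> x \<noteq> 0} \<subseteq> ?K" using closure_subset[of "{x. \<psi> x \<noteq> 0}"] by auto
  have "\<forall>x. x \<notin> {a..b} \<longrightarrow> \<psi> x = 0"
  proof (intro allI impI)
    fix x assume x: "x \<notin> {a..b}"
    hence "x \<notin> ?K" using a(2) b(2) by (meson atLeastAtMost_iff)
    thus "\<psi> x = 0" using sub by (meson mem_Collect_eq subsetD)
  qed
  moreover have "0 < a" "b < 1" using a(1) b(1) K(2) by (meson greaterThanLessThan_iff subsetD)+
  moreover have "a < b"
  proof -
    have "a \<le> 1/3" using a(2) by (meson insertI1)
    moreover have "2/3 \<le> b" using b(2) by (meson insertI1 insertI2)
    ultimately show ?thesis by simp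
  qed
  ultimately show "\<exists>a b. 0 < a \<and> a < b \<and> b < 1 \<and> (\<forall>x. x \<notin> {a..b} \<longrightarrow> \<psi> x = 0)" by (intro exI conjI)
next
  assume "smooth \<psi> \<and> (\<exists>a b. 0 < a \<and> a < b \<and> b < 1 \<and> (\<forall>x. x \<notin> {a..b} \<longrightarrow> \<psi> x = 0))"
  then obtain a b where *: "smooth \<psi>" "0 < a" "b < 1" "\<forall>x. x \<notin> {a..b} \<longrightarrow> \<psi> x = 0" by (elim conjE exE)
  have "{x. \<psi> x \<noteq> 0} \<subseteq> {a..b}" using *(4) by (auto simp del: atLeastAtMost_iff)
  hence cl: "closure {x. \<psi> x \<noteq> 0} \<subseteq> {a..b}"
    by (rule closure_minimal) simp
  moreover have "{a..b} \<subseteq> {0<..<1}" using * by auto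
  moreover have "compact (closure {x. \<psi> x \<noteq> 0})"
    using compact_Int_closed[OF compact_Icc closed_closure, of a b "{x. \<psi> x \<noteq> 0}"] cl
    by (simp add: Int_absorb1)
  ultimately show "test_fun {0<..<1} \<psi>"
    using *(1) unfolding test_fun_def smooth_def by (meson order_trans)
qed

lemma test_fun_smooth: "test_fun {0<..<1} \<psi> \<Longrightarrow> smooth \<psi>"
  by (simp add: test_fun_iff)

lemma test_fun_support:
  assumes "test_fun {0<..<1} \<psi>"
  shows "\<exists>a b. 0 < a \<and> a < b \<and> b < 1 \<and> (\<forall>x. x \<notin> {a..b} \<longrightarrow> \<psi> x = 0 \<and> deriv \<psi> x = 0)"
proof -
  obtain a b where *: "0 < a" "a < b" "b < 1" "\<forall>x. x \<notin> {a..b} \<longrightarrow> \<psi> x = 0"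
    using assms unfolding test_fun_iff by (elim conjE exE)
  have d: "deriv \<psi> x = 0" if "x \<notin> {a..b}" for x
  proof -
    have "open (- {a..b})" by (rule open_Compl) simp
    hence "\<forall>\<^sub>F y in nhds x. y \<in> - {a..b}" using that by (intro eventually_nhds_in_open) auto
    hence "\<forall>\<^sub>F y in nhds x. \<psi> y = 0" by eventually_elim (use *(4) in auto)
    hence "deriv \<psi> x = deriv (\<lambda>x. 0) x" by (rule deriv_cong_ev) simp
    thus ?thesis by simp
  qed
  thus ?thesis using * by (intro exI[of _ a] exI[of _ b]) simp
qed

text \<open>The fundamental theorem is applied on [a/2, (b+1)/2], whose ends lie off [a, b], so both
  boundary values vanish. Differentiability is asked only inside (0,1), which admits the singular
  factors p of Picone's identity.\<close>

lemma integral_deriv_eq_0: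
  assumes ab: "0 < a" "a < b" "b < 1"
    and F: "\<And>x. 0 < x \<Longrightarrow> x < 1 \<Longrightarrow> (F has_real_derivative F' x) (at x)"
    and c: "continuous_on {0<..<1} F'"
    and z: "\<And>x. x \<notin> {a..b} \<Longrightarrow> F x = 0" "\<And>x. x \<notin> {a..b} \<Longrightarrow> F' x = 0"
  shows "integrable I01 F' \<and> integral\<^sup>L I01 F' = 0"
proof
  have "compact (F' ` {a..b})"
    using ab by (intro compact_continuous_image continuous_on_subset[OF c]) auto
  then obtain B where B: "\<And>x. x \<in> {a..b} \<Longrightarrow> \<bar>F' x\<bar> \<le> B"
    using compact_imp_bounded bounded_iff by (metis imageI real_norm_def)
  hence "\<bar>F' x\<bar> \<le> max B 0" for x
    using z(2)[of x] by (cases "x \<in> {a..b}") (auto simp: le_max_iff_disj)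
  thus "integrable I01 F'"
    by (intro integrable_I01_bounded[where B = "max B 0"] continuous_measurable_I01 c) auto
  note i = this
  have "(F' has_integral F ((b + 1) / 2) - F (a / 2)) {a / 2..(b + 1) / 2}"
  proof (rule fundamental_theorem_of_calculus)
    fix x assume "x \<in> {a / 2..(b + 1) / 2}"
    hence "(F has_vector_derivative F' x) (at x)"
      using F[of x] ab by (simp add: has_real_derivative_iff_has_vector_derivative)
    thus "(F has_vector_derivative F' x) (at x within {a / 2..(b + 1) / 2})"
      by (rule has_vector_derivative_at_within)
  qed (use ab in simp)
  moreover have "F ((b + 1) / 2) = 0" "F (a / 2) = 0" using ab by (auto intro!: z)
  ultimately have "(F' has_integral 0) {a / 2..(b + 1) / 2}" by simp
  hence "(F' has_integral 0) {0<..<1}"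
    by (rule has_integral_on_superset) (use ab in \<open>auto intro!: z(2)\<close>)
  moreover have "(F' has_integral integral\<^sup>L I01 F') {0<..<1}"
    by (rule has_integral_integral_lebesgue_on[OF i]) simp
  ultimately show "integral\<^sup>L I01 F' = 0" by (metis has_integral_unique)
qed

lemma integral_by_parts_test:
  assumes t: "test_fun {0<..<1} \<psi>"
    and v: "\<And>x. 0 < x \<Longrightarrow> x < 1 \<Longrightarrow> (v has_real_derivative v' x) (at x)"
    and c: "continuous_on {0<..<1} v'"
    and i: "integrable I01 (\<lambda>x. v x * deriv \<psi> x)" "integrable I01 (\<lambda>x. v' x * \<psi> x)"
  shows "(LINT x|I01. v x * deriv \<psi> x) = - (LINT x|I01. v' x * \<psi> x)"
proof -
  obtain a b where ab: "0 < a" "a < b" "b < 1"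
    "\<forall>x. x \<notin> {a..b} \<longrightarrow> \<psi> x = 0 \<and> deriv \<psi> x = 0" using test_fun_support[OF t] by blast
  have sm: "smooth \<psi>" by (rule test_fun_smooth[OF t])
  have cv: "continuous_on {0<..<1} v"
    using DERIV_isCont[OF v] by (intro continuous_at_imp_continuous_on) auto
  have "integrable I01 (\<lambda>x. v x * deriv \<psi> x + v' x * \<psi> x) \<and>
      integral\<^sup>L I01 (\<lambda>x. v x * deriv \<psi> x + v' x * \<psi> x) = 0"
  proof (rule integral_deriv_eq_0[OF ab(1-3), of "\<lambda>x. v x * \<psi> x"])
    show "((\<lambda>x. v x * \<psi> x) has_real_derivative v x * deriv \<psi> x + v' x * \<psi> x) (at x)"
      if "0 < x" "x < 1" for x
      by (rule DERIV_mult'[OF v[OF that] smooth_has_deriv[OF sm]])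
    show "continuous_on {0<..<1} (\<lambda>x. v x * deriv \<psi> x + v' x * \<psi> x)"
      by (intro continuous_intros cv c smooth_continuous_on smooth_deriv sm)
  qed (use ab in auto)
  thus ?thesis using i by simp
qed

text \<open>Picone's identity: expand \<open>(\<psi>' + p \<psi>)\<^sup>2 \<ge> 0\<close> and integrate \<open>(p \<psi>\<^sup>2)'\<close> to zero.\<close>

lemma picone:
  assumes t: "test_fun {0<..<1} \<psi>"
    and p: "\<And>x. 0 < x \<Longrightarrow> x < 1 \<Longrightarrow> (p has_real_derivative p' x) (at x)"
    and c: "continuous_on {0<..<1} p'"
    and Q: "Q \<in> borel_measurable I01" "\<And>x. 0 < x \<Longrightarrow> x < 1 \<Longrightarrow> Q x \<le> p' x - (p x)\<^sup>2"
      "AE x in I01. \<bar>Q x\<bar> \<le> N"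
  shows "(LINT x|I01. Q x * (\<psi> x)\<^sup>2) \<le> (LINT x|I01. (deriv \<psi> x)\<^sup>2)"
proof -
  obtain a b where ab: "0 < a" "a < b" "b < 1"
    "\<forall>x. x \<notin> {a..b} \<longrightarrow> \<psi> x = 0 \<and> deriv \<psi> x = 0" using test_fun_support[OF t] by blast
  have sm: "smooth \<psi>" by (rule test_fun_smooth[OF t])
  have cp: "continuous_on {0<..<1} p"
    using DERIV_isCont[OF p] by (intro continuous_at_imp_continuous_on) auto
  let ?D = "\<lambda>x. p x * (2 * \<psi> x * deriv \<psi> x) + p' x * (\<psi> x)\<^sup>2"
  have D: "integrable I01 ?D \<and> integral\<^sup>L I01 ?D = 0"
  proof (rule integral_deriv_eq_0[OF ab(1-3), of "\<lambda>x. p x * (\<psi> x)\<^sup>2"])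
    fix x :: real assume x: "0 < x" "x < 1"
    have "((\<lambda>x. (\<psi> x)\<^sup>2) has_real_derivative 2 * \<psi> x * deriv \<psi> x) (at x)"
      using DERIV_power[OF smooth_has_deriv[OF sm], of 2 x] by (simp add: ac_simps)
    from DERIV_mult'[OF p[OF x] this]
    show "((\<lambda>x. p x * (\<psi> x)\<^sup>2) has_real_derivative ?D x) (at x)" .
  next
    show "continuous_on {0<..<1} ?D"
      by (intro continuous_intros cp c smooth_continuous_on smooth_deriv sm)
  qed (use ab in auto)
  have i1: "integrable I01 (\<lambda>x. (deriv \<psi> x)\<^sup>2)"
    using test_fun_sq_int[OF t] by (simp add: sq_int_def)
  have i2: "integrable I01 (\<lambda>x. Q x * (\<psi> x)\<^sup>2)"
    using sq_int_mult[OF sq_int_mult_bounded[OF test_fun_sq_int(1)[OF t] Q(1,3)] test_fun_sq_int(1)[OF t]]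
    by (simp add: power2_eq_square mult.assoc)
  have "(LINT x|I01. Q x * (\<psi> x)\<^sup>2) \<le> (LINT x|I01. (deriv \<psi> x)\<^sup>2 + ?D x)"
  proof (rule integral_mono[OF i2 Bochner_Integration.integrable_add[OF i1 conjunct1[OF D]]])
    fix x assume "x \<in> space I01"
    hence "Q x * (\<psi> x)\<^sup>2 \<le> (p' x - (p x)\<^sup>2) * (\<psi> x)\<^sup>2"
      using Q(2)[of x] by (intro mult_right_mono) auto
    also have "\<dots> \<le> (deriv \<psi> x)\<^sup>2 + ?D x"
      using zero_le_power2[of "deriv \<psi> x + p x * \<psi> x"]
      by (simp add: power2_eq_square algebra_simps)
    finally show "Q x * (\<psi> x)\<^sup>2 \<le> (deriv \<psi> x)\<^sup>2 + ?D x" .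
  qed
  also have "\<dots> = (LINT x|I01. (deriv \<psi> x)\<^sup>2)"
    using i1 D by simp
  finally show ?thesis .
qed

section \<open>Boundary cut-offs and density of the test functions\<close>

lemma tendsto_norm_le_L2:
  assumes "\<And>n::nat. norm (X n - u) \<le> e n" "e \<longlonglongrightarrow> 0"
  shows "X \<longlonglongrightarrow> (u::L2)"
proof -
  have "(\<lambda>n. X n - u) \<longlonglongrightarrow> 0"
    by (rule Lim_null_comparison[OF _ assms(2)]) (simp add: assms(1))
  thus ?thesis by (rule LIM_zero_cancel)
qed

lemma inner_abs_right:
  assumes "sq_int I01 f"
  shows "inner u (abs_L2 f) = (LINT x|I01. rep_L2 u x * f x)"
  using inner_abs_L2[OF sq_int_rep_L2[of u] assms] by simp

text \<open>The slope of the cut-off is of order m, but it lives within distance 2/m of the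
  boundary. Hence slope times distance to the boundary stays bounded uniformly in n, which is what
  lets functions vanishing linearly at the boundary be truncated in H^1.\<close>

lemma cutoff:
  "\<exists>\<eta> C. (\<forall>n. smooth (\<eta> n)) \<and> (\<forall>n x. 0 \<le> \<eta> n x \<and> \<eta> n x \<le> (1::real)) \<and>
     (\<forall>n. \<exists>a b. 0 < a \<and> a < b \<and> b < 1 \<and> (\<forall>x. x \<notin> {a..b} \<longrightarrow> \<eta> n x = 0)) \<and>
     (\<forall>x. 0 < x \<longrightarrow> x < 1 \<longrightarrow> (\<forall>\<^sub>F n in sequentially. \<eta> n x = 1 \<and> deriv (\<eta> n) x = 0)) \<and>
     (\<forall>n x. 0 < x \<longrightarrow> x < 1 \<longrightarrow> \<bar>deriv (\<eta> n) x\<bar> * min x (1 - x) \<le> C)"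
proof -
  obtain E C where sE: "smooth E" and E: "\<forall>x\<le>0. E x = 0" "\<forall>x\<ge>1. E x = 1"
    "\<forall>x. 0 \<le> E x \<and> E x \<le> 1" "\<forall>x. \<bar>deriv E x\<bar> \<le> C" using smooth_step by blast
  have C0: "0 \<le> C" using E(4) abs_ge_zero order_trans by blast
  \<comment> \<open>At such points \<open>E\<close> attains its minimum 0 or its maximum 1. This
    covers y = 0 and y = 1 as well, where \<open>E\<close> is not constant on both sides.\<close>
  have dE: "deriv E y = 0" if "y \<le> 0 \<or> 1 \<le> y" for y
    using that
  proof
    assume "y \<le> 0"
    thus ?thesis
      using DERIV_local_min[OF smooth_has_deriv[OF sE, of y] zero_less_one] E by auto
  next
    assume "1 \<le> y"
    thus ?thesis
      using DERIV_local_max[OF smooth_has_deriv[OF sE, of y] zero_less_one] E by auto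
  qed
  \<comment> \<open>The offset 3 gives m > 2, so that 1/m < 1 - 1/m already for n = 0.\<close>
  define m where "m n = real n + 3" for n :: nat
  have m3: "3 \<le> m n" for n by (simp add: m_def)
  define \<eta> where "\<eta> n x = E (m n * x + (-1)) * E ((- m n) * x + (m n - 1))" for n x
  have sm: "smooth (\<eta> n)" for n
    unfolding \<eta>_def by (intro smooth_mult smooth_compose[OF sE] smooth_affine)
  have aff: "((\<lambda>x. c * x + d) has_real_derivative c) (at x)" for c d x :: real
    by (auto intro!: derivative_eq_intros)
  have d\<eta>: "deriv (\<eta> n) x = E (m n * x + (-1)) * (deriv E ((- m n) * x + (m n - 1)) * (- m n))
      + (deriv E (m n * x + (-1)) * m n) * E ((- m n) * x + (m n - 1))" for n x
    unfolding \<eta>_def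
    by (intro DERIV_imp_deriv DERIV_mult' DERIV_chain2[OF smooth_has_deriv[OF sE] aff])
  have scaled: "\<bar>deriv E (m n * y - 1) * m n\<bar> * y \<le> 2 * C" if "0 < y" for n y
  proof (cases "m n * y - 1 \<ge> 1")
    case True thus ?thesis using dE C0 by simp
  next
    case False
    have "\<bar>deriv E (m n * y - 1) * m n\<bar> * y = \<bar>deriv E (m n * y - 1)\<bar> * (m n * y)"
      using m3[of n] by (simp add: abs_mult)
    also have "\<dots> \<le> C * 2"
      using False E(4) C0 that m3[of n] by (intro mult_mono) auto
    finally show ?thesis by simp
  qed
  show ?thesis
  proof (intro exI conjI allI impI)
    show "smooth (\<eta> n)" for n by (rule sm)
    show "0 \<le> \<eta> n x" "\<eta> n x \<le> 1" for n x
      using E(3) by (auto simp: \<eta>_def intro: mult_le_one)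
    fix n
    show "0 < 1 / m n" "1 / m n < 1 - 1 / m n" "1 - 1 / m n < 1"
      using m3[of n] by (auto simp: field_simps)
    fix x assume "x \<notin> {1 / m n..1 - 1 / m n}"
    hence "m n * x + (-1) \<le> 0 \<or> (- m n) * x + (m n - 1) \<le> 0"
      using m3[of n] by (auto simp: field_simps)
    thus "\<eta> n x = 0" using E(1) by (auto simp: \<eta>_def)
  next
    fix x :: real assume x: "0 < x" "x < 1"
    obtain N :: nat where N: "2 / x < real N" using reals_Archimedean2 by blast
    obtain M :: nat where M: "2 / (1 - x) < real M" using reals_Archimedean2 by blast
    show "\<forall>\<^sub>F n in sequentially. \<eta> n x = 1 \<and> deriv (\<eta> n) x = 0"
      using eventually_ge_at_top[of "max N M"]
    proof eventually_elim
      case (elim n)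
      have "2 / x < m n" "2 / (1 - x) < m n" using N M elim by (auto simp: m_def)
      hence *: "1 \<le> m n * x + (-1)" "1 \<le> (- m n) * x + (m n - 1)"
        using x by (auto simp: field_simps)
      show ?case using * E(2) dE by (simp add: d\<eta>) (simp add: \<eta>_def)
    qed
  next
    fix n and x :: real assume x: "0 < x" "x < 1"
    let ?A = "E (m n * x + (-1))" and ?B = "E ((- m n) * x + (m n - 1))"
    let ?a = "deriv E (m n * x + (-1)) * m n" and ?b = "deriv E ((- m n) * x + (m n - 1)) * (- m n)"
    have "\<bar>?a\<bar> * x \<le> 2 * C" using scaled[of x n] x by simp
    moreover have "\<bar>?b\<bar> * (1 - x) \<le> 2 * C"
      using scaled[of "1 - x" n] x by (simp add: algebra_simps abs_minus_commute)
    moreover have "\<bar>?a\<bar> * min x (1 - x) \<le> \<bar>?a\<bar> * x" "\<bar>?b\<bar> * min x (1 - x) \<le> \<bar>?b\<bar> * (1 - x)"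
      by (intro mult_left_mono; simp)+
    ultimately have ab: "(\<bar>?a\<bar> + \<bar>?b\<bar>) * min x (1 - x) \<le> 4 * C"
      by (simp only: distrib_right)
    have "\<bar>deriv (\<eta> n) x\<bar> \<le> \<bar>?A * ?b\<bar> + \<bar>?a * ?B\<bar>"
      unfolding d\<eta> by (rule abs_triangle_ineq)
    also have "\<dots> = ?A * \<bar>?b\<bar> + \<bar>?a\<bar> * ?B"
      using E(3) by (simp only: abs_mult abs_of_nonneg)
    also have "\<dots> \<le> \<bar>?b\<bar> + \<bar>?a\<bar>"
      using E(3) by (intro add_mono mult_left_le mult_left_le_one_le) auto
    finally have "\<bar>deriv (\<eta> n) x\<bar> * min x (1 - x) \<le> (\<bar>?a\<bar> + \<bar>?b\<bar>) * min x (1 - x)"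
      using x by (intro mult_right_mono) auto
    with ab show "\<bar>deriv (\<eta> n) x\<bar> * min x (1 - x) \<le> 4 * C" by linarith
  qed
qed

lemma smooth_bounded_01:
  assumes "smooth f"
  obtains B where "\<forall>x\<in>{0..1}. \<bar>f x\<bar> \<le> B"
proof -
  have "compact (f ` {0..1})"
    using smooth_continuous_on[OF assms] compact_continuous_image compact_Icc by blast
  thus thesis using that compact_imp_bounded bounded_iff by (metis imageI real_norm_def)
qed

text \<open>Multiply by the cut-offs and use dominated convergence. For the derivatives the
  dangerous term is v times the slope of the cut-off; if v vanishes at both ends, the mean value
  inequality bounds |v| by a multiple of the distance to the boundary, which compensates the
  slope.\<close>

lemma smooth_test_approx:
  assumes "smooth v"
  shows "\<exists>\<phi>. (\<forall>n. test_fun {0<..<1} (\<phi> n)) \<and> (\<lambda>n. abs_L2 (\<phi> n)) \<longlonglongrightarrow> abs_L2 v \<and>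
    (v 0 = 0 \<and> v 1 = 0 \<longrightarrow> (\<lambda>n. abs_L2 (deriv (\<phi> n))) \<longlonglongrightarrow> abs_L2 (deriv v))"
proof -
  obtain \<eta> C where e: "\<forall>n. smooth (\<eta> n)" "\<forall>n x. 0 \<le> \<eta> n x \<and> \<eta> n x \<le> (1::real)"
     "\<forall>n. \<exists>a b. 0 < a \<and> a < b \<and> b < 1 \<and> (\<forall>x. x \<notin> {a..b} \<longrightarrow> \<eta> n x = 0)"
     "\<forall>x. 0 < x \<longrightarrow> x < 1 \<longrightarrow> (\<forall>\<^sub>F n in sequentially. \<eta> n x = 1 \<and> deriv (\<eta> n) x = 0)"
     "\<forall>n x. 0 < x \<longrightarrow> x < 1 \<longrightarrow> \<bar>deriv (\<eta> n) x\<bar> * min x (1 - x) \<le> C"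
    using cutoff by (elim exE conjE)
  have se: "smooth (\<eta> n)" for n using e(1) by blast
  define \<phi> where "\<phi> n x = v x * \<eta> n x" for n x
  have s: "smooth (\<phi> n)" for n unfolding \<phi>_def by (intro smooth_mult assms se)
  have t: "test_fun {0<..<1} (\<phi> n)" for n
  proof -
    obtain a b where "0 < a \<and> a < b \<and> b < 1 \<and> (\<forall>x. x \<notin> {a..b} \<longrightarrow> \<eta> n x = 0)"
      using e(3) by blast
    hence "0 < a \<and> a < b \<and> b < 1 \<and> (\<forall>x. x \<notin> {a..b} \<longrightarrow> \<phi> n x = 0)" by (simp add: \<phi>_def)
    thus ?thesis unfolding test_fun_iff using s by blast
  qed
  have d: "deriv (\<phi> n) x = v x * deriv (\<eta> n) x + deriv v x * \<eta> n x" for n x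
    unfolding \<phi>_def
    by (intro DERIV_imp_deriv DERIV_mult' smooth_has_deriv[OF assms] smooth_has_deriv se)
  obtain B where B: "\<forall>x\<in>{0..1}. \<bar>v x\<bar> \<le> B" using smooth_bounded_01[OF assms] by blast
  obtain M where M: "\<forall>x\<in>{0..1}. \<bar>deriv v x\<bar> \<le> M" using smooth_bounded_01[OF smooth_deriv[OF assms]] by blast
  have "(\<lambda>n. abs_L2 (\<phi> n)) \<longlonglongrightarrow> abs_L2 v"
  proof (rule tendsto_abs_L2_dominated)
    show "AE x in I01. (\<lambda>n. \<phi> n x) \<longlonglongrightarrow> v x"
    proof (rule AE_I01_I)
      fix x :: real assume "0 < x" "x < 1"
      with e(4) have "\<forall>\<^sub>F n in sequentially. \<eta> n x = 1 \<and> deriv (\<eta> n) x = 0" by blast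
      hence "\<forall>\<^sub>F n in sequentially. \<phi> n x = v x" by eventually_elim (simp add: \<phi>_def)
      thus "(\<lambda>n. \<phi> n x) \<longlonglongrightarrow> v x" by (rule tendsto_eventually)
    qed
    show "AE x in I01. \<bar>\<phi> n x\<bar> \<le> B" for n
    proof (rule AE_I01_I)
      fix x :: real assume "0 < x" "x < 1"
      hence "\<bar>v x\<bar> \<le> B" using B by simp
      thus "\<bar>\<phi> n x\<bar> \<le> B" using e(2) mult_left_le[of "\<eta> n x" "\<bar>v x\<bar>"]
        by (simp add: \<phi>_def abs_mult)
    qed
  qed (intro sq_int_smooth s assms)+
  moreover have "(\<lambda>n. abs_L2 (deriv (\<phi> n))) \<longlonglongrightarrow> abs_L2 (deriv v)" if v0: "v 0 = 0" "v 1 = 0"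
  proof (rule tendsto_abs_L2_dominated)
    have M0: "0 \<le> M" using M[rule_format, of 0] by simp
    have lip: "\<bar>v x - v y\<bar> \<le> M * \<bar>x - y\<bar>" if "x \<in> {0..1}" "y \<in> {0..1}" for x y
    proof -
      have "norm (v x - v y) \<le> M * norm (x - y)"
        by (rule field_differentiable_bound[of "{0..1}" v "deriv v"])
           (use that M in \<open>auto intro!: has_field_derivative_at_within smooth_has_deriv assms\<close>)
      thus ?thesis by simp
    qed
    have vmin: "\<bar>v x\<bar> \<le> M * min x (1 - x)" if "0 < x" "x < 1" for x
      using lip[of x 0] lip[of x 1] that v0 by (auto simp: min_def)
    show "AE x in I01. (\<lambda>n. deriv (\<phi> n) x) \<longlonglongrightarrow> deriv v x"
    proof (rule AE_I01_I)
      fix x :: real assume "0 < x" "x < 1"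
      with e(4) have "\<forall>\<^sub>F n in sequentially. \<eta> n x = 1 \<and> deriv (\<eta> n) x = 0" by blast
      hence "\<forall>\<^sub>F n in sequentially. deriv (\<phi> n) x = deriv v x" by eventually_elim (simp add: d)
      thus "(\<lambda>n. deriv (\<phi> n) x) \<longlonglongrightarrow> deriv v x" by (rule tendsto_eventually)
    qed
    show "AE x in I01. \<bar>deriv (\<phi> n) x\<bar> \<le> M * C + M" for n
    proof (rule AE_I01_I)
      fix x :: real assume x: "0 < x" "x < 1"
      have "\<bar>deriv v x\<bar> \<le> M" using M x by simp
      hence "\<bar>deriv v x * \<eta> n x\<bar> \<le> M" using e(2) mult_left_le[of "\<eta> n x" "\<bar>deriv v x\<bar>"]
        by (simp add: abs_mult)
      moreover have "\<bar>v x * deriv (\<eta> n) x\<bar> \<le> M * C"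
      proof -
        have "\<bar>v x * deriv (\<eta> n) x\<bar> \<le> (M * min x (1 - x)) * \<bar>deriv (\<eta> n) x\<bar>"
          using vmin[OF x] by (simp add: abs_mult mult_right_mono)
        also have "\<dots> = M * (\<bar>deriv (\<eta> n) x\<bar> * min x (1 - x))" by simp
        also have "\<dots> \<le> M * C" using e(5) x M0 by (intro mult_left_mono) auto
        finally show ?thesis .
      qed
      ultimately show "\<bar>deriv (\<phi> n) x\<bar> \<le> M * C + M" unfolding d by linarith
    qed
  qed (intro sq_int_smooth smooth_deriv s assms)+
  ultimately show ?thesis using t by blast
qed

lemma smooth_real_polynomial:
  fixes p :: "real \<Rightarrow> real"
  assumes "real_polynomial_function p"
  shows "smooth p"
  using assms
proof induction
  case (linear f)
  then obtain c where "f = (\<lambda>x. x * c)" using real_bounded_linear by blast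
  thus ?case using smooth_cmult[OF smooth_ident, of c] by (simp add: mult.commute)
qed (auto intro: smooth_const smooth_add smooth_mult)

text \<open>Orthogonality spreads from test functions to smooth functions by cut-offs, to continuous
  functions by Weierstrass approximation, and finally to the sign of u. The last case says that the
  L^1 norm of u is 0.\<close>

lemma test_fun_separating:
  assumes u: "\<And>\<psi>. test_fun {0<..<1} \<psi> \<Longrightarrow> inner u (abs_L2 \<psi>) = 0"
  shows "u = 0"
proof -
  have lim: "inner u w = 0" if "X \<longlonglongrightarrow> w" "\<And>n::nat. inner u (X n) = 0" for X w
  proof -
    have "(\<lambda>n. inner u (X n)) \<longlonglongrightarrow> inner u w" by (intro tendsto_intros that)
    thus ?thesis using that(2) by (simp add: LIMSEQ_const_iff)
  qed
  have sm: "inner u (abs_L2 p) = 0" if p: "smooth p" for p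
  proof -
    obtain \<phi> where "\<forall>n. test_fun {0<..<1} (\<phi> n)" "(\<lambda>n. abs_L2 (\<phi> n)) \<longlonglongrightarrow> abs_L2 p"
      using smooth_test_approx[OF p] by blast
    thus ?thesis using lim u by blast
  qed
  have cont: "inner u (abs_L2 g) = 0" if g: "continuous_on UNIV g" for g :: "real \<Rightarrow> real"
  proof -
    have g01: "continuous_on {0..1} g" by (rule continuous_on_subset[OF g]) simp
    have "\<exists>p. real_polynomial_function p \<and> (\<forall>x\<in>{0..1}. \<bar>g x - p x\<bar> < 1 / real (Suc n))" for n
      using Stone_Weierstrass_real_polynomial_function[OF compact_Icc g01, of "1 / real (Suc n)"]
      by (metis of_nat_0_less_iff zero_less_Suc zero_less_divide_1_iff)
    then obtain p where p: "\<And>n. real_polynomial_function (p n)"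
      "\<And>n. \<forall>x\<in>{0..1}. \<bar>g x - p n x\<bar> < 1 / real (Suc n)" by metis
    have sp: "smooth (p n)" for n by (rule smooth_real_polynomial[OF p(1)])
    have "norm (abs_L2 (p n) - abs_L2 g) \<le> 1 / real (Suc n)" for n
    proof (rule norm_L2_le_const)
      have sq: "sq_int I01 (\<lambda>x. p n x - g x)"
        by (intro sq_int_diff sq_int_smooth sp sq_int_continuous g01)
      have "AE x in I01. \<bar>p n x - g x\<bar> \<le> 1 / real (Suc n)"
      proof (rule AE_I01_I)
        fix x :: real assume "0 < x" "x < 1"
        hence "\<bar>g x - p n x\<bar> < 1 / real (Suc n)" using p(2)[of n] by simp
        thus "\<bar>p n x - g x\<bar> \<le> 1 / real (Suc n)" by (simp add: abs_minus_commute)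
      qed
      thus "AE x in I01. \<bar>rep_L2 (abs_L2 (p n) - abs_L2 g) x\<bar> \<le> 1 / real (Suc n)"
        unfolding abs_L2_diff[OF sq_int_smooth[OF sp] sq_int_continuous[OF g01]]
        using rep_abs_L2[OF sq] by eventually_elim simp
    qed simp
    hence "(\<lambda>n. abs_L2 (p n)) \<longlonglongrightarrow> abs_L2 g"
      by (rule tendsto_norm_le_L2) (use LIMSEQ_inverse_real_of_nat in \<open>simp add: inverse_eq_divide\<close>)
    thus ?thesis using lim sm[OF sp] by blast
  qed
  let ?s = "\<lambda>x. sgn (rep_L2 u x)"
  have "(sgn :: real \<Rightarrow> real) \<in> borel_measurable borel"
    unfolding sgn_real_def[abs_def] by measurable
  from measurable_compose[OF sq_int_measurable[OF sq_int_rep_L2[of u]] this]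
  have sm': "?s \<in> borel_measurable I01" .
  hence "?s measurable_on {0<..<1}"
    by (subst measurable_on_iff_borel_measurable) auto
  then obtain N g where N: "negligible N" and g: "\<And>n::nat. continuous_on UNIV (g n)"
    and gl: "\<And>x. x \<notin> N \<Longrightarrow> (\<lambda>n. g n x) \<longlonglongrightarrow> (if x \<in> {0<..<1} then ?s x else 0)"
    unfolding measurable_on_def by blast
  \<comment> \<open>Truncation to [-1,1] supplies the uniform bound for dominated convergence and
    does not disturb the limit, a sign.\<close>
  define h where "h n x = max (-1) (min 1 (g n x))" for n x
  have ch: "continuous_on UNIV (h n)" for n
    unfolding h_def by (intro continuous_intros g)
  have sqs: "sq_int I01 ?s" by (rule sq_int_bounded[OF sm', of 1]) (simp add: sgn_real_def)
  have "(\<lambda>n. abs_L2 (h n)) \<longlonglongrightarrow> abs_L2 ?s"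
  proof (rule tendsto_abs_L2_dominated[OF _ sqs])
    show "sq_int I01 (h n)" for n
      by (intro sq_int_continuous continuous_on_subset[OF ch]) auto
    have "AE x in lebesgue. x \<notin> N"
      using N by (simp add: negligible_iff_null_sets AE_not_in)
    hence "AE x in I01. x \<notin> N" by (subst AE_restrict_space_iff) auto
    thus "AE x in I01. (\<lambda>n. h n x) \<longlonglongrightarrow> ?s x"
    proof (rule AE_mp, intro AE_I2 impI)
      fix x assume "x \<in> space I01" "x \<notin> N"
      hence "(\<lambda>n. g n x) \<longlonglongrightarrow> ?s x" using gl[of x] by simp
      hence "(\<lambda>n. h n x) \<longlonglongrightarrow> max (-1) (min 1 (?s x))"
        unfolding h_def by (intro tendsto_intros)
      thus "(\<lambda>n. h n x) \<longlonglongrightarrow> ?s x" by (simp add: sgn_real_def split: if_splits)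
    qed
    show "AE x in I01. \<bar>h n x\<bar> \<le> 1" for n by (simp add: h_def)
  qed
  hence "inner u (abs_L2 ?s) = 0" by (rule lim) (rule cont[OF ch])
  hence "(LINT x|I01. \<bar>rep_L2 u x\<bar>) = 0"
    by (simp add: inner_abs_right[OF sqs] abs_sgn)
  moreover have "integrable I01 (\<lambda>x. \<bar>rep_L2 u x\<bar>)"
    using sq_int_mult[OF sq_int_rep_L2[of u] sqs] by (simp add: abs_sgn)
  ultimately have "AE x in I01. \<bar>rep_L2 u x\<bar> = 0"
    by (subst (asm) integral_nonneg_eq_0_iff_AE) auto
  hence "AE x in I01. rep_L2 u x = rep_L2 0 x" using rep_L2_zero by eventually_elim simp
  thus "u = 0" by (rule L2_eqI_AE)
qed

section \<open>Weak derivatives and the Dirichlet Laplacian\<close>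

lemma wderiv_L2_iff:
  "wderiv_L2 v g \<longleftrightarrow> (\<forall>\<psi>. test_fun {0<..<1} \<psi> \<longrightarrow>
     inner v (abs_L2 (deriv \<psi>)) = - inner g (abs_L2 \<psi>))"
  unfolding wderiv_L2_def has_weak_deriv_def
  by (auto simp: inner_abs_right test_fun_sq_int)

lemma wderiv_unique:
  assumes "wderiv_L2 v g" "wderiv_L2 v g'"
  shows "g = g'"
proof -
  have "g - g' = 0"
    by (rule test_fun_separating) (use assms in \<open>auto simp: wderiv_L2_iff inner_diff_left\<close>)
  thus ?thesis by simp
qed

lemma wderiv_add: "wderiv_L2 v g \<Longrightarrow> wderiv_L2 v' g' \<Longrightarrow> wderiv_L2 (v + v') (g + g')"
  by (auto simp: wderiv_L2_iff inner_add_left)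

lemma wderiv_scale: "wderiv_L2 v g \<Longrightarrow> wderiv_L2 (c *\<^sub>R v) (c *\<^sub>R g)"
  by (auto simp: wderiv_L2_iff)

lemma wderiv_limit:
  assumes "\<And>n::nat. wderiv_L2 (X n) (G n)" "X \<longlonglongrightarrow> v" "G \<longlonglongrightarrow> g"
  shows "wderiv_L2 v g"
  unfolding wderiv_L2_iff
proof (intro allI impI)
  fix \<psi> assume t: "test_fun {0<..<1} \<psi>"
  have "(\<lambda>n. inner (X n) (abs_L2 (deriv \<psi>))) \<longlonglongrightarrow> inner v (abs_L2 (deriv \<psi>))"
    by (intro tendsto_intros assms)
  moreover have "(\<lambda>n. inner (X n) (abs_L2 (deriv \<psi>))) = (\<lambda>n. - inner (G n) (abs_L2 \<psi>))"
    using assms(1) t by (auto simp: wderiv_L2_iff)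
  moreover have "(\<lambda>n. - inner (G n) (abs_L2 \<psi>)) \<longlonglongrightarrow> - inner g (abs_L2 \<psi>)"
    by (intro tendsto_intros assms)
  ultimately show "inner v (abs_L2 (deriv \<psi>)) = - inner g (abs_L2 \<psi>)"
    using LIMSEQ_unique by metis
qed

lemma wderiv_smooth:
  assumes "smooth v"
  shows "wderiv_L2 (abs_L2 v) (abs_L2 (deriv v))"
  unfolding wderiv_L2_iff
proof (intro allI impI)
  fix \<psi> assume t: "test_fun {0<..<1} \<psi>"
  note sq = sq_int_smooth[OF assms] sq_int_smooth[OF smooth_deriv[OF assms]] test_fun_sq_int[OF t]
  show "inner (abs_L2 v) (abs_L2 (deriv \<psi>)) = - inner (abs_L2 (deriv v)) (abs_L2 \<psi>)"
    unfolding inner_abs_L2[OF sq(1,4)] inner_abs_L2[OF sq(2,3)]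
    by (rule integral_by_parts_test[OF t])
       (intro smooth_has_deriv assms smooth_continuous_on smooth_deriv sq_int_mult sq)+
qed

text \<open>The approximation clause of \<open>H10_01\<close> with its derivative exposed, so that
  it can be combined linearly and passed to the limit together with the weak derivative.\<close>

definition H1_approx :: "L2 \<Rightarrow> L2 \<Rightarrow> bool" where
  "H1_approx v g \<longleftrightarrow> (\<exists>\<phi>. (\<forall>n. test_fun {0<..<1} (\<phi> n)) \<and>
          (\<lambda>n. abs_L2 (\<phi> n)) \<longlonglongrightarrow> v \<and> (\<lambda>n. abs_L2 (deriv (\<phi> n))) \<longlonglongrightarrow> g)"

text \<open>This form spares the choice of a diagonal sequence when limits of limits are
  taken.\<close>

lemma H1_approx_iff:
  "H1_approx v g \<longleftrightarrow> (\<forall>e>0. \<exists>\<psi>. test_fun {0<..<1} \<psi> \<and>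
     norm (abs_L2 \<psi> - v) < e \<and> norm (abs_L2 (deriv \<psi>) - g) < e)"
proof
  assume "H1_approx v g"
  then obtain \<phi> where p: "\<forall>n. test_fun {0<..<1} (\<phi> n)"
    "(\<lambda>n. abs_L2 (\<phi> n)) \<longlonglongrightarrow> v" "(\<lambda>n. abs_L2 (deriv (\<phi> n))) \<longlonglongrightarrow> g"
    unfolding H1_approx_def by blast
  show "\<forall>e>0. \<exists>\<psi>. test_fun {0<..<1} \<psi> \<and>
     norm (abs_L2 \<psi> - v) < e \<and> norm (abs_L2 (deriv \<psi>) - g) < e"
  proof (intro allI impI)
    fix e :: real assume e: "e > 0"
    obtain N where N: "\<And>n. n \<ge> N \<Longrightarrow> norm (abs_L2 (\<phi> n) - v) < e"
      using LIMSEQ_D[OF p(2) e] by blast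
    obtain M where M: "\<And>n. n \<ge> M \<Longrightarrow> norm (abs_L2 (deriv (\<phi> n)) - g) < e"
      using LIMSEQ_D[OF p(3) e] by blast
    show "\<exists>\<psi>. test_fun {0<..<1} \<psi> \<and> norm (abs_L2 \<psi> - v) < e \<and> norm (abs_L2 (deriv \<psi>) - g) < e"
      using N[of "max N M"] M[of "max N M"] p(1) by (intro exI[of _ "\<phi> (max N M)"]) simp
  qed
next
  assume *: "\<forall>e>0. \<exists>\<psi>. test_fun {0<..<1} \<psi> \<and>
     norm (abs_L2 \<psi> - v) < e \<and> norm (abs_L2 (deriv \<psi>) - g) < e"
  have "\<exists>\<psi>. test_fun {0<..<1} \<psi> \<and>
     norm (abs_L2 \<psi> - v) < 1 / real (Suc n) \<and> norm (abs_L2 (deriv \<psi>) - g) < 1 / real (Suc n)" for n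
    using *[rule_format, of "1 / real (Suc n)"] by simp
  then obtain \<phi> where \<phi>: "\<And>n. test_fun {0<..<1} (\<phi> n)"
     "\<And>n. norm (abs_L2 (\<phi> n) - v) < 1 / real (Suc n)"
     "\<And>n. norm (abs_L2 (deriv (\<phi> n)) - g) < 1 / real (Suc n)" by metis
  have z: "(\<lambda>n. 1 / real (Suc n)) \<longlonglongrightarrow> 0"
    using LIMSEQ_inverse_real_of_nat by (simp add: inverse_eq_divide)
  show "H1_approx v g"
    unfolding H1_approx_def
    by (intro exI[of _ \<phi>] conjI allI \<phi>(1) tendsto_norm_le_L2[OF _ z] less_imp_le \<phi>(2,3))
qed

lemma H1_approx_limit:
  assumes X: "\<And>n::nat. H1_approx (X n) (G n)" and lim: "X \<longlonglongrightarrow> v" "G \<longlonglongrightarrow> g"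
  shows "H1_approx v g"
  unfolding H1_approx_iff
proof (intro allI impI)
  fix e :: real assume e: "e > 0"
  obtain N where N: "\<And>n. n \<ge> N \<Longrightarrow> norm (X n - v) < e / 2"
    using LIMSEQ_D[OF lim(1), of "e / 2"] e by auto
  obtain M where M: "\<And>n. n \<ge> M \<Longrightarrow> norm (G n - g) < e / 2"
    using LIMSEQ_D[OF lim(2), of "e / 2"] e by auto
  let ?n = "max N M"
  obtain \<psi> where t: "test_fun {0<..<1} \<psi>" and
    n: "norm (abs_L2 \<psi> - X ?n) < e / 2" "norm (abs_L2 (deriv \<psi>) - G ?n) < e / 2"
    using X[of ?n] e unfolding H1_approx_iff by (meson half_gt_zero)
  have "norm (abs_L2 \<psi> - v) < e"
    using norm_triangle_lt[of "abs_L2 \<psi> - X ?n" "X ?n - v" e] n(1) N[of ?n] by simp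
  moreover have "norm (abs_L2 (deriv \<psi>) - g) < e"
    using norm_triangle_lt[of "abs_L2 (deriv \<psi>) - G ?n" "G ?n - g" e] n(2) M[of ?n] by simp
  ultimately show "\<exists>\<psi>. test_fun {0<..<1} \<psi> \<and> norm (abs_L2 \<psi> - v) < e \<and> norm (abs_L2 (deriv \<psi>) - g) < e"
    using t by blast
qed

section \<open>Linearity, symmetry and closedness of the Dirichlet Laplacian\<close>

lemma test_fun_linear:
  assumes "test_fun {0<..<1} \<phi>" "test_fun {0<..<1} \<psi>"
  shows "test_fun {0<..<1} (\<lambda>x. c * \<phi> x + d * \<psi> x)"
    and "abs_L2 (\<lambda>x. c * \<phi> x + d * \<psi> x) = c *\<^sub>R abs_L2 \<phi> + d *\<^sub>R abs_L2 \<psi>"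
    and "abs_L2 (deriv (\<lambda>x. c * \<phi> x + d * \<psi> x)) = c *\<^sub>R abs_L2 (deriv \<phi>) + d *\<^sub>R abs_L2 (deriv \<psi>)"
proof -
  obtain a b where ab: "0 < a" "a < b" "b < 1" "\<forall>x. x \<notin> {a..b} \<longrightarrow> \<phi> x = 0 \<and> deriv \<phi> x = 0"
    using test_fun_support[OF assms(1)] by blast
  obtain a' b' where ab': "0 < a'" "a' < b'" "b' < 1" "\<forall>x. x \<notin> {a'..b'} \<longrightarrow> \<psi> x = 0 \<and> deriv \<psi> x = 0"
    using test_fun_support[OF assms(2)] by blast
  note sm = test_fun_smooth[OF assms(1)] test_fun_smooth[OF assms(2)]
  have "\<forall>x. x \<notin> {min a a'..max b b'} \<longrightarrow> c * \<phi> x + d * \<psi> x = 0"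
  proof (intro allI impI)
    fix x assume "x \<notin> {min a a'..max b b'}"
    hence "x \<notin> {a..b}" "x \<notin> {a'..b'}" by auto
    thus "c * \<phi> x + d * \<psi> x = 0" using ab(4) ab'(4) by simp
  qed
  moreover have "0 < min a a'" "min a a' < max b b'" "max b b' < 1" using ab ab' by auto
  ultimately show "test_fun {0<..<1} (\<lambda>x. c * \<phi> x + d * \<psi> x)"
    unfolding test_fun_iff by (intro conjI smooth_add smooth_cmult sm) blast
  show "abs_L2 (\<lambda>x. c * \<phi> x + d * \<psi> x) = c *\<^sub>R abs_L2 \<phi> + d *\<^sub>R abs_L2 \<psi>"
    using sm by (simp add: abs_L2_add abs_L2_scale sq_int_smooth smooth_cmult)
  have "((\<lambda>x. c * \<phi> x + d * \<psi> x) has_real_derivative c * deriv \<phi> x + d * deriv \<psi> x) (at x)" for x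
    by (intro DERIV_add DERIV_cmult smooth_has_deriv sm)
  hence "deriv (\<lambda>x. c * \<phi> x + d * \<psi> x) = (\<lambda>x. c * deriv \<phi> x + d * deriv \<psi> x)"
    by (intro ext DERIV_imp_deriv)
  thus "abs_L2 (deriv (\<lambda>x. c * \<phi> x + d * \<psi> x)) = c *\<^sub>R abs_L2 (deriv \<phi>) + d *\<^sub>R abs_L2 (deriv \<psi>)"
    using sm by (simp add: abs_L2_add abs_L2_scale sq_int_smooth smooth_cmult smooth_deriv)
qed

lemma H1_approx_linear:
  assumes "H1_approx v g" "H1_approx w h"
  shows "H1_approx (c *\<^sub>R v + d *\<^sub>R w) (c *\<^sub>R g + d *\<^sub>R h)"
proof -
  obtain \<phi> where p: "\<forall>n. test_fun {0<..<1} (\<phi> n)"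
    "(\<lambda>n. abs_L2 (\<phi> n)) \<longlonglongrightarrow> v" "(\<lambda>n. abs_L2 (deriv (\<phi> n))) \<longlonglongrightarrow> g"
    using assms(1) unfolding H1_approx_def by blast
  obtain \<psi> where q: "\<forall>n. test_fun {0<..<1} (\<psi> n)"
    "(\<lambda>n. abs_L2 (\<psi> n)) \<longlonglongrightarrow> w" "(\<lambda>n. abs_L2 (deriv (\<psi> n))) \<longlonglongrightarrow> h"
    using assms(2) unfolding H1_approx_def by blast
  show ?thesis
    unfolding H1_approx_def
  proof (intro exI[of _ "\<lambda>n x. c * \<phi> n x + d * \<psi> n x"] conjI allI)
    note t = p(1)[rule_format] q(1)[rule_format]
    show "test_fun {0<..<1} (\<lambda>x. c * \<phi> n x + d * \<psi> n x)" for n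
      by (rule test_fun_linear(1)[OF t])
    show "(\<lambda>n. abs_L2 (\<lambda>x. c * \<phi> n x + d * \<psi> n x)) \<longlonglongrightarrow> c *\<^sub>R v + d *\<^sub>R w"
      unfolding test_fun_linear(2)[OF t] by (intro tendsto_intros p q)
    show "(\<lambda>n. abs_L2 (deriv (\<lambda>x. c * \<phi> n x + d * \<psi> n x))) \<longlonglongrightarrow> c *\<^sub>R g + d *\<^sub>R h"
      unfolding test_fun_linear(3)[OF t] by (intro tendsto_intros p q)
  qed
qed

text \<open>One and the same first derivative serves both H^2 and H_0^1. In \<open>DA\<close> the
  two memberships come with separate witnesses, which uniqueness of weak derivatives
  identifies.\<close>

definition dirichlet :: "L2 \<Rightarrow> L2 \<Rightarrow> L2 \<Rightarrow> bool" where
  "dirichlet v g h \<longleftrightarrow> wderiv_L2 v g \<and> wderiv_L2 g h \<and> H1_approx v g"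

lemma dirichlet_A_op: "dirichlet v g h \<Longrightarrow> A_op v = - h"
  unfolding A_op_def dirichlet_def by (auto intro!: the_equality dest: wderiv_unique)

lemma DA_iff: "v \<in> DA \<longleftrightarrow> (\<exists>g. dirichlet v g (- A_op v))"
proof
  assume "v \<in> DA"
  then obtain g h g' where "wderiv_L2 v g" "wderiv_L2 g h" "wderiv_L2 v g'" "H1_approx v g'"
    unfolding DA_def H2_01_def H10_01_def H1_approx_def by blast
  hence "dirichlet v g h" unfolding dirichlet_def using wderiv_unique by blast
  thus "\<exists>g. dirichlet v g (- A_op v)" using dirichlet_A_op by fastforce
next
  assume "\<exists>g. dirichlet v g (- A_op v)"
  thus "v \<in> DA"
    unfolding DA_def H2_01_def H10_01_def dirichlet_def H1_approx_def by blast
qed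

lemma dirichlet_DA: "dirichlet v g h \<Longrightarrow> v \<in> DA"
  using DA_iff dirichlet_A_op by fastforce

lemma dirichlet_linear:
  assumes "dirichlet v g h" "dirichlet v' g' h'"
  shows "dirichlet (c *\<^sub>R v + d *\<^sub>R v') (c *\<^sub>R g + d *\<^sub>R g') (c *\<^sub>R h + d *\<^sub>R h')"
  using assms unfolding dirichlet_def
  by (intro conjI wderiv_add wderiv_scale H1_approx_linear) auto

lemma DA_linear:
  assumes "v \<in> DA" "w \<in> DA"
  shows "c *\<^sub>R v + d *\<^sub>R w \<in> DA" "A_op (c *\<^sub>R v + d *\<^sub>R w) = c *\<^sub>R A_op v + d *\<^sub>R A_op w"
proof -
  obtain g h where "dirichlet v g (- A_op v)" "dirichlet w h (- A_op w)"
    using assms DA_iff by blast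
  from dirichlet_linear[OF this, of c d] show
    "c *\<^sub>R v + d *\<^sub>R w \<in> DA" "A_op (c *\<^sub>R v + d *\<^sub>R w) = c *\<^sub>R A_op v + d *\<^sub>R A_op w"
    using dirichlet_DA dirichlet_A_op by fastforce+
qed

lemma DA_diff:
  assumes "v \<in> DA" "w \<in> DA"
  shows "v - w \<in> DA" "A_op (v - w) = A_op v - A_op w"
  using DA_linear[OF assms, of 1 "-1"] by simp_all

lemma DA_minus:
  assumes "v \<in> DA"
  shows "- v \<in> DA" "A_op (- v) = - A_op v"
  using DA_linear[OF assms assms, of "-1" 0] by simp_all

lemma DA_smooth:
  assumes "smooth v" "v 0 = 0" "v 1 = 0"
  shows "abs_L2 v \<in> DA" "A_op (abs_L2 v) = - abs_L2 (deriv (deriv v))"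
proof -
  have "dirichlet (abs_L2 v) (abs_L2 (deriv v)) (abs_L2 (deriv (deriv v)))"
    unfolding dirichlet_def H1_approx_def
    using smooth_test_approx[OF assms(1)] assms
    by (intro conjI wderiv_smooth smooth_deriv) auto
  thus "abs_L2 v \<in> DA" "A_op (abs_L2 v) = - abs_L2 (deriv (deriv v))"
    using dirichlet_DA dirichlet_A_op by auto
qed

text \<open>Integration by parts without boundary terms: replacing w by test functions that
  approximate it in H^1 turns the claim into the definition of the weak derivative of g.\<close>

lemma dirichlet_inner:
  assumes "dirichlet v g h" "dirichlet w g' h'"
  shows "inner g g' = - inner h w"
proof -
  obtain \<phi> where p: "\<forall>n. test_fun {0<..<1} (\<phi> n)"
    "(\<lambda>n. abs_L2 (\<phi> n)) \<longlonglongrightarrow> w" "(\<lambda>n. abs_L2 (deriv (\<phi> n))) \<longlonglongrightarrow> g'"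
    using assms(2) unfolding dirichlet_def H1_approx_def by blast
  have "(\<lambda>n. inner g (abs_L2 (deriv (\<phi> n)))) \<longlonglongrightarrow> inner g g'" by (intro tendsto_intros p)
  moreover have "(\<lambda>n. inner g (abs_L2 (deriv (\<phi> n)))) = (\<lambda>n. - inner h (abs_L2 (\<phi> n)))"
    using assms(1) p(1) by (auto simp: dirichlet_def wderiv_L2_iff)
  moreover have "(\<lambda>n. - inner h (abs_L2 (\<phi> n))) \<longlonglongrightarrow> - inner h w" by (intro tendsto_intros p)
  ultimately show "inner g g' = - inner h w" using LIMSEQ_unique by metis
qed

lemma A_op_symmetric:
  assumes "v \<in> DA" "w \<in> DA"
  shows "inner (A_op v) w = inner v (A_op w)"
proof -
  obtain g h where gh: "dirichlet v g (- A_op v)" "dirichlet w h (- A_op w)" using assms DA_iff by blast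
  show ?thesis
    using dirichlet_inner[OF gh] dirichlet_inner[OF gh(2,1)] by (simp add: inner_commute)
qed

text \<open>By the energy identity and Cauchy-Schwarz, convergence of \<open>X n\<close> and of
  \<open>A_op (X n)\<close> makes the first derivatives Cauchy as well. Their limit is then the
  derivative of \<open>v\<close>, since weak derivatives and H_0^1 approximations pass to the limit.
  This is how infinite sine series enter \<open>DA\<close>.\<close>

lemma DA_closed:
  assumes X: "\<And>n::nat. X n \<in> DA" and lim: "X \<longlonglongrightarrow> v" "(\<lambda>n. A_op (X n)) \<longlonglongrightarrow> a"
  shows "v \<in> DA" "A_op v = a"
proof -
  obtain G where G: "\<And>n. dirichlet (X n) (G n) (- A_op (X n))"
  proof -
    have "\<forall>n. \<exists>g. dirichlet (X n) g (- A_op (X n))" using X by (simp add: DA_iff[symmetric])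
    thus thesis using that by metis
  qed
  have en: "(norm (G m - G n))\<^sup>2 \<le> norm (A_op (X m) - A_op (X n)) * norm (X m - X n)" for m n
  proof -
    have "dirichlet (X m - X n) (G m - G n) (- A_op (X m) + A_op (X n))"
      using dirichlet_linear[OF G[of m] G[of n], of 1 "-1"] by simp
    from dirichlet_inner[OF this this]
    have "(norm (G m - G n))\<^sup>2 = inner (A_op (X m) - A_op (X n)) (X m - X n)"
      by (simp add: inner_diff_left inner_add_left power2_norm_eq_inner)
    also have "\<dots> \<le> norm (A_op (X m) - A_op (X n)) * norm (X m - X n)"
      by (rule norm_cauchy_schwarz)
    finally show ?thesis .
  qed
  have "Cauchy G"
    unfolding Cauchy_iff
  proof (intro allI impI)
    fix e :: real assume e: "e > 0"
    obtain N where N: "\<forall>m\<ge>N. \<forall>n\<ge>N. norm (X m - X n) < e"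
      using CauchyD[OF LIMSEQ_imp_Cauchy[OF lim(1)] e] by blast
    obtain M where M: "\<forall>m\<ge>M. \<forall>n\<ge>M. norm (A_op (X m) - A_op (X n)) < e"
      using CauchyD[OF LIMSEQ_imp_Cauchy[OF lim(2)] e] by blast
    show "\<exists>M. \<forall>m\<ge>M. \<forall>n\<ge>M. norm (G m - G n) < e"
    proof (intro exI[of _ "max N M"] allI impI)
      fix m n assume "max N M \<le> m" "max N M \<le> n"
      hence "norm (X m - X n) < e" "norm (A_op (X m) - A_op (X n)) < e" using N M by auto
      hence "norm (A_op (X m) - A_op (X n)) * norm (X m - X n) < e * e"
        by (intro mult_strict_mono') auto
      hence "(norm (G m - G n))\<^sup>2 < e\<^sup>2" using en[of m n] by (simp add: power2_eq_square)
      thus "norm (G m - G n) < e" using e by (simp add: power_less_imp_less_base)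
    qed
  qed
  then obtain g where g: "G \<longlonglongrightarrow> g" using Cauchy_convergent convergent_def by blast
  have "dirichlet v g (- a)"
    unfolding dirichlet_def
  proof (intro conjI)
    show "wderiv_L2 v g" by (rule wderiv_limit[OF _ lim(1) g]) (use G in \<open>auto simp: dirichlet_def\<close>)
    show "wderiv_L2 g (- a)"
      by (rule wderiv_limit[OF _ g, of "\<lambda>n. - A_op (X n)"])
         (use G lim(2) in \<open>auto simp: dirichlet_def intro: tendsto_minus\<close>)
    show "H1_approx v g" by (rule H1_approx_limit[OF _ lim(1) g]) (use G in \<open>auto simp: dirichlet_def\<close>)
  qed
  thus "v \<in> DA" "A_op v = a" using dirichlet_DA dirichlet_A_op by fastforce+
qed

text \<open>Test functions \<open>\<phi>\<close> approximating \<open>v\<close> are composed with a smooth approximation \<open>j\<close> of the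
  positive part; since \<open>0 \<le> j' \<le> 1\<close>, one has \<open>\<langle>\<phi>', (j \<circ> \<phi>)'\<rangle> \<ge> \<parallel>(j \<circ> \<phi>)'\<parallel>\<^sup>2\<close>.\<close>

lemma DA_inner_pos:
  assumes v: "v \<in> DA" and Q: "Q \<in> borel_measurable I01" "AE x in I01. \<bar>Q x\<bar> \<le> N"
    and hardy: "\<And>\<psi>. test_fun {0<..<1} \<psi> \<Longrightarrow> (LINT x|I01. Q x * (\<psi> x)\<^sup>2) \<le> (LINT x|I01. (deriv \<psi> x)\<^sup>2)"
  shows "inner (mult_L2 Q (pos v)) (pos v) \<le> inner (A_op v) (pos v)"
proof -
  have Q': "AE x in I01. \<bar>Q x\<bar> \<le> \<bar>N\<bar>" using Q(2) by eventually_elim linarith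
  note lin = bounded_linear.tendsto[OF bounded_linear_mult_L2[OF Q(1) Q' abs_ge_zero]]
  obtain g where vd: "dirichlet v g (- A_op v)" using v DA_iff by blast
  then obtain \<phi> where p: "\<forall>n. test_fun {0<..<1} (\<phi> n)"
    "(\<lambda>n. abs_L2 (\<phi> n)) \<longlonglongrightarrow> v" "(\<lambda>n. abs_L2 (deriv (\<phi> n))) \<longlonglongrightarrow> g"
    unfolding dirichlet_def H1_approx_def by blast
  have t: "test_fun {0<..<1} (\<phi> n)" for n using p(1) by blast
  note s = test_fun_smooth[OF t]
  have approx: "\<exists>w. norm (w - pos v) \<le> \<epsilon> \<and> inner (mult_L2 Q w) w \<le> inner (A_op v) w" if \<epsilon>: "\<epsilon> > 0" for \<epsilon>
  proof -
    obtain j where j: "smooth j" "\<And>s. s \<le> 0 \<Longrightarrow> j s = 0" "\<And>s. 0 \<le> deriv j s" "\<And>s. deriv j s \<le> 1"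
      "\<And>s. \<bar>j s - max 0 s\<bar> \<le> \<epsilon>" by (rule smooth_pos_part[OF \<epsilon>]) (rule that)
    have jl: "\<bar>j s - j r\<bar> \<le> \<bar>s - r\<bar>" for s r
      using field_differentiable_bound[of UNIV j "deriv j" 1 s r] j(3,4) smooth_has_deriv[OF j(1)]
      by auto
    have jb: "j \<in> borel_measurable borel"
      by (intro borel_measurable_continuous_onI smooth_continuous_on j)
    have j0: "\<bar>j s\<bar> \<le> \<bar>s\<bar>" for s using jl[of s 0] j(2)[of 0] by simp
    define w where "w = abs_L2 (\<lambda>x. j (rep_L2 v x))"
    have sqw: "sq_int I01 (\<lambda>x. j (rep_L2 v x))"
      by (rule sq_int_lipschitz[OF sq_int_rep_L2 jb j0])
    have rw: "AE x in I01. rep_L2 w x = j (rep_L2 v x)" unfolding w_def by (rule rep_abs_L2[OF sqw])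
    have wpos: "norm (w - pos v) \<le> \<epsilon>"
    proof (rule norm_L2_le_const)
      show "AE x in I01. \<bar>rep_L2 (w - pos v) x\<bar> \<le> \<epsilon>"
        using rep_L2_diff[of w "pos v"] rw rep_pos[of v]
        by eventually_elim (use j(5) in simp)
    qed (use \<epsilon> in simp)
    define \<psi> where "\<psi> n x = j (\<phi> n x)" for n x
    have s\<psi>: "smooth (\<psi> n)" for n unfolding \<psi>_def by (rule smooth_compose[OF j(1) s])
    have t\<psi>: "test_fun {0<..<1} (\<psi> n)" for n
    proof -
      obtain a b where "0 < a \<and> a < b \<and> b < 1 \<and> (\<forall>x. x \<notin> {a..b} \<longrightarrow> \<phi> n x = 0)"
        using t[of n] by (auto simp: test_fun_iff)
      hence "0 < a \<and> a < b \<and> b < 1 \<and> (\<forall>x. x \<notin> {a..b} \<longrightarrow> \<psi> n x = 0)"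
        using j(2)[of 0] by (simp add: \<psi>_def)
      thus ?thesis unfolding test_fun_iff using s\<psi> by blast
    qed
    have d\<psi>: "deriv (\<psi> n) = (\<lambda>x. deriv j (\<phi> n x) * deriv (\<phi> n) x)" for n
      unfolding \<psi>_def
      by (intro ext DERIV_imp_deriv DERIV_chain2[OF smooth_has_deriv[OF j(1)] smooth_has_deriv[OF s]])
    note sq = sq_int_smooth[OF s\<psi>] sq_int_smooth[OF smooth_deriv[OF s\<psi>]]
      sq_int_smooth[OF s] sq_int_smooth[OF smooth_deriv[OF s]]
    have lim1: "(\<lambda>n. abs_L2 (\<psi> n)) \<longlonglongrightarrow> w"
    proof (rule tendsto_norm_le_L2)
      show "norm (abs_L2 (\<psi> n) - w) \<le> norm (abs_L2 (\<phi> n) - v)" for n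
      proof (rule norm_L2_le_AE)
        show "AE x in I01. \<bar>rep_L2 (abs_L2 (\<psi> n) - w) x\<bar> \<le> \<bar>rep_L2 (abs_L2 (\<phi> n) - v) x\<bar>"
          using rep_L2_diff[of "abs_L2 (\<psi> n)" w] rep_L2_diff[of "abs_L2 (\<phi> n)" v] rw
            rep_abs_L2[OF sq(1)[of n]] rep_abs_L2[OF sq(3)[of n]]
          by eventually_elim (use jl in \<open>simp add: \<psi>_def\<close>)
      qed
      show "(\<lambda>n. norm (abs_L2 (\<phi> n) - v)) \<longlonglongrightarrow> 0"
        using p(2) by (simp add: LIM_zero tendsto_norm_zero)
    qed
    \<comment> \<open>The pairing of g with the derivative of \<psi> is the only place where the
      weak form of A is used. It needs g, while the pointwise inequality concerns the derivative of
      \<phi>; exchanging the two costs the last term, which tends to 0. No weak derivative of the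
      limit \<open>w\<close> is required.\<close>
    have le: "inner (mult_L2 Q (abs_L2 (\<psi> n))) (abs_L2 (\<psi> n))
        \<le> inner (A_op v) (abs_L2 (\<psi> n)) + norm (abs_L2 (deriv (\<phi> n)) - g) * norm (abs_L2 (deriv (\<phi> n)))" for n
    proof -
      let ?D = "abs_L2 (deriv (\<phi> n))" and ?P = "abs_L2 (deriv (\<psi> n))"
      have "inner (mult_L2 Q (abs_L2 (\<psi> n))) (abs_L2 (\<psi> n)) = (LINT x|I01. Q x * (\<psi> n x)\<^sup>2)"
        unfolding inner_abs_right[OF sq(1)]
      proof (rule integral_cong_AE)
        show "AE x in I01. rep_L2 (mult_L2 Q (abs_L2 (\<psi> n))) x * \<psi> n x = Q x * (\<psi> n x)\<^sup>2"
          using rep_mult_L2[OF Q, of "abs_L2 (\<psi> n)"] rep_abs_L2[OF sq(1)[of n]]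
          by eventually_elim (simp add: power2_eq_square)
      qed (use Q sq(1) sq_int_rep_L2 sq_int_measurable in \<open>auto intro!: borel_measurable_times borel_measurable_power\<close>)
      also have "\<dots> \<le> (LINT x|I01. (deriv (\<psi> n) x)\<^sup>2)" by (rule hardy[OF t\<psi>])
      also have "\<dots> = inner ?P ?P" by (simp add: inner_abs_L2[OF sq(2,2)] power2_eq_square)
      also have "\<dots> \<le> inner ?D ?P"
        unfolding inner_abs_L2[OF sq(2,2)] inner_abs_L2[OF sq(4,2)]
      proof (intro integral_mono sq_int_mult sq)
        fix x
        have "deriv j (\<phi> n x) * (deriv j (\<phi> n x) * (deriv (\<phi> n) x)\<^sup>2) \<le> 1 * (deriv j (\<phi> n x) * (deriv (\<phi> n) x)\<^sup>2)"
          using j(3,4) by (intro mult_right_mono) auto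
        thus "deriv (\<psi> n) x * deriv (\<psi> n) x \<le> deriv (\<phi> n) x * deriv (\<psi> n) x"
          by (simp add: d\<psi> power2_eq_square ac_simps)
      qed
      also have "\<dots> = inner g ?P + inner (?D - g) ?P" by (simp add: inner_diff_left)
      also have "inner g ?P = inner (A_op v) (abs_L2 (\<psi> n))"
        using vd t\<psi>[of n] by (simp add: dirichlet_def wderiv_L2_iff)
      also have "inner (?D - g) ?P \<le> norm (?D - g) * norm ?P" by (rule norm_cauchy_schwarz)
      also have "norm ?P \<le> norm ?D"
      proof (rule norm_L2_le_AE)
        show "AE x in I01. \<bar>rep_L2 ?P x\<bar> \<le> \<bar>rep_L2 ?D x\<bar>"
          using rep_abs_L2[OF sq(2)[of n]] rep_abs_L2[OF sq(4)[of n]]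
        proof eventually_elim
          case (elim x)
          thus ?case using j(3,4)[of "\<phi> n x"] by (simp add: d\<psi> abs_mult mult_left_le_one_le)
        qed
      qed
      finally show ?thesis by (simp add: mult_left_mono)
    qed
    have "inner (mult_L2 Q w) w \<le> inner (A_op v) w + 0 * norm g"
    proof (rule LIMSEQ_le)
      show "(\<lambda>n. inner (mult_L2 Q (abs_L2 (\<psi> n))) (abs_L2 (\<psi> n))) \<longlonglongrightarrow> inner (mult_L2 Q w) w"
        by (intro tendsto_inner lim1 lin)
      show "(\<lambda>n. inner (A_op v) (abs_L2 (\<psi> n)) + norm (abs_L2 (deriv (\<phi> n)) - g) * norm (abs_L2 (deriv (\<phi> n))))
          \<longlonglongrightarrow> inner (A_op v) w + 0 * norm g"
        by (intro tendsto_intros lim1 p) (use p(3) in \<open>simp add: LIM_zero tendsto_norm_zero\<close>)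
      show "\<exists>N. \<forall>n\<ge>N. inner (mult_L2 Q (abs_L2 (\<psi> n))) (abs_L2 (\<psi> n))
        \<le> inner (A_op v) (abs_L2 (\<psi> n)) + norm (abs_L2 (deriv (\<phi> n)) - g) * norm (abs_L2 (deriv (\<phi> n)))"
        using le by blast
    qed
    thus ?thesis using wpos by (intro exI[of _ w]) simp
  qed
  have "\<exists>w. norm (w - pos v) \<le> 1 / real (Suc n) \<and> inner (mult_L2 Q w) w \<le> inner (A_op v) w" for n
    by (rule approx) simp
  then obtain W where W: "\<And>n. norm (W n - pos v) \<le> 1 / real (Suc n)"
    "\<And>n. inner (mult_L2 Q (W n)) (W n) \<le> inner (A_op v) (W n)" by metis
  have Wl: "W \<longlonglongrightarrow> pos v"
    by (rule tendsto_norm_le_L2[OF W(1)]) (use LIMSEQ_inverse_real_of_nat in \<open>simp add: inverse_eq_divide\<close>)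
  show ?thesis
  proof (rule LIMSEQ_le)
    show "(\<lambda>n. inner (mult_L2 Q (W n)) (W n)) \<longlonglongrightarrow> inner (mult_L2 Q (pos v)) (pos v)"
      by (intro tendsto_inner Wl lin)
    show "(\<lambda>n. inner (A_op v) (W n)) \<longlonglongrightarrow> inner (A_op v) (pos v)"
      by (intro tendsto_intros Wl)
  qed (use W(2) in blast)
qed

section \<open>Absolutely continuous functions and Gronwall's inequality\<close>

text \<open>The definition enumerates the intervals by numbers, whereas a tagged division is a
  finite set of pairs; a bijection translates.\<close>

lemma abs_continuous_on_finite:
  fixes u :: "real \<Rightarrow> 'a::real_normed_vector"
  assumes "abs_continuous_on a b u" "\<epsilon> > 0"
  shows "\<exists>\<delta>>0. \<forall>(S::'i set) p q. finite S \<and> (\<forall>i\<in>S. a \<le> p i \<and> p i \<le> q i \<and> q i \<le> b) \<and>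
      (\<forall>i\<in>S. \<forall>j\<in>S. i \<noteq> j \<longrightarrow> {p i<..<q i} \<inter> {p j<..<q j} = {}) \<and>
      (\<Sum>i\<in>S. q i - p i) < \<delta> \<longrightarrow> (\<Sum>i\<in>S. norm (u (q i) - u (p i))) < \<epsilon>"
proof -
  obtain \<delta> where \<delta>: "\<delta> > 0" and ac: "\<forall>(n::nat) p q.
     (\<forall>i<n. a \<le> p i \<and> p i \<le> q i \<and> q i \<le> b) \<and>
     (\<forall>i<n. \<forall>j<n. i \<noteq> j \<longrightarrow> {p i<..<q i} \<inter> {p j<..<q j} = {}) \<and>
     (\<Sum>i<n. q i - p i) < \<delta>
     \<longrightarrow> (\<Sum>i<n. norm (u (q i) - u (p i))) < \<epsilon>"
    using mp[OF spec[OF assms(1)[unfolded abs_continuous_on_def]] assms(2)] by (elim exE conjE)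
  show ?thesis
  proof (intro exI[of _ \<delta>] conjI \<delta> allI impI)
    fix S :: "'i set" and p q
    assume *: "finite S \<and> (\<forall>i\<in>S. a \<le> p i \<and> p i \<le> q i \<and> q i \<le> b) \<and>
      (\<forall>i\<in>S. \<forall>j\<in>S. i \<noteq> j \<longrightarrow> {p i<..<q i} \<inter> {p j<..<q j} = {}) \<and> (\<Sum>i\<in>S. q i - p i) < \<delta>"
    note S = conjunct1[OF *] conjunct1[OF conjunct2[OF *]]
      conjunct1[OF conjunct2[OF conjunct2[OF *]]] conjunct2[OF conjunct2[OF conjunct2[OF *]]]
    obtain h where "bij_betw h {0..<card S} S" using ex_bij_betw_nat_finite[OF S(1)] by blast
    hence h: "bij_betw h {..<card S} S" by (simp add: atLeast0LessThan)
    have hS: "h i \<in> S" if "i < card S" for i using h that by (auto simp: bij_betw_def)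
    have hI: "h i \<noteq> h j" if "i < card S" "j < card S" "i \<noteq> j" for i j
      using bij_betw_imp_inj_on[OF h] that by (meson inj_onD lessThan_iff)
    have "(\<Sum>i<card S. norm (u (q (h i)) - u (p (h i)))) < \<epsilon>"
    proof (rule ac[rule_format, of "card S" "\<lambda>i. p (h i)" "\<lambda>i. q (h i)"], intro conjI allI impI)
      show "(\<Sum>i<card S. q (h i) - p (h i)) < \<delta>"
        using S(4) sum.reindex_bij_betw[OF h, of "\<lambda>i. q i - p i"] by simp
      fix i assume i: "i < card S"
      show "a \<le> p (h i)" "p (h i) \<le> q (h i)" "q (h i) \<le> b" using S(2) hS[OF i] by auto
      fix j assume j: "j < card S" "i \<noteq> j"
      show "{p (h i)<..<q (h i)} \<inter> {p (h j)<..<q (h j)} = {}"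
        by (rule S(3)[rule_format, OF hS[OF i] hS[OF j(1)] hI[OF i j]])
    qed
    thus "(\<Sum>i\<in>S. norm (u (q i) - u (p i))) < \<epsilon>"
      using sum.reindex_bij_betw[OF h, of "\<lambda>i. norm (u (q i) - u (p i))"] by simp
  qed
qed

text \<open>Admitting the time increment next to that of \<open>u\<close> covers with one criterion
  negation, subtraction of a Lipschitz function, and the weighted squared norm in the Gronwall
  argument.\<close>

lemma abs_continuous_on_dominated:
  fixes u :: "real \<Rightarrow> 'a::real_normed_vector" and f :: "real \<Rightarrow> 'b::real_normed_vector"
  assumes u: "abs_continuous_on a b u"
    and f: "\<And>x y. a \<le> x \<Longrightarrow> x \<le> y \<Longrightarrow> y \<le> b \<Longrightarrow> norm (f y - f x) \<le> C * (norm (u y - u x) + (y - x))"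
  shows "abs_continuous_on a b f"
  unfolding abs_continuous_on_def
proof (intro allI impI)
  fix \<epsilon> :: real assume \<epsilon>: "\<epsilon> > 0"
  \<comment> \<open>A strictly positive majorant of \<open>C\<close>, so that \<epsilon> can be
    divided by it.\<close>
  define D where "D = \<bar>C\<bar> + 1"
  have D: "D > 0" "C \<le> D" by (auto simp: D_def)
  have eD: "\<epsilon> / (2 * D) > 0" using \<epsilon> D by simp
  obtain \<delta> where \<delta>: "\<delta> > 0" and ac: "\<forall>(n::nat) p q.
     (\<forall>i<n. a \<le> p i \<and> p i \<le> q i \<and> q i \<le> b) \<and>
     (\<forall>i<n. \<forall>j<n. i \<noteq> j \<longrightarrow> {p i<..<q i} \<inter> {p j<..<q j} = {}) \<and>
     (\<Sum>i<n. q i - p i) < \<delta>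
     \<longrightarrow> (\<Sum>i<n. norm (u (q i) - u (p i))) < \<epsilon> / (2 * D)"
    using mp[OF spec[OF u[unfolded abs_continuous_on_def]] eD] by (elim exE conjE)
  show "\<exists>\<delta>>0. \<forall>(n::nat) p q.
     (\<forall>i<n. a \<le> p i \<and> p i \<le> q i \<and> q i \<le> b) \<and>
     (\<forall>i<n. \<forall>j<n. i \<noteq> j \<longrightarrow> {p i<..<q i} \<inter> {p j<..<q j} = {}) \<and>
     (\<Sum>i<n. q i - p i) < \<delta>
     \<longrightarrow> (\<Sum>i<n. norm (f (q i) - f (p i))) < \<epsilon>"
  proof (intro exI[of _ "min \<delta> (\<epsilon> / (2 * D))"] conjI allI impI)
    show "min \<delta> (\<epsilon> / (2 * D)) > 0" using \<delta> D \<epsilon> by simp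
    fix n :: nat and p q
    assume *: "(\<forall>i<n. a \<le> p i \<and> p i \<le> q i \<and> q i \<le> b) \<and>
     (\<forall>i<n. \<forall>j<n. i \<noteq> j \<longrightarrow> {p i<..<q i} \<inter> {p j<..<q j} = {}) \<and>
     (\<Sum>i<n. q i - p i) < min \<delta> (\<epsilon> / (2 * D))"
    have 1: "(\<Sum>i<n. norm (u (q i) - u (p i))) < \<epsilon> / (2 * D)"
      using ac[rule_format, of n p q] * by simp
    have 2: "(\<Sum>i<n. q i - p i) < \<epsilon> / (2 * D)" using * by simp
    have "(\<Sum>i<n. norm (f (q i) - f (p i))) \<le> (\<Sum>i<n. D * (norm (u (q i) - u (p i)) + (q i - p i)))"
    proof (rule sum_mono)
      fix i assume i: "i \<in> {..<n}"
      hence pq: "a \<le> p i \<and> p i \<le> q i \<and> q i \<le> b" using * by auto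
      hence "norm (f (q i) - f (p i)) \<le> C * (norm (u (q i) - u (p i)) + (q i - p i))" using f by blast
      also have "\<dots> \<le> D * (norm (u (q i) - u (p i)) + (q i - p i))"
        using pq D by (intro mult_right_mono) auto
      finally show "norm (f (q i) - f (p i)) \<le> D * (norm (u (q i) - u (p i)) + (q i - p i))" .
    qed
    also have "\<dots> = D * ((\<Sum>i<n. norm (u (q i) - u (p i))) + (\<Sum>i<n. q i - p i))"
      by (simp add: sum.distrib flip: sum_distrib_left)
    also have "\<dots> < D * (\<epsilon> / (2 * D) + \<epsilon> / (2 * D))"
      using 1 2 D by (intro mult_strict_left_mono add_strict_mono) auto
    also have "\<dots> = \<epsilon>" using D by simp
    finally show "(\<Sum>i<n. norm (f (q i) - f (p i))) < \<epsilon>" .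
  qed
qed

lemma abs_continuous_on_lipschitz:
  fixes f :: "real \<Rightarrow> 'b::real_normed_vector"
  assumes "\<And>x y. a \<le> x \<Longrightarrow> x \<le> y \<Longrightarrow> y \<le> b \<Longrightarrow> norm (f y - f x) \<le> C * (y - x)"
  shows "abs_continuous_on a b f"
proof (rule abs_continuous_on_dominated[of a b "\<lambda>_. 0 :: real"])
  show "abs_continuous_on a b (\<lambda>_. 0 :: real)"
    unfolding abs_continuous_on_def by (auto intro: exI[of _ 1])
qed (use assms in simp)

section \<open>Monotonicity and Gronwall from derivatives known almost everywhere\<close>

lemma negligible_outer_open:
  fixes E :: "real set"
  assumes "negligible E" "e > 0"
  obtains T where "open T" "E \<subseteq> T" "T \<in> lmeasurable" "measure lebesgue T < e"
proof -
  have E0: "E \<in> null_sets lebesgue" using assms(1) by (simp add: negligible_iff_null_sets)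
  hence E: "E \<in> sets lebesgue" by auto
  obtain T where T: "open T" "E \<subseteq> T" "T - E \<in> lmeasurable" "emeasure lebesgue (T - E) < ennreal e"
    using sets_lebesgue_outer_open[OF E assms(2)] by blast
  have Ts: "T \<in> sets lebesgue" using T(1) by (simp add: borel_open)
  have "emeasure lebesgue T = emeasure lebesgue (T - E)"
    using emeasure_Diff_null_set[OF E0 Ts] by simp
  hence em: "emeasure lebesgue T < ennreal e" using T(4) by simp
  hence "T \<in> lmeasurable" using Ts by (auto simp: fmeasurable_def intro: less_trans[OF _ ennreal_less_top])
  moreover from this have "measure lebesgue T < e"
    using em assms(2) by (simp add: emeasure_eq_measure2 ennreal_less_iff)
  ultimately show thesis using that T by blast
qed

text \<open>On a tagged division fine for a suitable gauge, the increments at tags outside the exceptional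
  null set are controlled by the derivative, the others by absolute continuity.\<close>

lemma abs_continuous_nonincreasing:
  fixes N :: "real \<Rightarrow> real"
  assumes "a \<le> b" and ac: "abs_continuous_on a b N"
    and der: "AE t in lebesgue_on {a<..<b}. \<exists>D. (N has_real_derivative D) (at t) \<and> D \<le> 0"
  shows "N b \<le> N a"
proof (rule field_le_epsilon)
  fix e :: real assume e: "e > 0"
  \<comment> \<open>The error will be \<epsilon> from absolute continuity plus \<epsilon> (b - a)
    from the slopes.\<close>
  define \<epsilon> where "\<epsilon> = e / (1 + (b - a))"
  have \<epsilon>: "\<epsilon> > 0" "\<epsilon> * (1 + (b - a)) = e" using e assms(1) by (simp_all add: \<epsilon>_def)
  define E where "E = {t \<in> {a..b}. \<not> (\<exists>D. (N has_real_derivative D) (at t) \<and> D \<le> 0)}"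
  have "AE t in lebesgue. t \<in> {a<..<b} \<longrightarrow> (\<exists>D. (N has_real_derivative D) (at t) \<and> D \<le> 0)"
    using der by (subst (asm) AE_restrict_space_iff) auto
  moreover have "AE t in lebesgue. t \<noteq> a" "AE t in lebesgue. t \<noteq> b"
    by (auto intro!: AE_completion AE_lborel_singleton)
  ultimately have "AE t in lebesgue. t \<notin> E"
    by eventually_elim (auto simp: E_def)
  then obtain N' where "N' \<in> null_sets lebesgue" "{t \<in> space lebesgue. \<not> t \<notin> E} \<subseteq> N'"
    unfolding eventually_ae_filter by blast
  hence "negligible E"
    using negligible_subset[of N' E] by (auto simp: negligible_iff_null_sets)
  obtain \<delta> where \<delta>: "\<delta> > 0" and acS: "\<forall>(S::(real \<times> real set) set) p q. finite S \<and>
      (\<forall>i\<in>S. a \<le> p i \<and> p i \<le> q i \<and> q i \<le> b) \<and>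
      (\<forall>i\<in>S. \<forall>j\<in>S. i \<noteq> j \<longrightarrow> {p i<..<q i} \<inter> {p j<..<q j} = {}) \<and>
      (\<Sum>i\<in>S. q i - p i) < \<delta> \<longrightarrow> (\<Sum>i\<in>S. norm (N (q i) - N (p i))) < \<epsilon>"
    using abs_continuous_on_finite[OF ac \<epsilon>(1), where 'i = "real \<times> real set"] by (elim exE conjE)
  obtain T where T: "open T" "E \<subseteq> T" "T \<in> lmeasurable" "measure lebesgue T < \<delta>"
    using negligible_outer_open[OF \<open>negligible E\<close> \<delta>] by metis
  \<comment> \<open>Straddle estimate: for x \<le> t \<le> y the errors of the linear approximation
    at t add up to \<epsilon> (y - x), because t lies between the two points.\<close>
  have loc: "\<exists>r>0. \<forall>x y. x \<le> t \<longrightarrow> t \<le> y \<longrightarrow> t - r < x \<longrightarrow> y < t + r \<longrightarrow> N y - N x \<le> \<epsilon> * (y - x)"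
    if t: "t \<in> {a..b}" "t \<notin> E" for t
  proof -
    obtain D where D: "(N has_real_derivative D) (at t)" "D \<le> 0" using t by (auto simp: E_def)
    obtain r where r: "r > 0" "\<forall>y. norm (y - t) < r \<longrightarrow> norm (N y - N t - D * (y - t)) \<le> \<epsilon> * norm (y - t)"
      using D(1) \<epsilon>(1) unfolding has_field_derivative_def has_derivative_at_alt by blast
    show ?thesis
    proof (intro exI[of _ r] conjI r(1) allI impI)
      fix x y assume xy: "x \<le> t" "t \<le> y" "t - r < x" "y < t + r"
      have "N y - N t - D * (y - t) \<le> \<epsilon> * (y - t)"
        using r(2)[rule_format, of y] xy by (simp add: abs_le_iff)
      moreover have "- (N x - N t - D * (x - t)) \<le> \<epsilon> * (t - x)"
        using r(2)[rule_format, of x] xy by (simp add: abs_le_iff)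
      moreover have "D * (y - t) \<le> 0" "0 \<le> D * (x - t)"
        using D(2) xy by (auto intro: mult_nonpos_nonneg mult_nonpos_nonpos)
      ultimately show "N y - N x \<le> \<epsilon> * (y - x)" by (simp add: algebra_simps)
    qed
  qed
  define R where "R t = (SOME r. r > 0 \<and> (\<forall>x y. x \<le> t \<longrightarrow> t \<le> y \<longrightarrow> t - r < x \<longrightarrow> y < t + r \<longrightarrow> N y - N x \<le> \<epsilon> * (y - x)))" for t
  have R: "R t > 0 \<and> (\<forall>x y. x \<le> t \<longrightarrow> t \<le> y \<longrightarrow> t - R t < x \<longrightarrow> y < t + R t \<longrightarrow> N y - N x \<le> \<epsilon> * (y - x))"
    if t: "t \<in> {a..b}" "t \<notin> E" for t
    unfolding R_def by (rule someI_ex) (use loc[OF t] in blast)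
  \<comment> \<open>Intervals tagged in \<open>E\<close> are forced into the open set
    \<open>T\<close> of measure less than \<delta>, where absolute continuity applies; the others
    are forced into the range of the straddle estimate. The value outside [a, b] is immaterial,
    since every tag lies in [a, b].\<close>
  define \<gamma> where "\<gamma> t = (if t \<in> E then T else if t \<in> {a..b} then ball t (R t) else UNIV)" for t
  have "gauge \<gamma>"
    unfolding gauge_def \<gamma>_def using T R by auto
  then obtain P where P: "P tagged_division_of {a..b}" "\<gamma> fine P"
    by (rule fine_division_exists_real)
  note Pd = tagged_division_ofD[OF P(1)]
  have Pi: "snd z = {Inf (snd z)..Sup (snd z)} \<and> Inf (snd z) \<le> fst z \<and> fst z \<le> Sup (snd z) \<and>
      a \<le> Inf (snd z) \<and> Sup (snd z) \<le> b \<and> fst z \<in> {a..b} \<and> snd z \<subseteq> \<gamma> (fst z)" if z: "z \<in> P" for z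
  proof -
    obtain t K where zt: "z = (t, K)" by force
    obtain c d where K: "K = {c..d}" using Pd(4) z zt by (metis box_real(2))
    have tK: "t \<in> K" "K \<subseteq> {a..b}" using Pd(2,3) z zt by auto
    hence "c \<le> d" using K by auto
    hence "Inf K = c" "Sup K = d" "a \<le> c" "d \<le> b" using K tK(2) by auto
    moreover have "K \<subseteq> \<gamma> t" using P(2) z zt by (auto simp: fine_def)
    ultimately show ?thesis using tK K zt by auto
  qed
  let ?l = "\<lambda>z. Inf (snd z)" and ?u = "\<lambda>z. Sup (snd z)"
  define P1 where "P1 = {z \<in> P. fst z \<in> E}"
  define P2 where "P2 = {z \<in> P. fst z \<notin> E}"
  have fin: "finite P" "finite P1" "finite P2" using Pd(1) by (auto simp: P1_def P2_def)
  have tele: "(\<Sum>z\<in>P. f (?u z) - f (?l z)) = f b - f a" for f :: "real \<Rightarrow> real"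
    using additive_tagged_division_1[OF assms(1) P(1), of f] by (simp add: case_prod_unfold)
  have split: "(\<Sum>z\<in>P. f z) = (\<Sum>z\<in>P1. f z) + (\<Sum>z\<in>P2. f z)" for f :: "_ \<Rightarrow> real"
    unfolding P1_def P2_def using Pd(1) by (subst sum.union_disjoint[symmetric]) (auto intro: sum.cong)
  have disj: "{?l z<..<?u z} \<inter> {?l z'<..<?u z'} = {}" if "z \<in> P" "z' \<in> P" "z \<noteq> z'" for z z'
  proof -
    have "interior (snd z) \<inter> interior (snd z') = {}"
      using Pd(5)[of "fst z" "snd z" "fst z'" "snd z'"] that by (simp add: prod_eq_iff)
    moreover have "interior (snd z) = {?l z<..<?u z}" "interior (snd z') = {?l z'<..<?u z'}"
      using Pi[OF that(1)] Pi[OF that(2)] interior_atLeastAtMost_real by metis+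
    ultimately show ?thesis by simp
  qed
  have small: "(\<Sum>z\<in>P1. ?u z - ?l z) < \<delta>"
  proof -
    let ?J = "\<lambda>z. {?l z<..<?u z}"
    have "(\<Sum>z\<in>P1. ?u z - ?l z) = (\<Sum>z\<in>P1. measure lebesgue (?J z))"
    proof (rule sum.cong[OF refl])
      fix z assume "z \<in> P1"
      hence "?l z \<le> ?u z" using Pi[of z] by (auto simp: P1_def)
      thus "?u z - ?l z = measure lebesgue (?J z)" by simp
    qed
    also have "\<dots> = measure lebesgue (\<Union>z\<in>P1. ?J z)"
    proof (rule measure_finite_Union[symmetric, OF fin(2)])
      show "disjoint_family_on ?J P1" using disj by (auto simp: disjoint_family_on_def P1_def)
      show "emeasure lebesgue (?J z) \<noteq> \<infinity>" if "z \<in> P1" for z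
      proof -
        have "?l z \<le> ?u z" using Pi[of z] that by (auto simp: P1_def)
        thus ?thesis by simp
      qed
    qed auto
    also have "\<dots> \<le> measure lebesgue T"
    proof (rule measure_mono_fmeasurable[OF _ _ T(3)])
      show "(\<Union>z\<in>P1. ?J z) \<subseteq> T"
      proof (rule UN_least)
        fix z assume "z \<in> P1"
        hence z: "z \<in> P" "fst z \<in> E" by (auto simp: P1_def)
        have "?J z \<subseteq> {?l z..?u z}" by auto
        also have "{?l z..?u z} \<subseteq> T" using Pi[OF z(1)] z(2) by (simp add: \<gamma>_def)
        finally show "?J z \<subseteq> T" .
      qed
    qed (auto intro: fin)
    finally show ?thesis using T(4) by simp
  qed
  have "(\<Sum>z\<in>P1. norm (N (?u z) - N (?l z))) < \<epsilon>"
  proof (rule acS[rule_format, of P1 ?l ?u], intro conjI ballI impI fin small)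
    fix z assume "z \<in> P1"
    hence z: "z \<in> P" by (simp add: P1_def)
    show "a \<le> ?l z" "?u z \<le> b" using Pi[OF z] by blast+
    show "?l z \<le> ?u z" using Pi[OF z] by linarith
    fix z' assume "z' \<in> P1" "z \<noteq> z'"
    thus "{?l z<..<?u z} \<inter> {?l z'<..<?u z'} = {}" using disj[OF z, of z'] by (simp add: P1_def)
  qed
  moreover have "(\<Sum>z\<in>P1. N (?u z) - N (?l z)) \<le> (\<Sum>z\<in>P1. norm (N (?u z) - N (?l z)))"
    by (intro sum_mono) simp
  moreover have "(\<Sum>z\<in>P2. N (?u z) - N (?l z)) \<le> \<epsilon> * (b - a)"
  proof -
    have "(\<Sum>z\<in>P2. N (?u z) - N (?l z)) \<le> (\<Sum>z\<in>P2. \<epsilon> * (?u z - ?l z))"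
    proof (rule sum_mono)
      fix z assume "z \<in> P2"
      hence z: "z \<in> P" "fst z \<notin> E" by (auto simp: P2_def)
      note zz = Pi[OF z(1)]
      hence "snd z \<subseteq> \<gamma> (fst z)" "fst z \<in> {a..b}" by blast+
      hence "snd z \<subseteq> ball (fst z) (R (fst z))" using z(2) by (simp add: \<gamma>_def)
      hence "{?l z..?u z} \<subseteq> ball (fst z) (R (fst z))" using zz by simp
      moreover have "?l z \<in> {?l z..?u z}" "?u z \<in> {?l z..?u z}" using zz by auto
      ultimately have "?l z \<in> ball (fst z) (R (fst z))" "?u z \<in> ball (fst z) (R (fst z))" by blast+
      hence "fst z - R (fst z) < ?l z" "?u z < fst z + R (fst z)" using zz by (auto simp: dist_real_def)
      thus "N (?u z) - N (?l z) \<le> \<epsilon> * (?u z - ?l z)" using R[of "fst z"] z zz by blast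
    qed
    also have "\<dots> \<le> (\<Sum>z\<in>P. \<epsilon> * (?u z - ?l z))"
    proof (rule sum_mono2[OF fin(1)])
      show "P2 \<subseteq> P" by (auto simp: P2_def)
      show "0 \<le> \<epsilon> * (?u z - ?l z)" if "z \<in> P - P2" for z
        using Pi[of z] that \<epsilon>(1) by auto
    qed
    also have "\<dots> = \<epsilon> * (b - a)"
      using tele[of "\<lambda>x. x"] by (simp flip: sum_distrib_left)
    finally show ?thesis .
  qed
  ultimately have "N b - N a \<le> \<epsilon> + \<epsilon> * (b - a)"
    using tele[of N] split[of "\<lambda>z. N (?u z) - N (?l z)"] by linarith
  also have "\<dots> = e" using \<epsilon>(2) by (simp add: algebra_simps)
  finally show "N b \<le> N a + e" by simp
qed

text \<open>The positive part is not differentiable, but its square is pointwise a C^1 function with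
  Lipschitz derivative. The remainder lies pointwise between 0 and the squared increment, so after
  integration it is at most the square of the norm of the increment.\<close>

lemma norm_pos_sq_has_derivative:
  "((\<lambda>u. (norm (pos u))\<^sup>2) has_derivative (\<lambda>h. 2 * inner h (pos u))) (at u)"
proof (rule has_derivativeI_sandwich[where e = 1 and H = "\<lambda>y. norm (y - u)"])
  show "bounded_linear (\<lambda>h. 2 * inner h (pos u))"
    by (intro bounded_linear_const_mult bounded_linear_inner_left)
  have "((\<lambda>y. norm (y - u)) \<longlongrightarrow> norm (u - u)) (at u)" by (intro tendsto_intros)
  thus "((\<lambda>y. norm (y - u)) \<longlongrightarrow> 0) (at u)" by simp
  fix y assume "y \<noteq> u"
  let ?f = "\<lambda>x. max 0 (rep_L2 u x)" and ?g = "\<lambda>x. max 0 (rep_L2 y x)"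
  define d where "d = y - u"
  have "\<bar>(norm (pos y))\<^sup>2 - (norm (pos u))\<^sup>2 - 2 * inner d (pos u)\<bar> \<le> (norm d)\<^sup>2"
  proof -
    have eq: "(norm (pos y))\<^sup>2 - (norm (pos u))\<^sup>2 - 2 * inner d (pos u) = inner (pos y - pos u) (pos y - pos u)
        + 2 * inner (pos y - pos u - d) (pos u)"
      by (simp add: power2_norm_eq_inner inner_diff_left inner_diff_right inner_commute)
    have 1: "0 \<le> inner (pos y - pos u - d) (pos u)"
    proof -
      have "inner 0 (pos u) \<le> inner (pos y - pos u - d) (pos u)"
      proof (rule inner_L2_mono)
        show "AE x in I01. rep_L2 0 x * rep_L2 (pos u) x \<le> rep_L2 (pos y - pos u - d) x * rep_L2 (pos u) x"
          using rep_L2_diff[of "pos y - pos u" d] rep_L2_diff[of "pos y" "pos u"] rep_L2_diff[of y u]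
            rep_pos[of u] rep_pos[of y] rep_L2_zero
          unfolding d_def by eventually_elim (auto simp: max_def)
      qed
      thus ?thesis by simp
    qed
    have 2: "inner (pos y - pos u) (pos y - pos u) + 2 * inner (pos y - pos u - d) (pos u) \<le> inner d d"
    proof -
      have "inner (pos y - pos u) (pos y + pos u) \<le> inner d (d + 2 *\<^sub>R pos u)"
      proof (rule inner_L2_mono)
        show "AE x in I01. rep_L2 (pos y - pos u) x * rep_L2 (pos y + pos u) x
            \<le> rep_L2 d x * rep_L2 (d + 2 *\<^sub>R pos u) x"
          using rep_L2_diff[of "pos y" "pos u"] rep_L2_add[of "pos y" "pos u"] rep_L2_diff[of y u]
            rep_L2_add[of "y - u" "2 *\<^sub>R pos u"] rep_L2_scale[of 2 "pos u"] rep_pos[of u] rep_pos[of y]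
          unfolding d_def
        proof eventually_elim
          case (elim x)
          let ?u = "rep_L2 u x" and ?y = "rep_L2 y x"
          have "(max 0 ?y - max 0 ?u) * (max 0 ?y + max 0 ?u) \<le> (?y - ?u) * (?y - ?u + 2 * max 0 ?u)"
            using zero_le_square[of "?y - ?u"] zero_le_square[of ?y]
            by (auto simp: max_def algebra_simps mult_nonneg_nonpos2 mult_nonneg_nonpos)
          thus ?case by (simp only: elim)
        qed
      qed
      thus ?thesis
        by (simp add: inner_diff_left inner_diff_right inner_add_right inner_commute)
    qed
    show ?thesis unfolding eq using 1 2 by (simp add: power2_norm_eq_inner)
  qed
  thus "norm (((norm (pos y))\<^sup>2 - (norm (pos u))\<^sup>2) - 2 * inner (y - u) (pos u)) / norm (y - u) \<le> norm (y - u)"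
    using \<open>y \<noteq> u\<close> by (simp add: d_def divide_le_eq power2_eq_square)
qed simp

text \<open>Gronwall: exp(-2 \<kappa> r) times the squared norm of the positive part is
  nonincreasing. Strong solutions are absolutely continuous only away from the initial time, so this
  is shown from every T > s and extended to s by continuity. Negative \<kappa> gives decay; a
  positive \<kappa> still propagates the value 0.\<close>

lemma pos_decay:
  fixes w :: "real \<Rightarrow> L2"
  assumes cont: "continuous_on {s..t} w" and ac: "\<And>T. s < T \<Longrightarrow> T < t \<Longrightarrow> abs_continuous_on T t w"
    and der: "AE r in lebesgue_on {s<..}. \<exists>w'. (w has_vector_derivative w') (at r) \<and>
      inner w' (pos (w r)) \<le> \<kappa> * (norm (pos (w r)))\<^sup>2"
    and "s \<le> t"
  shows "norm (pos (w t)) \<le> exp (\<kappa> * (t - s)) * norm (pos (w s))"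
proof -
  define e where "e r = exp (- 2 * \<kappa> * r)" for r
  define N where "N r = e r * (norm (pos (w r)))\<^sup>2" for r
  obtain B where B: "\<forall>r\<in>{s..t}. norm (w r) \<le> B"
    using compact_imp_bounded[OF compact_continuous_image[OF cont compact_Icc]] unfolding bounded_iff by auto
  have ce: "continuous_on S e" for S unfolding e_def by (intro continuous_intros)
  obtain M where M: "\<forall>r\<in>{s..t}. \<bar>e r\<bar> \<le> M"
    using compact_imp_bounded[OF compact_continuous_image[OF ce compact_Icc, of s t]] unfolding bounded_iff by auto
  have de: "(e has_real_derivative (- 2 * \<kappa>) * e r) (at r)" for r
    unfolding e_def by (auto intro!: derivative_eq_intros)
  have le: "\<bar>e y - e x\<bar> \<le> (2 * \<bar>\<kappa>\<bar> * M) * \<bar>y - x\<bar>" if "x \<in> {s..t}" "y \<in> {s..t}" for x y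
  proof -
    have "norm (e y - e x) \<le> (2 * \<bar>\<kappa>\<bar> * M) * norm (y - x)"
    proof (rule field_differentiable_bound[of "{s..t}" e "\<lambda>r. (- 2 * \<kappa>) * e r"])
      show "norm (- 2 * \<kappa> * e r) \<le> 2 * \<bar>\<kappa>\<bar> * M" if "r \<in> {s..t}" for r
        using M[rule_format, OF that] by (simp add: abs_mult mult_left_mono)
      show "(e has_field_derivative - 2 * \<kappa> * e r) (at r within {s..t})" for r
        by (rule has_field_derivative_at_within[OF de])
    qed (use that in auto)
    thus ?thesis by simp
  qed
  have acN: "abs_continuous_on T t N" if T: "s < T" "T < t" for T
  proof (rule abs_continuous_on_dominated[OF ac[OF T]])
    fix x y assume xy: "T \<le> x" "x \<le> y" "y \<le> t"
    have xs: "x \<in> {s..t}" "y \<in> {s..t}" using xy T by auto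
    have M0: "0 \<le> M" using M[rule_format, OF xs(1)] by simp
    have B0: "0 \<le> B" using B[rule_format, OF xs(1)] norm_ge_zero order_trans by blast
    let ?P = "\<lambda>r. norm (pos (w r))"
    have P: "?P r \<le> B" if "r \<in> {s..t}" for r using norm_pos_le B[rule_format, OF that] order_trans by blast
    have "\<bar>?P y - ?P x\<bar> \<le> norm (pos (w y) - pos (w x))" by (rule norm_triangle_ineq3)
    also have "\<dots> \<le> norm (w y - w x)" by (rule pos_lipschitz)
    finally have dP: "\<bar>?P y - ?P x\<bar> \<le> norm (w y - w x)" .
    have "\<bar>(?P y)\<^sup>2 - (?P x)\<^sup>2\<bar> = \<bar>?P y - ?P x\<bar> * (?P y + ?P x)"
    proof -
      have "(?P y)\<^sup>2 - (?P x)\<^sup>2 = (?P y - ?P x) * (?P y + ?P x)"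
        by (simp add: power2_eq_square algebra_simps)
      thus ?thesis by (simp only: abs_mult abs_of_nonneg add_nonneg_nonneg norm_ge_zero)
    qed
    also have "\<dots> \<le> norm (w y - w x) * (B + B)"
      using dP P xs by (intro mult_mono add_mono) auto
    finally have 1: "\<bar>(?P y)\<^sup>2 - (?P x)\<^sup>2\<bar> \<le> 2 * B * norm (w y - w x)" by (simp add: ac_simps)
    have "N y - N x = e y * ((?P y)\<^sup>2 - (?P x)\<^sup>2) + (e y - e x) * (?P x)\<^sup>2"
      by (simp add: N_def algebra_simps)
    hence "\<bar>N y - N x\<bar> \<le> \<bar>e y * ((?P y)\<^sup>2 - (?P x)\<^sup>2)\<bar> + \<bar>(e y - e x) * (?P x)\<^sup>2\<bar>"
      using abs_triangle_ineq by simp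
    also have "\<dots> = \<bar>e y\<bar> * \<bar>(?P y)\<^sup>2 - (?P x)\<^sup>2\<bar> + \<bar>e y - e x\<bar> * (?P x)\<^sup>2"
      by (simp add: abs_mult)
    also have "\<dots> \<le> M * (2 * B * norm (w y - w x)) + (2 * \<bar>\<kappa>\<bar> * M * (y - x)) * B\<^sup>2"
      using 1 M[rule_format, OF xs(2)] le[OF xs] P[OF xs(1)] xy M0 B0
      by (intro add_mono mult_mono power_mono) auto
    also have "\<dots> \<le> (2 * M * B + 2 * \<bar>\<kappa>\<bar> * M * B\<^sup>2) * (norm (w y - w x) + (y - x))"
    proof -
      have "0 \<le> 2 * M * B * (y - x)" "0 \<le> 2 * \<bar>\<kappa>\<bar> * M * B\<^sup>2 * norm (w y - w x)"
        using xy M0 B0 by simp_all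
      thus ?thesis by (simp add: algebra_simps)
    qed
    finally show "norm (N y - N x) \<le> (2 * M * B + 2 * \<bar>\<kappa>\<bar> * M * B\<^sup>2) * (norm (w y - w x) + (y - x))"
      by simp
  qed
  have derN: "AE r in lebesgue_on {s<..}. \<exists>D. (N has_real_derivative D) (at r) \<and> D \<le> 0"
    using der
  proof eventually_elim
    case (elim r)
    then obtain w' where w': "(w has_vector_derivative w') (at r)"
      "inner w' (pos (w r)) \<le> \<kappa> * (norm (pos (w r)))\<^sup>2" by blast
    have "((\<lambda>r. (norm (pos (w r)))\<^sup>2) has_derivative (\<lambda>h. 2 * inner (h *\<^sub>R w') (pos (w r)))) (at r)"
      using has_derivative_compose[OF w'(1)[unfolded has_vector_derivative_def] norm_pos_sq_has_derivative] .
    hence "((\<lambda>r. (norm (pos (w r)))\<^sup>2) has_real_derivative 2 * inner w' (pos (w r))) (at r)"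
      unfolding has_field_derivative_def by (rule has_derivative_eq_rhs) (auto simp: fun_eq_iff)
    from DERIV_mult'[OF de this]
    have "(N has_real_derivative e r * (2 * inner w' (pos (w r))) + (- 2 * \<kappa> * e r) * (norm (pos (w r)))\<^sup>2) (at r)"
      unfolding N_def[abs_def] .
    moreover have "e r * (2 * inner w' (pos (w r))) \<le> e r * (2 * (\<kappa> * (norm (pos (w r)))\<^sup>2))"
      using w'(2) by (intro mult_left_mono) (auto simp: e_def)
    ultimately show ?case
      by (intro exI conjI) (auto simp: algebra_simps)
  qed
  have le1: "N t \<le> N T" if T: "s < T" "T < t" for T
  proof (rule abs_continuous_nonincreasing[OF less_imp_le[OF T(2)] acN[OF T]])
    have "AE r in lebesgue. r \<in> {s<..} \<longrightarrow> (\<exists>D. (N has_real_derivative D) (at r) \<and> D \<le> 0)"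
      using derN by (subst (asm) AE_restrict_space_iff) auto
    hence "AE r in lebesgue. r \<in> {T<..<t} \<longrightarrow> (\<exists>D. (N has_real_derivative D) (at r) \<and> D \<le> 0)"
      by eventually_elim (use T in auto)
    thus "AE r in lebesgue_on {T<..<t}. \<exists>D. (N has_real_derivative D) (at r) \<and> D \<le> 0"
      by (subst AE_restrict_space_iff) auto
  qed
  have "N t \<le> N s"
  proof (cases "s = t")
    case False
    hence st: "s < t" using assms(4) by simp
    have cp: "continuous_on UNIV pos"
      unfolding continuous_on_iff dist_norm
      using le_less_trans[OF pos_lipschitz] by blast
    have cN: "continuous_on {s..t} N"
      unfolding N_def by (intro continuous_intros ce continuous_on_compose2[OF cp cont]) auto
    hence "(N \<longlongrightarrow> N s) (at s within {s..t})" using st by (auto simp: continuous_on)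
    hence "(N \<longlongrightarrow> N s) (at_right s)"
      using at_within_Icc_at_right[OF st] by simp
    moreover have "\<forall>\<^sub>F T in at_right s. N t \<le> N T"
      unfolding eventually_at_right[OF st] using st le1 by blast
    ultimately show ?thesis
      by (intro tendsto_lowerbound[of N "N s" "at_right s"]) auto
  qed simp
  hence "exp (2 * \<kappa> * t) * N t \<le> exp (2 * \<kappa> * t) * N s" by simp
  moreover have "exp (2 * \<kappa> * t) * e t = 1"
    unfolding e_def mult_exp_exp by simp
  moreover have "exp (2 * \<kappa> * t) * e s = (exp (\<kappa> * (t - s)))\<^sup>2"
    unfolding e_def mult_exp_exp exp_double[symmetric] by (simp add: algebra_simps)
  ultimately have "(norm (pos (w t)))\<^sup>2 \<le> (exp (\<kappa> * (t - s)) * norm (pos (w s)))\<^sup>2"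
    by (simp only: N_def power_mult_distrib mult.assoc[symmetric] mult_1_left)
  thus ?thesis by (rule power2_le_imp_le) simp
qed

section \<open>Poincare and Hardy inequalities for positive parts\<close>

lemma inner_mult_L2_self:
  assumes "Q \<in> borel_measurable I01" "AE x in I01. \<bar>Q x\<bar> \<le> N"
  shows "inner (mult_L2 Q u) u = (LINT x|I01. Q x * (rep_L2 u x)\<^sup>2)"
    and "integrable I01 (\<lambda>x. Q x * (rep_L2 u x)\<^sup>2)"
proof -
  have eq: "AE x in I01. rep_L2 (mult_L2 Q u) x * rep_L2 u x = Q x * (rep_L2 u x)\<^sup>2"
    using rep_mult_L2[OF assms, of u] by eventually_elim (simp add: power2_eq_square)
  have m: "(\<lambda>x. rep_L2 (mult_L2 Q u) x * rep_L2 u x) \<in> borel_measurable I01"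
      "(\<lambda>x. Q x * (rep_L2 u x)\<^sup>2) \<in> borel_measurable I01"
    using sq_int_measurable[OF sq_int_rep_L2] assms(1)
    by (auto intro!: borel_measurable_times borel_measurable_power)
  show "inner (mult_L2 Q u) u = (LINT x|I01. Q x * (rep_L2 u x)\<^sup>2)"
    unfolding inner_L2_iff by (rule integral_cong_AE[OF m eq])
  show "integrable I01 (\<lambda>x. Q x * (rep_L2 u x)\<^sup>2)"
    using integrable_cong_AE[OF m eq] sq_int_mult[OF sq_int_rep_L2 sq_int_rep_L2] by blast
qed

lemma norm_L2_sq: "(norm u)\<^sup>2 = (LINT x|I01. (rep_L2 u x)\<^sup>2)"
  unfolding power2_norm_eq_inner inner_L2_iff by (simp add: power2_eq_square)

text \<open>Here p belongs to phi = sin(pi x), the first Dirichlet eigenfunction, for which p' - p^2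
  is exactly pi^2. The sharp constant matters because the reaction rate may come arbitrarily close
  to it.\<close>

lemma DA_poincare_pos:
  assumes "v \<in> DA"
  shows "pi\<^sup>2 * (norm (pos v))\<^sup>2 \<le> inner (A_op v) (pos v)"
proof -
  have bd: "AE x in I01. \<bar>pi\<^sup>2\<bar> \<le> pi\<^sup>2" by simp
  have s: "sin (pi * x) > 0" if "0 < x" "x < 1" for x
    using that by (intro sin_gt_zero) auto
  have "inner (mult_L2 (\<lambda>x. pi\<^sup>2) (pos v)) (pos v) \<le> inner (A_op v) (pos v)"
  proof (rule DA_inner_pos[OF assms _ bd])
    fix \<psi> assume t: "test_fun {0<..<1} \<psi>"
    show "(LINT x|I01. pi\<^sup>2 * (\<psi> x)\<^sup>2) \<le> (LINT x|I01. (deriv \<psi> x)\<^sup>2)"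
    proof (rule picone[OF t, of "\<lambda>x. - pi * cos (pi * x) / sin (pi * x)" "\<lambda>x. pi\<^sup>2 / (sin (pi * x))\<^sup>2"])
      fix x :: real assume x: "0 < x" "x < 1"
      have "((\<lambda>x. - pi * cos (pi * x) / sin (pi * x)) has_real_derivative
         (pi\<^sup>2 * (sin (pi * x))\<^sup>2 + pi\<^sup>2 * (cos (pi * x))\<^sup>2) / (sin (pi * x))\<^sup>2) (at x)"
        using s[OF x] by (auto intro!: derivative_eq_intros simp: power2_eq_square field_simps)
      thus "((\<lambda>x. - pi * cos (pi * x) / sin (pi * x)) has_real_derivative pi\<^sup>2 / (sin (pi * x))\<^sup>2) (at x)"
        by (simp flip: distrib_left)
      have "pi\<^sup>2 / (sin (pi * x))\<^sup>2 - (- pi * cos (pi * x) / sin (pi * x))\<^sup>2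
          = pi\<^sup>2 * (1 - (cos (pi * x))\<^sup>2) / (sin (pi * x))\<^sup>2"
        by (simp add: power_divide power_mult_distrib diff_divide_distrib right_diff_distrib)
      also have "\<dots> = pi\<^sup>2" using s[OF x] by (simp add: sin_squared_eq[symmetric])
      finally show "pi\<^sup>2 \<le> pi\<^sup>2 / (sin (pi * x))\<^sup>2 - (- pi * cos (pi * x) / sin (pi * x))\<^sup>2" by simp
    next
      show "continuous_on {0<..<1} (\<lambda>x. pi\<^sup>2 / (sin (pi * x))\<^sup>2)"
        using s by (intro continuous_intros) (auto simp: less_imp_neq[THEN not_sym])
    qed (use bd in auto)
  qed auto
  also have "inner (mult_L2 (\<lambda>x. pi\<^sup>2) (pos v)) (pos v) = pi\<^sup>2 * (norm (pos v))\<^sup>2"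
    by (subst inner_mult_L2_self(1)[OF _ bd]) (simp_all only: norm_L2_sq integral_mult_right_zero borel_measurable_const)
  finally show ?thesis .
qed

text \<open>This is 1/(x(1-x)), a multiple of the reciprocal of the barrier used later; the sum form
  separates the two endpoints.\<close>

definition hardy_weight :: "real \<Rightarrow> real" where
  "hardy_weight x = 1 / x + 1 / (1 - x)"

text \<open>Here p belongs to phi = exp(4 (sqrt x + sqrt(1-x))). Near 0, p' is of order x^(-3/2) and
  beats both p^2 and K/x, which are of order 1/x, whatever the size of K; likewise near 1.
  Truncation at \<open>N\<close> makes the weight bounded, as \<open>DA_inner_pos\<close>
  demands.\<close>

lemma DA_hardy_pos:
  assumes "v \<in> DA" "0 \<le> K" "0 \<le> N"
  defines "Q \<equiv> \<lambda>x. min (K * hardy_weight x - 2 * (K + 4) ^ 3) N"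
  shows "(LINT x|I01. Q x * (rep_L2 (pos v) x)\<^sup>2) \<le> inner (A_op v) (pos v)"
    and "integrable I01 (\<lambda>x. Q x * (rep_L2 (pos v) x)\<^sup>2)"
proof -
  define C where "C = 2 * (K + 4) ^ 3"
  have Q: "Q x = min (K * hardy_weight x - C) N" for x by (simp add: Q_def C_def)
  have Qm: "Q \<in> borel_measurable I01"
    unfolding Q_def hardy_weight_def by (intro continuous_measurable_I01 continuous_intros) auto
  have C0: "0 \<le> C" using assms(2) by (simp add: C_def)
  have bd: "AE x in I01. \<bar>Q x\<bar> \<le> C + N"
  proof (rule AE_I01_I)
    fix x :: real assume "0 < x" "x < 1"
    hence "0 \<le> K * hardy_weight x" using assms(2) by (simp add: hardy_weight_def)
    thus "\<bar>Q x\<bar> \<le> C + N" unfolding Q using C0 assms(3) by (auto simp: min_def abs_if)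
  qed
  \<comment> \<open>y stands for the inverse square root of x or of 1 - x. Above K + 4 the cube
    wins, below it the constant does; one constant for each endpoint explains the factor 2 in
    \<open>C\<close>.\<close>
  have cubic: "K * y\<^sup>2 - (K + 4) ^ 3 \<le> y ^ 3 - 4 * y\<^sup>2" if "0 \<le> y" for y
  proof (cases "K + 4 \<le> y")
    case True
    have "0 \<le> y\<^sup>2 * (y - (K + 4))" using True by simp
    moreover have "0 \<le> (K + 4) ^ 3" using assms(2) by simp
    ultimately show ?thesis by (simp add: power2_eq_square power3_eq_cube algebra_simps)
  next
    case False
    have "(K + 4) * y\<^sup>2 \<le> (K + 4) * (K + 4)\<^sup>2"
      using False that assms(2) by (intro mult_left_mono power_mono) auto
    moreover have "0 \<le> y ^ 3" using that by simp
    moreover have "(K + 4) * (K + 4)\<^sup>2 = (K + 4) ^ 3" by (simp add: power2_eq_square power3_eq_cube)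
    ultimately show ?thesis by (simp only: distrib_right)
  qed
  have "inner (mult_L2 Q (pos v)) (pos v) \<le> inner (A_op v) (pos v)"
  proof (rule DA_inner_pos[OF assms(1) Qm bd])
    fix \<psi> assume t: "test_fun {0<..<1} \<psi>"
    show "(LINT x|I01. Q x * (\<psi> x)\<^sup>2) \<le> (LINT x|I01. (deriv \<psi> x)\<^sup>2)"
    proof (rule picone[OF t, of "\<lambda>x. 2 * (1 / sqrt (1 - x) - 1 / sqrt x)"
          "\<lambda>x. (1 / sqrt (1 - x)) ^ 3 + (1 / sqrt x) ^ 3"])
      fix x :: real assume x: "0 < x" "x < 1"
      have sq: "sqrt x * sqrt x = x" "sqrt (1 - x) * sqrt (1 - x) = 1 - x"
        "sqrt x > 0" "sqrt (1 - x) > 0" using x by auto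
      have d1: "((\<lambda>x. 1 / sqrt x) has_real_derivative - ((1 / sqrt x) ^ 3 / 2)) (at x)"
        using x by (auto intro!: derivative_eq_intros simp: field_simps power3_eq_cube)
      have d2: "((\<lambda>x. 1 / sqrt (1 - x)) has_real_derivative ((1 / sqrt (1 - x)) ^ 3 / 2)) (at x)"
        using x by (auto intro!: derivative_eq_intros simp: field_simps power3_eq_cube)
      have "((\<lambda>x. 2 * (1 / sqrt (1 - x) - 1 / sqrt x)) has_real_derivative
        2 * ((1 / sqrt (1 - x)) ^ 3 / 2 - - ((1 / sqrt x) ^ 3 / 2))) (at x)"
        by (intro DERIV_cmult DERIV_diff d1 d2)
      thus "((\<lambda>x. 2 * (1 / sqrt (1 - x) - 1 / sqrt x)) has_real_derivative
          (1 / sqrt (1 - x)) ^ 3 + (1 / sqrt x) ^ 3) (at x)" by simp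
      define y z where "y = 1 / sqrt x" and "z = 1 / sqrt (1 - x)"
      have yz: "0 \<le> y" "0 \<le> z" "y\<^sup>2 = 1 / x" "z\<^sup>2 = 1 / (1 - x)"
        using x by (auto simp: y_def z_def power_divide)
      have "K * hardy_weight x - C = (K * y\<^sup>2 - (K + 4) ^ 3) + (K * z\<^sup>2 - (K + 4) ^ 3)"
        by (simp only: hardy_weight_def yz(3,4)) (simp only: distrib_left mult_2 C_def)
      also have "\<dots> \<le> (y ^ 3 - 4 * y\<^sup>2) + (z ^ 3 - 4 * z\<^sup>2)"
        by (intro add_mono cubic yz)
      \<comment> \<open>Only the nonnegative cross term 8 y z is dropped.\<close>
      also have "\<dots> \<le> z ^ 3 + y ^ 3 - (2 * (z - y))\<^sup>2"
        using mult_nonneg_nonneg[OF yz(1,2)] by (simp add: power2_eq_square algebra_simps)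
      finally have "K * hardy_weight x - C \<le> z ^ 3 + y ^ 3 - (2 * (z - y))\<^sup>2" .
      thus "Q x \<le> (1 / sqrt (1 - x)) ^ 3 + (1 / sqrt x) ^ 3 - (2 * (1 / sqrt (1 - x) - 1 / sqrt x))\<^sup>2"
        unfolding Q y_def z_def by (rule min.coboundedI1)
    next
      show "continuous_on {0<..<1} (\<lambda>x. (1 / sqrt (1 - x)) ^ 3 + (1 / sqrt x) ^ 3)"
        by (intro continuous_intros) auto
    qed (use Qm bd in auto)
  qed
  thus "(LINT x|I01. Q x * (rep_L2 (pos v) x)\<^sup>2) \<le> inner (A_op v) (pos v)"
    by (simp add: inner_mult_L2_self(1)[OF Qm bd])
  show "integrable I01 (\<lambda>x. Q x * (rep_L2 (pos v) x)\<^sup>2)" by (rule inner_mult_L2_self(2)[OF Qm bd])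
qed

text \<open>The truncated Hardy weights increase to the full one; pass to the limit by dominated convergence.\<close>

lemma hardy_absorb:
  assumes w: "w \<in> DA" and K: "0 \<le> K" and k: "0 \<le> \<kappa>"
    and G: "AE x in I01. rep_L2 G x * rep_L2 (pos w) x \<le> (K * hardy_weight x + \<kappa>) * (rep_L2 (pos w) x)\<^sup>2"
  shows "inner G (pos w) \<le> inner (A_op w) (pos w) + (\<kappa> + 2 * (K + 4) ^ 3) * (norm (pos w))\<^sup>2"
proof -
  let ?P = "rep_L2 (pos w)" and ?g = "\<lambda>x. rep_L2 G x * rep_L2 (pos w) x"
  define C where "C = 2 * (K + 4) ^ 3"
  define Q where "Q n x = min (K * hardy_weight x - C) (real n)" for n x
  have C0: "0 \<le> C" using K by (simp add: C_def)
  \<comment> \<open>The second entry is nonnegative and, once n exceeds the weight at x, it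
    dominates \<open>?g x\<close>. Hence |h n| \<le> |?g|, h n converges to ?g, and its integral is
    bounded by the truncated inequality for each n.\<close>
  define h where "h n x = min (?g x) (Q n x * (?P x)\<^sup>2 + (\<kappa> + C) * (?P x)\<^sup>2)" for n x
  have iP: "integrable I01 (\<lambda>x. (?P x)\<^sup>2)" using sq_int_rep_L2 by (simp add: sq_int_def)
  have iQ: "integrable I01 (\<lambda>x. Q n x * (?P x)\<^sup>2)" "(LINT x|I01. Q n x * (?P x)\<^sup>2) \<le> inner (A_op w) (pos w)" for n
    unfolding Q_def C_def using DA_hardy_pos[OF w K, of "real n"] by auto
  have ig: "integrable I01 ?g" by (intro sq_int_mult sq_int_rep_L2)
  have iR: "integrable I01 (\<lambda>x. Q n x * (?P x)\<^sup>2 + (\<kappa> + C) * (?P x)\<^sup>2)" for n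
    by (intro Bochner_Integration.integrable_add iQ integrable_mult_right iP)
  have "(\<lambda>n. LINT x|I01. h n x) \<longlonglongrightarrow> (LINT x|I01. ?g x)"
  proof (rule integral_dominated_convergence)
    show "integrable I01 (\<lambda>x. norm (?g x))" by (rule integrable_norm[OF ig])
    show "h n \<in> borel_measurable I01" for n
      unfolding h_def using ig iR by (intro borel_measurable_min borel_measurable_integrable) auto
    show "?g \<in> borel_measurable I01" using ig by auto
    show "AE x in I01. (\<lambda>n. h n x) \<longlonglongrightarrow> ?g x"
      using G
    proof eventually_elim
      case (elim x)
      obtain N :: nat where N: "K * hardy_weight x - C \<le> real N" using real_arch_simple by blast
      have "\<forall>\<^sub>F n in sequentially. h n x = ?g x"
        using eventually_ge_at_top[of N]
      proof eventually_elim
        case (elim n)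
        hence "K * hardy_weight x = Q n x + C" using N by (simp add: Q_def)
        hence "Q n x * (?P x)\<^sup>2 + (\<kappa> + C) * (?P x)\<^sup>2 = (K * hardy_weight x + \<kappa>) * (?P x)\<^sup>2"
          by (simp add: distrib_right)
        thus ?case using \<open>?g x \<le> (K * hardy_weight x + \<kappa>) * (?P x)\<^sup>2\<close> by (simp add: h_def)
      qed
      thus ?case by (rule tendsto_eventually)
    qed
    show "AE x in I01. norm (h n x) \<le> norm (?g x)" for n
    proof (rule AE_I01_I)
      fix x :: real assume "0 < x" "x < 1"
      hence "0 \<le> K * hardy_weight x" using K by (simp add: hardy_weight_def)
      hence "0 \<le> Q n x + (\<kappa> + C)" using C0 k by (auto simp: Q_def min_def)
      hence "0 \<le> (Q n x + (\<kappa> + C)) * (?P x)\<^sup>2" by simp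
      hence "0 \<le> Q n x * (?P x)\<^sup>2 + (\<kappa> + C) * (?P x)\<^sup>2" by (simp only: distrib_right)
      thus "norm (h n x) \<le> norm (?g x)" unfolding h_def by (auto simp: min_def abs_if)
    qed
  qed
  moreover have "(LINT x|I01. h n x) \<le> inner (A_op w) (pos w) + (\<kappa> + C) * (norm (pos w))\<^sup>2" for n
  proof -
    have "(LINT x|I01. h n x) \<le> (LINT x|I01. Q n x * (?P x)\<^sup>2 + (\<kappa> + C) * (?P x)\<^sup>2)"
      unfolding h_def by (intro integral_mono integrable_min ig iR) auto
    also have "\<dots> = (LINT x|I01. Q n x * (?P x)\<^sup>2) + (\<kappa> + C) * (LINT x|I01. (?P x)\<^sup>2)"
      using iQ iP by simp
    also have "(LINT x|I01. (?P x)\<^sup>2) = (norm (pos w))\<^sup>2" by (rule norm_L2_sq[symmetric])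
    finally show ?thesis using iQ(2)[of n] by linarith
  qed
  ultimately show ?thesis
    unfolding inner_L2_iff[of G] C_def[symmetric] by (intro LIMSEQ_le_const2[where X = "\<lambda>n. LINT x|I01. h n x"]) auto
qed

section \<open>The sine system\<close>

lemma integral_I01_FTC:
  assumes "\<And>x. (F has_real_derivative F' x) (at x)" "continuous_on UNIV F'"
  shows "(LINT x|I01. F' x) = F 1 - F 0"
proof -
  have i: "integrable I01 F'"
  proof -
    have "sq_int I01 F'" "sq_int I01 (\<lambda>x. 1)"
      by (intro sq_int_continuous continuous_intros continuous_on_subset[OF assms(2)]; simp)+
    from sq_int_mult[OF this] show ?thesis by simp
  qed
  have "(F' has_integral F 1 - F 0) {0..1}"
  proof (rule fundamental_theorem_of_calculus)
    fix x :: real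
    have "(F has_vector_derivative F' x) (at x)"
      using assms(1) by (simp add: has_real_derivative_iff_has_vector_derivative)
    thus "(F has_vector_derivative F' x) (at x within {0..1})" by (rule has_vector_derivative_at_within)
  qed simp
  hence "(F' has_integral F 1 - F 0) {0<..<1}"
    using has_integral_open_interval[of F' "F 1 - F 0" 0 1] by simp
  moreover have "(F' has_integral integral\<^sup>L I01 F') {0<..<1}"
    by (rule has_integral_integral_lebesgue_on[OF i]) simp
  ultimately show ?thesis by (metis has_integral_unique)
qed

text \<open>Only odd multiples of pi: the even sine modes are antisymmetric about 1/2 and so
  orthogonal to 1.\<close>

definition freq :: "nat \<Rightarrow> real" where
  "freq k = (2 * real k + 1) * pi"

definition sine :: "nat \<Rightarrow> real \<Rightarrow> real" where
  "sine k x = sqrt 2 * sin (freq k * x)"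

definition e_sine :: "nat \<Rightarrow> L2" where
  "e_sine k = abs_L2 (sine k)"

definition c_sine :: "nat \<Rightarrow> real" where
  "c_sine k = 2 * sqrt 2 / freq k"

definition one_L2 :: L2 where
  "one_L2 = abs_L2 (\<lambda>x. 1)"

lemma freq_ge: "pi \<le> freq k"
  by (simp add: freq_def)

lemma freq_pos: "0 < freq k"
  by (simp add: freq_def)

lemma sin_freq: "sin (freq k) = 0" and cos_freq: "cos (freq k) = -1"
  unfolding freq_def distrib_right
  by (simp_all add: sin_add cos_add sin_2npi cos_2npi)

lemma smooth_sine: "smooth (sine k)"
  unfolding sine_def[abs_def] by (intro smooth_cmult smooth_compose[OF smooth_sin] smooth_ident)

lemma sq_int_one: "sq_int I01 (\<lambda>x. 1)"
  by (intro sq_int_continuous continuous_intros)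

lemma rep_one_L2: "AE x in I01. rep_L2 one_L2 x = 1"
  unfolding one_L2_def by (rule rep_abs_L2[OF sq_int_one])

lemma e_sine_DA: "e_sine k \<in> DA" "A_op (e_sine k) = (freq k)\<^sup>2 *\<^sub>R e_sine k"
proof -
  have "(sine k has_real_derivative sqrt 2 * (freq k * cos (freq k * x))) (at x)" for x
    unfolding sine_def[abs_def] by (auto intro!: derivative_eq_intros)
  hence d1: "deriv (sine k) = (\<lambda>x. sqrt 2 * (freq k * cos (freq k * x)))"
    by (intro ext DERIV_imp_deriv)
  have "((\<lambda>x. sqrt 2 * (freq k * cos (freq k * x))) has_real_derivative - (freq k)\<^sup>2 * sine k x) (at x)" for x
    unfolding sine_def by (auto intro!: derivative_eq_intros simp: power2_eq_square)
  hence d2: "deriv (deriv (sine k)) = (\<lambda>x. - (freq k)\<^sup>2 * sine k x)"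
    unfolding d1 by (intro ext DERIV_imp_deriv)
  have b: "sine k 0 = 0" "sine k 1 = 0" by (simp_all add: sine_def sin_freq)
  show "e_sine k \<in> DA" unfolding e_sine_def by (rule DA_smooth(1)[OF smooth_sine b])
  have "A_op (e_sine k) = - abs_L2 (\<lambda>x. - (freq k)\<^sup>2 * sine k x)"
    unfolding e_sine_def DA_smooth(2)[OF smooth_sine b] d2 ..
  also have "\<dots> = - (- (freq k)\<^sup>2 *\<^sub>R abs_L2 (sine k))"
    by (simp only: abs_L2_scale[OF sq_int_smooth[OF smooth_sine]])
  finally show "A_op (e_sine k) = (freq k)\<^sup>2 *\<^sub>R e_sine k" by (simp add: e_sine_def)
qed

lemma inner_e_sine: "inner (e_sine j) (e_sine k) = (if j = k then 1 else 0)"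
proof (cases "j = k")
  case True
  have "((\<lambda>x. x - sin (freq k * x) * cos (freq k * x) / freq k) has_real_derivative sine k x * sine k x) (at x)" for x
  proof -
    have "((\<lambda>x. x - sin (freq k * x) * cos (freq k * x) / freq k) has_real_derivative
      1 - (cos (freq k * x) * cos (freq k * x) - sin (freq k * x) * sin (freq k * x))) (at x)"
      using freq_pos[of k] by (auto intro!: derivative_eq_intros simp: field_simps)
    moreover have "1 - (cos y * cos y - sin y * sin y) = 2 * (sin y * sin y)" for y :: real
      using sin_cos_squared_add[of y] by (simp add: power2_eq_square algebra_simps)
    moreover have "sine k x * sine k x = 2 * (sin (freq k * x) * sin (freq k * x))"
      by (simp add: sine_def)
    ultimately show ?thesis by (simp only:)
  qed
  hence "(LINT x|I01. sine k x * sine k x) = 1"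
    by (subst integral_I01_FTC) (auto simp: sin_freq intro!: smooth_continuous_on smooth_mult smooth_sine)
  thus ?thesis using True by (simp add: e_sine_def inner_abs_L2 sq_int_smooth smooth_sine)
next
  \<comment> \<open>Eigenvectors of the symmetric operator A for distinct eigenvalues are
    orthogonal.\<close>
  case False
  have "(freq j)\<^sup>2 * inner (e_sine j) (e_sine k) = (freq k)\<^sup>2 * inner (e_sine j) (e_sine k)"
    using A_op_symmetric[OF e_sine_DA(1) e_sine_DA(1), of j k] by (simp add: e_sine_DA(2))
  moreover have "(freq j)\<^sup>2 \<noteq> (freq k)\<^sup>2"
  proof -
    have "freq j \<noteq> freq k" using False by (simp add: freq_def)
    moreover have "freq j \<noteq> - freq k" using freq_pos[of j] freq_pos[of k] by linarith
    ultimately show ?thesis by (simp add: power2_eq_iff)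
  qed
  ultimately show ?thesis using False by simp
qed

lemma inner_one_e_sine: "inner one_L2 (e_sine k) = c_sine k"
proof -
  have "((\<lambda>x. - sqrt 2 * cos (freq k * x) / freq k) has_real_derivative sine k x) (at x)" for x
    using freq_pos[of k] by (auto intro!: derivative_eq_intros simp: sine_def)
  hence "(LINT x|I01. sine k x) = - sqrt 2 * cos (freq k * 1) / freq k - - sqrt 2 * cos (freq k * 0) / freq k"
    by (rule integral_I01_FTC) (intro smooth_continuous_on smooth_sine)
  thus ?thesis
    by (simp add: one_L2_def e_sine_def inner_abs_L2 sq_int_one sq_int_smooth smooth_sine c_sine_def cos_freq)
qed

lemma norm_one_L2: "norm one_L2 = 1"
proof -
  have "(norm one_L2)\<^sup>2 = 1"
    unfolding one_L2_def norm_abs_L2[OF sq_int_one] by (simp add: measure_restrict_space)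
  thus ?thesis using norm_ge_zero[of one_L2] unfolding power2_eq_1_iff by auto
qed

text \<open>From the sum pi^2/6 of the inverse squares: grouping the terms in pairs splits odd from
  even, the even ones make up a quarter, and the odd ones sum to pi^2/8. The squared coefficient is
  8 divided by the squared frequency.\<close>

lemma c_sine_sq_sums: "(\<lambda>k. (c_sine k)\<^sup>2) sums 1"
proof -
  let ?f = "\<lambda>n. 1 / (real n + 1)\<^sup>2"
  have s: "?f sums (pi\<^sup>2 / 6)" using inverse_squares_sums by (simp add: add.commute)
  have "(\<lambda>n. sum ?f {n * 2..<n * 2 + 2}) sums (pi\<^sup>2 / 6)" by (rule sums_group[OF s]) simp
  moreover have "sum ?f {n * 2..<n * 2 + 2} = 1 / (2 * real n + 1)\<^sup>2 + (1 / 4) * ?f n" for n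
    by (simp add: numeral_2_eq_2 power2_eq_square field_simps)
  ultimately have "(\<lambda>n. 1 / (2 * real n + 1)\<^sup>2 + (1 / 4) * ?f n) sums (pi\<^sup>2 / 6)" by simp
  from sums_diff[OF this sums_mult[OF s, of "1 / 4"]]
  have "(\<lambda>n. 1 / (2 * real n + 1)\<^sup>2) sums (pi\<^sup>2 / 8)" by simp
  from sums_mult[OF this, of "8 / pi\<^sup>2"]
  have "(\<lambda>n. 8 / pi\<^sup>2 * (1 / (2 * real n + 1)\<^sup>2)) sums 1" by simp
  moreover have "8 / pi\<^sup>2 * (1 / (2 * real n + 1)\<^sup>2) = (c_sine n)\<^sup>2" for n
    by (simp add: c_sine_def freq_def power_divide power_mult_distrib ac_simps)
  ultimately show ?thesis by simp
qed

section \<open>Sine series with bounded multipliers\<close>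

lemma norm_sum_e_sine:
  assumes "finite I"
  shows "(norm (\<Sum>k\<in>I. a k *\<^sub>R e_sine k))\<^sup>2 = (\<Sum>k\<in>I. (a k)\<^sup>2)"
  using assms
  by (simp add: power2_norm_eq_inner inner_sum_left inner_sum_right inner_e_sine if_distrib
      cong: if_cong) (simp add: power2_eq_square sum.delta)

text \<open>For an orthonormal system the squared distance of 1 from its partial sums is 1 minus the
  sum of squared coefficients. Parseval's identity for this single function thus gives convergence,
  without completeness of the system.\<close>

lemma one_L2_sums: "(\<lambda>k. c_sine k *\<^sub>R e_sine k) sums one_L2"
proof -
  have "(norm ((\<Sum>k<n. c_sine k *\<^sub>R e_sine k) - one_L2))\<^sup>2 = 1 - (\<Sum>k<n. (c_sine k)\<^sup>2)" for n
  proof -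
    let ?S = "\<Sum>k<n. c_sine k *\<^sub>R e_sine k"
    have "inner one_L2 ?S = (\<Sum>k<n. (c_sine k)\<^sup>2)"
      by (simp add: inner_sum_right inner_one_e_sine power2_eq_square)
    moreover have "inner ?S ?S = (\<Sum>k<n. (c_sine k)\<^sup>2)"
      using norm_sum_e_sine[of "{..<n}" c_sine] by (simp add: power2_norm_eq_inner)
    moreover have "inner one_L2 one_L2 = 1" using norm_one_L2 by (simp add: norm_eq_1)
    ultimately show ?thesis
      by (simp add: power2_norm_eq_inner inner_diff_left inner_diff_right inner_commute)
  qed
  moreover have "(\<lambda>n. 1 - (\<Sum>k<n. (c_sine k)\<^sup>2)) \<longlonglongrightarrow> 1 - 1"
    using c_sine_sq_sums unfolding sums_def by (intro tendsto_intros)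
  ultimately have "(\<lambda>n. (norm ((\<Sum>k<n. c_sine k *\<^sub>R e_sine k) - one_L2))\<^sup>2) \<longlonglongrightarrow> 0" by simp
  from tendsto_real_sqrt[OF this] have "(\<lambda>n. norm ((\<Sum>k<n. c_sine k *\<^sub>R e_sine k) - one_L2)) \<longlonglongrightarrow> 0" by simp
  thus ?thesis unfolding sums_def by (intro tendsto_norm_le_L2[OF order_refl])
qed

lemma sine_series_tail:
  assumes z: "\<And>k. \<bar>z k\<bar> \<le> Z"
  shows "norm (\<Sum>k=m..<n. (c_sine k * z k) *\<^sub>R e_sine k) \<le> \<bar>Z\<bar> * sqrt (\<Sum>k=m..<n. (c_sine k)\<^sup>2)"
proof -
  have "(norm (\<Sum>k=m..<n. (c_sine k * z k) *\<^sub>R e_sine k))\<^sup>2 = (\<Sum>k=m..<n. (c_sine k * z k)\<^sup>2)"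
    by (rule norm_sum_e_sine) simp
  also have "\<dots> \<le> (\<Sum>k=m..<n. Z\<^sup>2 * (c_sine k)\<^sup>2)"
  proof (rule sum_mono)
    fix k
    have "(z k)\<^sup>2 \<le> Z\<^sup>2" using z[of k] by (metis abs_ge_zero abs_le_square_iff abs_of_nonneg order_trans)
    hence "(z k)\<^sup>2 * (c_sine k)\<^sup>2 \<le> Z\<^sup>2 * (c_sine k)\<^sup>2" by (rule mult_right_mono) simp
    thus "(c_sine k * z k)\<^sup>2 \<le> Z\<^sup>2 * (c_sine k)\<^sup>2"
      by (simp add: power_mult_distrib mult.commute)
  qed
  also have "\<dots> = (\<bar>Z\<bar> * sqrt (\<Sum>k=m..<n. (c_sine k)\<^sup>2))\<^sup>2"
    by (simp add: power_mult_distrib sum_nonneg flip: sum_distrib_left)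
  finally show ?thesis by (rule power2_le_imp_le) (simp add: sum_nonneg)
qed

text \<open>The index depends on the multipliers only through their bound \<open>Z\<close>. For
  multipliers depending on time this means uniform convergence in time, as termwise differentiation
  needs.\<close>

lemma sine_series_uniformly_Cauchy:
  assumes "e > 0"
  shows "\<exists>N. \<forall>z m n. (\<forall>k. \<bar>z k\<bar> \<le> Z) \<longrightarrow> N \<le> m \<longrightarrow>
    norm (\<Sum>k=m..<n. (c_sine k * z k) *\<^sub>R e_sine k) < e"
proof -
  have "summable (\<lambda>k. (c_sine k)\<^sup>2)" using c_sine_sq_sums sums_summable by blast
  moreover have e2: "(e / (\<bar>Z\<bar> + 1))\<^sup>2 > 0" using assms by (auto simp: add_nonneg_eq_0_iff)
  ultimately obtain N where N: "\<And>m n. N \<le> m \<Longrightarrow> norm (\<Sum>k=m..<n. (c_sine k)\<^sup>2) < (e / (\<bar>Z\<bar> + 1))\<^sup>2"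
    unfolding summable_Cauchy by blast
  show ?thesis
  proof (intro exI[of _ N] allI impI)
    fix z :: "nat \<Rightarrow> real" and m n assume z: "\<forall>k. \<bar>z k\<bar> \<le> Z" and m: "N \<le> m"
    have "(\<Sum>k=m..<n. (c_sine k)\<^sup>2) < (e / (\<bar>Z\<bar> + 1))\<^sup>2" using N[OF m, of n] by simp
    hence "sqrt (\<Sum>k=m..<n. (c_sine k)\<^sup>2) < sqrt ((e / (\<bar>Z\<bar> + 1))\<^sup>2)"
      by (rule real_sqrt_less_mono)
    hence s: "sqrt (\<Sum>k=m..<n. (c_sine k)\<^sup>2) < e / (\<bar>Z\<bar> + 1)" using assms by simp
    have "norm (\<Sum>k=m..<n. (c_sine k * z k) *\<^sub>R e_sine k) \<le> \<bar>Z\<bar> * sqrt (\<Sum>k=m..<n. (c_sine k)\<^sup>2)"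
      by (rule sine_series_tail[OF z[rule_format]])
    also have "\<dots> \<le> \<bar>Z\<bar> * (e / (\<bar>Z\<bar> + 1))" using s by (intro mult_left_mono) auto
    also have "\<dots> < e" using assms by (simp add: field_simps)
    finally show "norm (\<Sum>k=m..<n. (c_sine k * z k) *\<^sub>R e_sine k) < e" .
  qed
qed

lemma sine_series_summable:
  assumes "\<And>k. \<bar>z k\<bar> \<le> Z"
  shows "summable (\<lambda>k. (c_sine k * z k) *\<^sub>R e_sine k)"
  unfolding summable_Cauchy
proof (intro allI impI)
  fix e :: real assume "e > 0"
  from sine_series_uniformly_Cauchy[OF this, of Z]
  show "\<exists>N. \<forall>m\<ge>N. \<forall>n. norm (\<Sum>k=m..<n. (c_sine k * z k) *\<^sub>R e_sine k) < e" using assms by blast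
qed

lemma DA_sum:
  assumes "finite I" "\<And>k. k \<in> I \<Longrightarrow> v k \<in> DA"
  shows "(\<Sum>k\<in>I. a k *\<^sub>R v k) \<in> DA \<and> A_op (\<Sum>k\<in>I. a k *\<^sub>R v k) = (\<Sum>k\<in>I. a k *\<^sub>R A_op (v k))"
  using assms
proof (induction I)
  case empty
  show ?case using DA_linear[OF e_sine_DA(1)[of 0] e_sine_DA(1)[of 0], where c = 0 and d = 0] by simp
next
  case (insert i I)
  thus ?case using DA_linear[of "v i" "\<Sum>k\<in>I. a k *\<^sub>R v k" "a i" 1] by simp
qed

text \<open>Finite sums of eigenfunctions lie in the domain, and A is closed.\<close>

lemma sine_series_DA:
  assumes s: "(\<lambda>k. a k *\<^sub>R e_sine k) sums v" and s2: "(\<lambda>k. (a k * (freq k)\<^sup>2) *\<^sub>R e_sine k) sums h"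
  shows "v \<in> DA" "A_op v = h"
proof -
  have *: "(\<Sum>k<n. a k *\<^sub>R e_sine k) \<in> DA" "A_op (\<Sum>k<n. a k *\<^sub>R e_sine k) = (\<Sum>k<n. (a k * (freq k)\<^sup>2) *\<^sub>R e_sine k)" for n
    using DA_sum[of "{..<n}" e_sine a] by (simp_all add: e_sine_DA)
  show "v \<in> DA" "A_op v = h"
    by (rule DA_closed[where X = "\<lambda>n. \<Sum>k<n. a k *\<^sub>R e_sine k"];
        use * s s2 in \<open>simp add: sums_def\<close>)+
qed

lemma sine_series_norm:
  assumes z: "\<And>k. \<bar>z k\<bar> \<le> Z"
  shows "norm (\<Sum>k. (c_sine k * z k) *\<^sub>R e_sine k) \<le> \<bar>Z\<bar>"
proof -
  have "(\<lambda>n. norm (\<Sum>k<n. (c_sine k * z k) *\<^sub>R e_sine k)) \<longlonglongrightarrow> norm (\<Sum>k. (c_sine k * z k) *\<^sub>R e_sine k)"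
    by (intro tendsto_norm summable_LIMSEQ sine_series_summable[OF z])
  moreover have "norm (\<Sum>k<n. (c_sine k * z k) *\<^sub>R e_sine k) \<le> \<bar>Z\<bar>" for n
  proof -
    have "norm (\<Sum>k=0..<n. (c_sine k * z k) *\<^sub>R e_sine k) \<le> \<bar>Z\<bar> * sqrt (\<Sum>k=0..<n. (c_sine k)\<^sup>2)"
      by (rule sine_series_tail[OF z])
    also have "(\<Sum>k=0..<n. (c_sine k)\<^sup>2) \<le> 1"
      using sum_le_suminf[OF sums_summable[OF c_sine_sq_sums], of "{0..<n}"] sums_unique[OF c_sine_sq_sums] by simp
    hence "\<bar>Z\<bar> * sqrt (\<Sum>k=0..<n. (c_sine k)\<^sup>2) \<le> \<bar>Z\<bar>" by (intro mult_left_le) (auto simp: sum_nonneg)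
    finally show ?thesis by (simp add: atLeast0LessThan)
  qed
  ultimately show ?thesis by (intro LIMSEQ_le_const2) auto
qed

lemma sine_series_uniform:
  assumes "e > 0"
  shows "\<exists>N. \<forall>z n. (\<forall>k. \<bar>z k\<bar> \<le> Z) \<longrightarrow> N \<le> n \<longrightarrow>
    norm ((\<Sum>k<n. (c_sine k * z k) *\<^sub>R e_sine k) - (\<Sum>k. (c_sine k * z k) *\<^sub>R e_sine k)) \<le> e"
proof -
  obtain N where N: "\<forall>z m n. (\<forall>k. \<bar>z k\<bar> \<le> Z) \<longrightarrow> N \<le> m \<longrightarrow>
    norm (\<Sum>k=m..<n. (c_sine k * z k) *\<^sub>R e_sine k) < e"
    using sine_series_uniformly_Cauchy[OF assms, of Z] by blast
  show ?thesis
  proof (intro exI[of _ N] allI impI)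
    fix z :: "nat \<Rightarrow> real" and n assume z: "\<forall>k. \<bar>z k\<bar> \<le> Z" and n: "N \<le> n"
    let ?a = "\<lambda>k. (c_sine k * z k) *\<^sub>R e_sine k"
    have sm: "summable ?a" by (rule sine_series_summable[of z Z]) (use z in blast)
    have "(\<lambda>m. norm ((\<Sum>k<n. ?a k) - (\<Sum>k<m. ?a k))) \<longlonglongrightarrow> norm ((\<Sum>k<n. ?a k) - (\<Sum>k. ?a k))"
      by (intro tendsto_norm tendsto_diff tendsto_const summable_LIMSEQ sm)
    moreover have "norm ((\<Sum>k<n. ?a k) - (\<Sum>k<m. ?a k)) \<le> e" if "m \<ge> n" for m
    proof -
      have "(\<Sum>k<m. ?a k) - (\<Sum>k<n. ?a k) = (\<Sum>k=n..<m. ?a k)"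
        using sum_diff_nat_ivl[of 0 n m ?a] that by (simp add: atLeast0LessThan)
      hence "norm ((\<Sum>k<n. ?a k) - (\<Sum>k<m. ?a k)) = norm (\<Sum>k=n..<m. ?a k)"
        by (metis norm_minus_commute)
      thus ?thesis using N[rule_format, of z n m] z n by simp
    qed
    ultimately show "norm ((\<Sum>k<n. ?a k) - (\<Sum>k. ?a k)) \<le> e"
      by (intro LIMSEQ_le_const2) auto
  qed
qed

section \<open>Strong solutions\<close>

text \<open>A half-line is not a null set. This extracts the time-independent equation of a
  stationary point from a statement for almost every time.\<close>

lemma AE_lebesgue_on_const:
  fixes \<tau> :: real
  assumes "AE t in lebesgue_on {\<tau><..}. c"
  shows c
proof (rule ccontr)
  assume "\<not> c"
  have "AE t in lebesgue. t \<in> {\<tau><..} \<longrightarrow> c" using assms by (subst (asm) AE_restrict_space_iff) auto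
  then obtain N where "N \<in> null_sets lebesgue" "{t \<in> space lebesgue. \<not> (t \<in> {\<tau><..} \<longrightarrow> c)} \<subseteq> N"
    unfolding eventually_ae_filter by blast
  hence "negligible {\<tau><..}"
    using \<open>\<not> c\<close> negligible_subset[of N "{\<tau><..}"] by (auto simp: negligible_iff_null_sets)
  thus False using open_not_negligible[of "{\<tau><..}"] by (metis open_greaterThan greaterThan_non_empty)
qed

text \<open>Fubini for null sets. The argument goes through \<open>lborel\<close>, where the plane
  carries the product measure, and returns to completed measures afterwards.\<close>

lemma AE_lebesgue_on_prod:
  fixes A B :: "real set"
  assumes "AE z in lebesgue_on (A \<times> B). P z" "A \<in> sets borel" "B \<in> sets borel"
  shows "AE t in lebesgue_on A. AE x in lebesgue_on B. P (t, x)"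
proof -
  have AB: "A \<times> B \<in> sets (borel :: (real \<times> real) measure)" using assms by (simp add: borel_prod[symmetric])
  have "AE z in lebesgue. z \<in> A \<times> B \<longrightarrow> P z"
    using assms(1) AB by (subst (asm) AE_restrict_space_iff) auto
  hence "AE z in lborel \<Otimes>\<^sub>M (lborel :: real measure). z \<in> A \<times> B \<longrightarrow> P z"
    by (simp only: AE_completion_iff lborel_prod)
  hence "AE t in lborel. AE x in (lborel :: real measure). (t, x) \<in> A \<times> B \<longrightarrow> P (t, x)"
    by (rule lborel_pair.AE_pair)
  hence "AE t in lborel. t \<in> A \<longrightarrow> (AE x in lebesgue_on B. P (t, x))"
  proof eventually_elim
    case (elim t)
    show ?case
    proof
      assume "t \<in> A"
      hence "AE x in (lborel :: real measure). x \<in> B \<longrightarrow> P (t, x)" using elim by simp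
      hence "AE x in lebesgue. x \<in> B \<longrightarrow> P (t, x)" by (rule AE_completion)
      thus "AE x in lebesgue_on B. P (t, x)" using assms(3) by (subst AE_restrict_space_iff) auto
    qed
  qed
  hence "AE t in lebesgue. t \<in> A \<longrightarrow> (AE x in lebesgue_on B. P (t, x))" by (rule AE_completion)
  thus ?thesis using assms(2) by (subst AE_restrict_space_iff) auto
qed

text \<open>The definition speaks only of bounded intervals away from the initial time; countably
  many of them exhaust the open half-line.\<close>

lemma strong_solution_DA:
  assumes "strong_solution b \<omega> \<tau> v u"
  shows "AE t in lebesgue_on {\<tau><..}. u t \<in> DA"
proof -
  have "AE t in lebesgue. t \<in> {\<tau> + 1 / real (Suc n)<..<\<tau> + 2 + real n} \<longrightarrow> u t \<in> DA" for n
  proof -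
    have "0 < 1 / real (Suc n)" "1 / real (Suc n) \<le> 1" "0 \<le> real n" by simp_all
    hence "\<tau> < \<tau> + 1 / real (Suc n) \<and> \<tau> + 1 / real (Suc n) < \<tau> + 2 + real n" by linarith
    hence "AE t in lebesgue_on {\<tau> + 1 / real (Suc n)<..<\<tau> + 2 + real n}. u t \<in> DA"
      using assms unfolding strong_solution_def by blast
    thus ?thesis by (subst (asm) AE_restrict_space_iff) auto
  qed
  hence "AE t in lebesgue. \<forall>n. t \<in> {\<tau> + 1 / real (Suc n)<..<\<tau> + 2 + real n} \<longrightarrow> u t \<in> DA"
    unfolding AE_all_countable by blast
  hence "AE t in lebesgue. t \<in> {\<tau><..} \<longrightarrow> u t \<in> DA"
  proof eventually_elim
    case (elim t)
    show ?case
    proof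
      assume "t \<in> {\<tau><..}"
      hence "t - \<tau> > 0" by simp
      then obtain n where n: "inverse (real (Suc n)) < t - \<tau>" using reals_Archimedean by blast
      obtain m :: nat where m: "t - \<tau> - 2 < real m" using reals_Archimedean2 by blast
      have "1 / real (Suc (max n m)) \<le> inverse (real (Suc n))" by (simp add: inverse_eq_divide frac_le)
      hence "t \<in> {\<tau> + 1 / real (Suc (max n m))<..<\<tau> + 2 + real (max n m)}" using n m by auto
      thus "u t \<in> DA" using elim by blast
    qed
  qed
  thus ?thesis by (subst AE_restrict_space_iff) auto
qed

text \<open>The form in which the equation is used from here on: the joint representatives are
  eliminated by Fubini, leaving a pointwise inclusion in x and an explicit time derivative at almost
  every time.\<close>

lemma strong_solution_AE:
  assumes "strong_solution b \<omega> \<tau> v u"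
  shows "\<exists>f. AE t in lebesgue_on {\<tau><..}. u t \<in> DA \<and>
     (u has_vector_derivative b t *\<^sub>R f t + \<omega> t *\<^sub>R u t - A_op (u t)) (at t) \<and>
     (AE x in I01. rep_L2 (f t) x \<in> H0 (rep_L2 (u t) x))"
proof -
  obtain f F W where F: "joint_rep \<tau> f F" "joint_rep \<tau> u W"
    "AE z in lebesgue_on ({\<tau><..} \<times> {0<..<1}). F z \<in> H0 (W z)"
    and d: "AE t in lebesgue_on {\<tau><..}. \<exists>u'. (u has_vector_derivative u') (at t) \<and>
           u' + A_op (u t) = b t *\<^sub>R f t + \<omega> t *\<^sub>R u t"
    using assms unfolding strong_solution_def by blast
  have "AE t in lebesgue_on {\<tau><..}. AE x in I01. F (t, x) = rep_L2 (f t) x"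
    "AE t in lebesgue_on {\<tau><..}. AE x in I01. W (t, x) = rep_L2 (u t) x"
    using F unfolding joint_rep_def by blast+
  moreover have "AE t in lebesgue_on {\<tau><..}. AE x in I01. F (t, x) \<in> H0 (W (t, x))"
    by (rule AE_lebesgue_on_prod[OF F(3)]) auto
  ultimately have "AE t in lebesgue_on {\<tau><..}. u t \<in> DA \<and>
     (u has_vector_derivative b t *\<^sub>R f t + \<omega> t *\<^sub>R u t - A_op (u t)) (at t) \<and>
     (AE x in I01. rep_L2 (f t) x \<in> H0 (rep_L2 (u t) x))"
    using d strong_solution_DA[OF assms]
  proof eventually_elim
    case (elim t)
    obtain u' where u': "(u has_vector_derivative u') (at t)" "u' + A_op (u t) = b t *\<^sub>R f t + \<omega> t *\<^sub>R u t"
      using elim(4) by blast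
    have "u' = b t *\<^sub>R f t + \<omega> t *\<^sub>R u t - A_op (u t)" using u'(2) by (simp add: eq_diff_eq)
    moreover have "AE x in I01. rep_L2 (f t) x \<in> H0 (rep_L2 (u t) x)"
      using elim(1-3) by eventually_elim simp
    ultimately show ?case using u'(1) elim(5) by simp
  qed
  thus ?thesis by blast
qed

lemma H0_uminus: "y \<in> H0 u \<Longrightarrow> - y \<in> H0 (- u)"
  by (auto simp: H0_def split: if_splits)

lemma strong_solution_uminus:
  assumes "strong_solution b \<omega> \<tau> v u"
  shows "strong_solution b \<omega> \<tau> (- v) (\<lambda>t. - u t)"
proof -
  have c: "continuous_on {\<tau>..} u" "u \<tau> = v"
    "\<And>T1 T2. \<tau> < T1 \<Longrightarrow> T1 < T2 \<Longrightarrow> abs_continuous_on T1 T2 u"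
    "\<And>T1 T2. \<tau> < T1 \<Longrightarrow> T1 < T2 \<Longrightarrow> AE t in lebesgue_on {T1<..<T2}. u t \<in> DA"
    using assms unfolding strong_solution_def by blast+
  obtain f F W where f: "L2loc \<tau> f" and F: "joint_rep \<tau> f F" "joint_rep \<tau> u W"
    "AE z in lebesgue_on ({\<tau><..} \<times> {0<..<1}). F z \<in> H0 (W z)"
    and d: "AE t in lebesgue_on {\<tau><..}. \<exists>u'. (u has_vector_derivative u') (at t) \<and>
           u' + A_op (u t) = b t *\<^sub>R f t + \<omega> t *\<^sub>R u t"
    using assms unfolding strong_solution_def by blast
  have um: "(uminus :: L2 \<Rightarrow> L2) \<in> borel_measurable borel"
    by (intro borel_measurable_continuous_onI continuous_intros)
  have jr: "joint_rep \<tau> (\<lambda>t. - g t) (\<lambda>z. - G z)" if "joint_rep \<tau> g G" for g G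
  proof -
    have "AE t in lebesgue_on {\<tau><..}. AE x in I01. G (t, x) = rep_L2 (g t) x"
      using that by (simp add: joint_rep_def)
    hence "AE t in lebesgue_on {\<tau><..}. AE x in I01. - G (t, x) = rep_L2 (- g t) x"
    proof eventually_elim
      case (elim t)
      thus ?case using rep_L2_minus[of "g t"] by eventually_elim simp
    qed
    thus ?thesis using that by (simp add: joint_rep_def)
  qed
  show ?thesis
    unfolding strong_solution_def
  proof (intro conjI allI impI; (elim conjE)?)
    show "continuous_on {\<tau>..} (\<lambda>t. - u t)" by (intro continuous_intros c)
    show "- u \<tau> = - v" by (simp add: c)
    fix T1 T2 assume T: "\<tau> < T1" "T1 < T2"
    show "abs_continuous_on T1 T2 (\<lambda>t. - u t)"
    proof (rule abs_continuous_on_dominated[OF c(3)[OF T], of _ 1])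
      show "norm (- u y - - u x) \<le> 1 * (norm (u y - u x) + (y - x))" if "x \<le> y" for x y
        using that norm_minus_commute[of "u x" "u y"] by simp
    qed
    show "AE t in lebesgue_on {T1<..<T2}. - u t \<in> DA"
      using c(4)[OF T] by eventually_elim (rule DA_minus)
  next
    show "\<exists>f. L2loc \<tau> f \<and>
        (\<exists>F W. joint_rep \<tau> f F \<and> joint_rep \<tau> (\<lambda>t. - u t) W \<and>
           (AE z in lebesgue_on ({\<tau><..} \<times> {0<..<1}). F z \<in> H0 (W z))) \<and>
        (AE t in lebesgue_on {\<tau><..}. \<exists>u'. ((\<lambda>t. - u t) has_vector_derivative u') (at t) \<and>
           u' + A_op (- u t) = b t *\<^sub>R f t + \<omega> t *\<^sub>R (- u t))"
    proof (rule exI[of _ "\<lambda>t. - f t"], intro conjI)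
      show "L2loc \<tau> (\<lambda>t. - f t)"
        using f measurable_compose[OF _ um] unfolding L2loc_def by auto
      have "AE z in lebesgue_on ({\<tau><..} \<times> {0<..<1}). - F z \<in> H0 (- W z)"
        using F(3) by eventually_elim (rule H0_uminus)
      thus "\<exists>F W. joint_rep \<tau> (\<lambda>t. - f t) F \<and> joint_rep \<tau> (\<lambda>t. - u t) W \<and>
           (AE z in lebesgue_on ({\<tau><..} \<times> {0<..<1}). F z \<in> H0 (W z))"
        using jr[OF F(1)] jr[OF F(2)] by (rule_tac exI[of _ "\<lambda>z. - F z"], rule_tac exI[of _ "\<lambda>z. - W z"]) simp
      show "AE t in lebesgue_on {\<tau><..}. \<exists>u'. ((\<lambda>t. - u t) has_vector_derivative u') (at t) \<and>
           u' + A_op (- u t) = b t *\<^sub>R (- f t) + \<omega> t *\<^sub>R (- u t)"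
        using d strong_solution_DA[OF assms]
      proof eventually_elim
        case (elim t)
        obtain u' where u': "(u has_vector_derivative u') (at t)" "u' + A_op (u t) = b t *\<^sub>R f t + \<omega> t *\<^sub>R u t"
          using elim(1) by blast
        have "((\<lambda>t. - u t) has_vector_derivative - u') (at t)" by (rule has_vector_derivative_minus[OF u'(1)])
        moreover have "- u' + A_op (- u t) = - (u' + A_op (u t))" using DA_minus[OF elim(2)] by simp
        ultimately show ?case unfolding u'(2) by (intro exI[of _ "- u'"]) simp
      qed
    qed
  qed
qed

text \<open>Let s tend to minus infinity. This is where boundedness of a complete orbit, in the form
  of a constant \<open>M\<close> independent of s, turns decay into a sign.\<close>

lemma exp_decay_imp_nonpos:
  assumes c: "c > 0" and w: "\<And>s. s \<le> t \<Longrightarrow> norm (pos (w t)) \<le> exp (- c * (t - s)) * M"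
  shows "w t \<le> (0::L2)"
proof -
  have "((\<lambda>r. exp (- c * r) * M) \<longlongrightarrow> 0 * M) at_top"
  proof (intro tendsto_intros)
    have "filterlim (\<lambda>r. c * r) at_top at_top"
      using c by (rule filterlim_tendsto_pos_mult_at_top[OF tendsto_const _ filterlim_ident])
    hence "filterlim (\<lambda>r. - (c * r)) at_bot at_top" by (simp add: filterlim_uminus_at_bot)
    hence "((\<lambda>r. exp (- (c * r))) \<longlongrightarrow> 0) at_top" by (rule filterlim_compose[OF exp_at_bot])
    thus "((\<lambda>r. exp (- c * r)) \<longlongrightarrow> 0) at_top" by simp
  qed
  moreover have "\<forall>\<^sub>F r in at_top. norm (pos (w t)) \<le> exp (- c * r) * M"
    using eventually_ge_at_top[of 0] by eventually_elim (use w[of "t - r" for r] in simp)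
  ultimately have "norm (pos (w t)) \<le> 0 * M"
    by (intro tendsto_lowerbound[of _ "0 * M" at_top]) auto
  thus ?thesis by (simp add: pos_eq_0_iff)
qed

lemma inner_pos_nonneg:
  assumes "0 \<le> u"
  shows "0 \<le> inner u (pos v)"
proof -
  have "AE x in I01. 0 \<le> rep_L2 u x"
    using assms rep_L2_zero unfolding less_eq_L2_iff by (rule_tac AE_mp) (auto elim: eventually_mono)
  hence "AE x in I01. rep_L2 0 x * rep_L2 (pos v) x \<le> rep_L2 u x * rep_L2 (pos v) x"
    using rep_L2_zero rep_pos[of v] by eventually_elim simp
  from inner_L2_mono[OF this] show ?thesis by simp
qed

lemma one_nonneg: "0 \<le> one_L2"
  unfolding less_eq_L2_iff using rep_L2_zero rep_one_L2 by eventually_elim simp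

section \<open>The extremal trajectory\<close>

locale forcing =
  fixes b \<omega> :: "real \<Rightarrow> real" and b0 b1 \<omega>1 :: real
  assumes cont_b: "continuous_on UNIV b" and cont_\<omega>: "continuous_on UNIV \<omega>"
    and b0_pos: "0 < b0" and b_ge: "b0 \<le> b t" and b_le: "b t \<le> b1"
    and \<omega>_ge: "0 \<le> \<omega> t" and \<omega>_le: "\<omega> t \<le> \<omega>1" and \<omega>1_less: "\<omega>1 < pi\<^sup>2"
begin

definition rate :: real where "rate = pi\<^sup>2 - \<omega>1"

lemma rate_pos: "0 < rate"
  using \<omega>1_less by (simp add: rate_def)

lemma b1_nonneg: "0 \<le> b1"
  using b_le[of 0] b_ge[of 0] b0_pos by linarith

lemma \<omega>1_nonneg: "0 \<le> \<omega>1"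
  using \<omega>_le[of 0] \<omega>_ge[of 0] by linarith

lemma freq_sq_ge: "pi\<^sup>2 \<le> (freq k)\<^sup>2"
  using freq_ge[of k] by (intro power_mono) auto

text \<open>Variation of constants started at minus infinity. With \<Lambda> an antiderivative of
  the rate and B one of exp(\<Lambda>) b, the solution is exp(-\<Lambda>) (B - L). Both B and
  b1/\<mu> exp(\<Lambda>) - B are nondecreasing; the second fact bounds B from below and yields the
  upper bound b1/\<mu>.\<close>

lemma mode_exists:
  "\<exists>y. \<forall>t. (y has_real_derivative b t - ((freq k)\<^sup>2 - \<omega> t) * y t) (at t) \<and>
     0 \<le> y t \<and> y t \<le> b1 / ((freq k)\<^sup>2 - \<omega>1)"
proof -
  define \<mu> where "\<mu> = (freq k)\<^sup>2 - \<omega>1"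
  have \<mu>: "0 < \<mu>" using freq_sq_ge[of k] \<omega>1_less by (simp add: \<mu>_def)
  obtain \<Lambda> where \<Lambda>: "\<And>t. (\<Lambda> has_real_derivative (freq k)\<^sup>2 - \<omega> t) (at t)"
    using continuous_antiderivative[OF continuous_on_diff[OF continuous_on_const cont_\<omega>]] by blast
  have c\<Lambda>: "continuous_on UNIV \<Lambda>" using DERIV_isCont[OF \<Lambda>] by (intro continuous_at_imp_continuous_on) auto
  obtain B where B: "\<And>t. (B has_real_derivative exp (\<Lambda> t) * b t) (at t)"
    using continuous_antiderivative[OF continuous_on_mult[OF continuous_on_exp[OF c\<Lambda>] cont_b]] by blast
  have eb: "0 \<le> exp (\<Lambda> t) * b t" for t using b_ge[of t] b0_pos by simp
  have mono: "B s \<le> B t" if "s \<le> t" for s t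
    using DERIV_nonneg_imp_nondecreasing[OF that, of B] B eb by blast
  have upper: "b1 / \<mu> * exp (\<Lambda> s) - B s \<le> b1 / \<mu> * exp (\<Lambda> t) - B t" if "s \<le> t" for s t
  proof (rule DERIV_nonneg_imp_nondecreasing[OF that])
    fix x
    have d: "((\<lambda>t. b1 / \<mu> * exp (\<Lambda> t) - B t) has_real_derivative
        b1 / \<mu> * (exp (\<Lambda> x) * ((freq k)\<^sup>2 - \<omega> x)) - exp (\<Lambda> x) * b x) (at x)"
      by (intro DERIV_diff DERIV_cmult DERIV_fun_exp \<Lambda> B)
    have "b1 / \<mu> * \<mu> \<le> b1 / \<mu> * ((freq k)\<^sup>2 - \<omega> x)"
      using \<omega>_le[of x] \<mu> b1_nonneg by (intro mult_left_mono) (auto simp: \<mu>_def)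
    hence "b x \<le> b1 / \<mu> * ((freq k)\<^sup>2 - \<omega> x)" using b_le[of x] \<mu> by simp
    hence "exp (\<Lambda> x) * b x \<le> exp (\<Lambda> x) * (b1 / \<mu> * ((freq k)\<^sup>2 - \<omega> x))" by (intro mult_left_mono) auto
    thus "\<exists>y. ((\<lambda>t. b1 / \<mu> * exp (\<Lambda> t) - B t) has_real_derivative y) (at x) \<and> 0 \<le> y"
      using d by (intro exI conjI) (auto simp: ac_simps)
  qed
  have lower: "B t - b1 / \<mu> * exp (\<Lambda> t) \<le> B s" for s t
  proof (cases "s \<le> t")
    case True
    have "0 \<le> b1 / \<mu> * exp (\<Lambda> s)" using b1_nonneg \<mu> by simp
    thus ?thesis using upper[OF True] by linarith
  next
    case False
    have "0 \<le> b1 / \<mu> * exp (\<Lambda> t)" using b1_nonneg \<mu> by simp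
    thus ?thesis using mono[of t s] False by linarith
  qed
  \<comment> \<open>By monotonicity the infimum of B is its limit at minus infinity, the constant
    that selects the bounded solution.\<close>
  define L where "L = Inf (range B)"
  have bdd: "bdd_below (range B)" by (rule bdd_belowI[of _ "B 0 - b1 / \<mu> * exp (\<Lambda> 0)"]) (use lower in auto)
  have L1: "L \<le> B t" for t unfolding L_def by (intro cInf_lower bdd) auto
  have L2: "B t - b1 / \<mu> * exp (\<Lambda> t) \<le> L" for t unfolding L_def by (intro cInf_greatest) (use lower in auto)
  define y where "y t = exp (- \<Lambda> t) * (B t - L)" for t
  have "(y has_real_derivative b t - ((freq k)\<^sup>2 - \<omega> t) * y t) (at t)" for t
  proof -
    have "(y has_real_derivative exp (- \<Lambda> t) * (exp (\<Lambda> t) * b t) + (exp (- \<Lambda> t) * (- ((freq k)\<^sup>2 - \<omega> t))) * (B t - L)) (at t)"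
      unfolding y_def[abs_def]
      by (intro DERIV_mult' DERIV_fun_exp DERIV_minus \<Lambda>) (auto intro!: derivative_eq_intros B)
    moreover have e: "exp (- \<Lambda> t) * (exp (\<Lambda> t) * b t) = b t"
      by (simp add: mult.assoc[symmetric] mult_exp_exp)
    have "exp (- \<Lambda> t) * (exp (\<Lambda> t) * b t) + (exp (- \<Lambda> t) * (- ((freq k)\<^sup>2 - \<omega> t))) * (B t - L)
        = b t - ((freq k)\<^sup>2 - \<omega> t) * y t"
      unfolding e y_def by (simp add: algebra_simps)
    ultimately show ?thesis by (simp only:)
  qed
  moreover have "0 \<le> y t" for t unfolding y_def using L1[of t] by simp
  moreover have "y t \<le> b1 / \<mu>" for t
  proof -
    have "y t \<le> exp (- \<Lambda> t) * (b1 / \<mu> * exp (\<Lambda> t))"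
      unfolding y_def using L2[of t] by (intro mult_left_mono) auto
    also have "\<dots> = b1 / \<mu> * (exp (- \<Lambda> t) * exp (\<Lambda> t))" by simp
    also have "\<dots> = b1 / \<mu>" by (simp add: mult_exp_exp)
    finally show ?thesis .
  qed
  ultimately show ?thesis unfolding \<mu>_def by (intro exI[of _ y]) blast
qed

definition mode :: "nat \<Rightarrow> real \<Rightarrow> real" where
  "mode k = (SOME y. \<forall>t. (y has_real_derivative b t - ((freq k)\<^sup>2 - \<omega> t) * y t) (at t) \<and>
     0 \<le> y t \<and> y t \<le> b1 / ((freq k)\<^sup>2 - \<omega>1))"

lemma mode: "(mode k has_real_derivative b t - ((freq k)\<^sup>2 - \<omega> t) * mode k t) (at t)"
    "0 \<le> mode k t" "mode k t \<le> b1 / ((freq k)\<^sup>2 - \<omega>1)"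
  using someI_ex[OF mode_exists[of k], folded mode_def] by blast+

text \<open>With s for the squared frequency, s/(s - \<omega>1) does not increase in s, so its value
  at s = pi^2 bounds s times the mode uniformly in the mode.\<close>

definition zbound :: real where "zbound = b1 * pi\<^sup>2 / rate"

lemma zbound_nonneg: "0 \<le> zbound"
  using b1_nonneg rate_pos by (simp add: zbound_def)

lemma freq_mode_le: "(freq k)\<^sup>2 * mode k t \<le> zbound"
proof -
  have r: "0 < (freq k)\<^sup>2 - \<omega>1" using freq_sq_ge[of k] \<omega>1_less by linarith
  have "(freq k)\<^sup>2 * mode k t \<le> (freq k)\<^sup>2 * (b1 / ((freq k)\<^sup>2 - \<omega>1))"
    by (intro mult_left_mono mode) auto
  also have "\<dots> = b1 * ((freq k)\<^sup>2 / ((freq k)\<^sup>2 - \<omega>1))" by simp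
  also have "\<dots> \<le> b1 * (pi\<^sup>2 / rate)"
  proof (intro mult_left_mono b1_nonneg)
    have "pi\<^sup>2 * \<omega>1 \<le> (freq k)\<^sup>2 * \<omega>1" using freq_sq_ge \<omega>1_nonneg by (rule mult_right_mono)
    hence "(freq k)\<^sup>2 * rate \<le> pi\<^sup>2 * ((freq k)\<^sup>2 - \<omega>1)" by (simp add: rate_def algebra_simps)
    thus "(freq k)\<^sup>2 / ((freq k)\<^sup>2 - \<omega>1) \<le> pi\<^sup>2 / rate"
      using r rate_pos by (simp add: divide_le_eq le_divide_eq mult.commute)
  qed
  finally show ?thesis by (simp add: zbound_def)
qed

lemma mode_le: "mode k t \<le> zbound"
proof -
  have "1 \<le> pi\<^sup>2" using pi_gt3 by (intro one_le_power) linarith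
  hence "1 * mode k t \<le> (freq k)\<^sup>2 * mode k t"
    using freq_sq_ge[of k] by (intro mult_right_mono mode) linarith
  thus ?thesis using freq_mode_le[of k t] by linarith
qed

text \<open>Adds bounds for the three terms of the mode equation, so it is uniform in time and in
  the mode and becomes a Lipschitz constant of \<open>upper\<close>.\<close>

definition dbound :: real where "dbound = b1 + zbound + \<omega>1 * zbound"

lemma mode_deriv_le: "\<bar>b t - ((freq k)\<^sup>2 - \<omega> t) * mode k t\<bar> \<le> dbound"
proof -
  have "0 \<le> (freq k)\<^sup>2 * mode k t" "0 \<le> \<omega> t * mode k t" using mode(2) \<omega>_ge by auto
  moreover have "\<omega> t * mode k t \<le> \<omega>1 * zbound"
    using \<omega>_le \<omega>1_nonneg mode_le mode(2) by (intro mult_mono) auto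
  moreover have "b t - ((freq k)\<^sup>2 - \<omega> t) * mode k t = b t - (freq k)\<^sup>2 * mode k t + \<omega> t * mode k t"
    by (simp add: algebra_simps)
  moreover have "0 \<le> \<omega>1 * zbound" using \<omega>1_nonneg zbound_nonneg by simp
  ultimately show ?thesis
    using freq_mode_le[of k t] b_le[of t] b_ge[of t] b0_pos zbound_nonneg
    unfolding dbound_def abs_le_iff by linarith
qed

lemma dbound_nonneg: "0 \<le> dbound"
  using mode_deriv_le[of 0 0] by linarith

section \<open>The series for the extremal trajectory and its equation\<close>

definition upper :: "real \<Rightarrow> L2" where
  "upper t = (\<Sum>k. (c_sine k * mode k t) *\<^sub>R e_sine k)"

lemma upper_sums: "(\<lambda>k. (c_sine k * mode k t) *\<^sub>R e_sine k) sums upper t"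
  unfolding upper_def by (intro summable_sums sine_series_summable[of _ zbound]) (use mode mode_le in simp)

lemma upper_bounded: "norm (upper t) \<le> zbound"
proof -
  have "norm (upper t) \<le> \<bar>zbound\<bar>"
    unfolding upper_def by (rule sine_series_norm) (use mode mode_le in simp)
  thus ?thesis using zbound_nonneg by simp
qed

lemma upper_DA: "upper t \<in> DA"
  and A_upper_sums: "(\<lambda>k. (c_sine k * ((freq k)\<^sup>2 * mode k t)) *\<^sub>R e_sine k) sums A_op (upper t)"
proof -
  have "summable (\<lambda>k. (c_sine k * ((freq k)\<^sup>2 * mode k t)) *\<^sub>R e_sine k)"
    by (intro sine_series_summable[of _ zbound]) (use mode(2) freq_mode_le in \<open>simp add: abs_mult\<close>)
  then obtain h where h: "(\<lambda>k. (c_sine k * ((freq k)\<^sup>2 * mode k t)) *\<^sub>R e_sine k) sums h"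
    by (auto simp: summable_def)
  hence "(\<lambda>k. ((c_sine k * mode k t) * (freq k)\<^sup>2) *\<^sub>R e_sine k) sums h" by (simp add: ac_simps)
  from sine_series_DA[OF upper_sums this] h
  show "upper t \<in> DA" "(\<lambda>k. (c_sine k * ((freq k)\<^sup>2 * mode k t)) *\<^sub>R e_sine k) sums A_op (upper t)" by auto
qed

text \<open>The derivatives of the modes are bounded by \<open>dbound\<close> uniformly in time, so
  their series converges uniformly and may be taken termwise. Splitting it by the mode equation
  gives the three series of 1, \<open>upper\<close> and A applied to \<open>upper\<close>.\<close>

lemma upper_ode: "(upper has_vector_derivative b t *\<^sub>R one_L2 + \<omega> t *\<^sub>R upper t - A_op (upper t)) (at t)"
proof -
  define d where "d t k = b t - ((freq k)\<^sup>2 - \<omega> t) * mode k t" for t k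
  define D where "D t = (\<Sum>k. (c_sine k * d t k) *\<^sub>R e_sine k)" for t
  have db: "\<bar>d t k\<bar> \<le> dbound" for t k unfolding d_def by (rule mode_deriv_le)
  have "\<exists>g. \<forall>x\<in>UNIV. (\<lambda>k. (c_sine k * mode k x) *\<^sub>R e_sine k) sums g x \<and>
      (g has_derivative (\<lambda>h. h *\<^sub>R D x)) (at x within UNIV)"
  proof (rule has_derivative_series)
    show "((\<lambda>x. (c_sine k * mode k x) *\<^sub>R e_sine k) has_derivative (\<lambda>h. h *\<^sub>R ((c_sine k * d x k) *\<^sub>R e_sine k))) (at x within UNIV)" for k x
    proof -
      have "((\<lambda>x. c_sine k * mode k x) has_real_derivative c_sine k * d x k) (at x)"
        unfolding d_def by (intro DERIV_cmult mode)
      hence "((\<lambda>x. (c_sine k * mode k x) *\<^sub>R e_sine k) has_vector_derivative (c_sine k * d x k) *\<^sub>R e_sine k) (at x)"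
        by (rule has_vector_derivative_scaleR[OF _ has_vector_derivative_const, simplified])
      thus ?thesis by (simp add: has_vector_derivative_def)
    qed
    fix e :: real assume "e > 0"
    then obtain N where N: "\<forall>z n. (\<forall>k. \<bar>z k\<bar> \<le> dbound) \<longrightarrow> N \<le> n \<longrightarrow>
      norm ((\<Sum>k<n. (c_sine k * z k) *\<^sub>R e_sine k) - (\<Sum>k. (c_sine k * z k) *\<^sub>R e_sine k)) \<le> e"
      using sine_series_uniform by blast
    show "\<forall>\<^sub>F n in sequentially. \<forall>x\<in>UNIV. \<forall>h.
       norm ((\<Sum>i<n. h *\<^sub>R ((c_sine i * d x i) *\<^sub>R e_sine i)) - h *\<^sub>R D x) \<le> e * norm h"
      using eventually_ge_at_top[of N]
    proof (eventually_elim, intro ballI allI)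
      fix n x and h :: real assume n: "n \<ge> N"
      have "(\<Sum>i<n. h *\<^sub>R ((c_sine i * d x i) *\<^sub>R e_sine i)) - h *\<^sub>R D x
        = h *\<^sub>R ((\<Sum>i<n. (c_sine i * d x i) *\<^sub>R e_sine i) - D x)"
        by (simp only: scaleR_sum_right scaleR_diff_right)
      moreover have "norm ((\<Sum>i<n. (c_sine i * d x i) *\<^sub>R e_sine i) - D x) \<le> e"
        using N[rule_format, of "d x" n] db n unfolding D_def by simp
      ultimately show "norm ((\<Sum>i<n. h *\<^sub>R ((c_sine i * d x i) *\<^sub>R e_sine i)) - h *\<^sub>R D x) \<le> e * norm h"
        using mult_left_mono[of _ e "\<bar>h\<bar>"] by (simp only: norm_scaleR real_norm_def mult.commute[of e] abs_ge_zero)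
    qed
  next
    show "(\<lambda>n. (c_sine n * mode n 0) *\<^sub>R e_sine n) sums upper 0" by (rule upper_sums)
  qed auto
  then obtain g where g: "\<And>x. (\<lambda>k. (c_sine k * mode k x) *\<^sub>R e_sine k) sums g x"
    "\<And>x. (g has_derivative (\<lambda>h. h *\<^sub>R D x)) (at x)" by auto
  have "g = upper" using sums_unique2[OF g(1) upper_sums] by auto
  hence "(upper has_vector_derivative D t) (at t)" using g(2) by (simp add: has_vector_derivative_def)
  moreover have "(\<lambda>k. b t *\<^sub>R (c_sine k *\<^sub>R e_sine k) + \<omega> t *\<^sub>R ((c_sine k * mode k t) *\<^sub>R e_sine k)
      - (c_sine k * ((freq k)\<^sup>2 * mode k t)) *\<^sub>R e_sine k) sums (b t *\<^sub>R one_L2 + \<omega> t *\<^sub>R upper t - A_op (upper t))"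
    by (intro sums_diff sums_add sums_scaleR_right one_L2_sums upper_sums A_upper_sums)
  moreover have "b t *\<^sub>R (c_sine k *\<^sub>R e_sine k) + \<omega> t *\<^sub>R ((c_sine k * mode k t) *\<^sub>R e_sine k)
      - (c_sine k * ((freq k)\<^sup>2 * mode k t)) *\<^sub>R e_sine k = (c_sine k * d t k) *\<^sub>R e_sine k" for k
    by (simp add: d_def algebra_simps flip: scaleR_add_left scaleR_diff_left)
  ultimately show ?thesis using sums_unique unfolding D_def by fastforce
qed

text \<open>The difference is a sine series whose multipliers are the increments of the modes,
  bounded by the mean value inequality.\<close>

lemma upper_lipschitz: "norm (upper t - upper s) \<le> dbound * \<bar>t - s\<bar>"
proof -
  have m: "\<bar>mode k t - mode k s\<bar> \<le> dbound * \<bar>t - s\<bar>" for k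
  proof -
    have "norm (mode k t - mode k s) \<le> dbound * norm (t - s)"
      by (rule field_differentiable_bound[of UNIV "mode k" "\<lambda>t. b t - ((freq k)\<^sup>2 - \<omega> t) * mode k t"])
         (use mode(1) mode_deriv_le in auto)
    thus ?thesis by simp
  qed
  have "upper t - upper s = (\<Sum>k. (c_sine k * (mode k t - mode k s)) *\<^sub>R e_sine k)"
    using sums_unique[OF sums_diff[OF upper_sums[of t] upper_sums[of s]]]
    by (simp add: algebra_simps)
  also have "norm \<dots> \<le> \<bar>dbound * \<bar>t - s\<bar>\<bar>" by (rule sine_series_norm[OF m])
  finally show ?thesis using dbound_nonneg by (simp add: abs_mult)
qed

lemma upper_continuous: "continuous_on S upper"
  using upper_ode has_vector_derivative_continuous continuous_at_imp_continuous_on by blast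

end

section \<open>Limits at minus infinity and order calculus\<close>

lemma exp_decay_tendsto:
  fixes c :: real
  assumes "c > 0"
  shows "((\<lambda>s. exp (- c * (t - s)) * M) \<longlongrightarrow> 0) at_bot"
proof -
  have "filterlim (\<lambda>s. c * s) at_bot at_bot"
    using assms by (rule filterlim_tendsto_pos_mult_at_bot[OF tendsto_const _ filterlim_ident])
  hence "((\<lambda>s. exp (c * s)) \<longlongrightarrow> 0) at_bot" by (rule filterlim_compose[OF exp_at_bot])
  hence "((\<lambda>s. exp (- c * t) * exp (c * s) * M) \<longlongrightarrow> exp (- c * t) * 0 * M) at_bot"
    by (intro tendsto_intros)
  moreover have e: "exp (- c * t) * exp (c * s) * M = exp (- c * (t - s)) * M" for s
    unfolding mult_exp_exp by (simp add: algebra_simps)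
  ultimately show ?thesis by (simp only: e mult_zero_left mult_zero_right)
qed

lemma ennreal_squeeze:
  fixes D :: "real \<Rightarrow> ennreal"
  assumes "\<forall>\<^sub>F s in at_bot. D s \<le> ennreal (e s)" "(e \<longlongrightarrow> 0) at_bot"
  shows "(D \<longlongrightarrow> 0) at_bot"
proof (rule tendsto_sandwich[OF _ assms(1) tendsto_const])
  show "\<forall>\<^sub>F s in at_bot. 0 \<le> D s" by simp
  show "((\<lambda>s. ennreal (e s)) \<longlongrightarrow> 0) at_bot" using tendsto_ennrealI[OF assms(2)] by simp
qed

lemma inner_pos_nonpos: "u \<le> 0 \<Longrightarrow> inner u (pos v) \<le> 0"
  using inner_pos_nonneg[of "- u" v] L2_neg_le[of 0 u] by simp

lemma norm_L2_mono: "0 \<le> u \<Longrightarrow> u \<le> v \<Longrightarrow> norm u \<le> norm (v :: L2)"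
proof (rule norm_L2_le_AE)
  assume "0 \<le> u" "u \<le> v"
  hence "AE x in I01. rep_L2 0 x \<le> rep_L2 u x" "AE x in I01. rep_L2 u x \<le> rep_L2 v x"
    by (simp_all add: less_eq_L2_iff)
  thus "AE x in I01. \<bar>rep_L2 u x\<bar> \<le> \<bar>rep_L2 v x\<bar>" using rep_L2_zero by eventually_elim simp
qed

lemma pos_diff_pos: "pos w - pos (- w) = w"
proof (rule L2_eqI_AE)
  show "AE x in I01. rep_L2 (pos w - pos (- w)) x = rep_L2 w x"
    using rep_L2_diff[of "pos w" "pos (- w)"] rep_pos[of w] rep_pos[of "- w"] rep_L2_minus[of w]
    by eventually_elim (simp add: max_def)
qed

lemma norm_le_pos: "norm w \<le> norm (pos w) + norm (pos (- w))"
  using norm_triangle_ineq4[of "pos w" "pos (- w)"] by (simp add: pos_diff_pos)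

lemma L2_diff_mono:
  fixes u v w z :: L2
  assumes "u \<le> v" "z \<le> w"
  shows "u - w \<le> v - z"
proof -
  have "AE x in I01. rep_L2 u x \<le> rep_L2 v x" "AE x in I01. rep_L2 z x \<le> rep_L2 w x"
    using assms by (simp_all add: less_eq_L2_iff)
  thus ?thesis unfolding less_eq_L2_iff
    using rep_L2_diff[of u w] rep_L2_diff[of v z] by eventually_elim simp
qed

lemma L2_le_minus_iff: "u \<le> - v \<longleftrightarrow> v \<le> - (u :: L2)"
  using L2_neg_le[of "- u" v] by (simp only: minus_minus)

lemma L2_minus_le_iff: "- u \<le> v \<longleftrightarrow> - v \<le> (u :: L2)"
  using L2_neg_le[of u "- v"] by (simp only: minus_minus)

lemma positive_L2_AE: "positive_L2 v \<Longrightarrow> AE x in I01. 0 < rep_L2 v x"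
proof -
  assume "positive_L2 v"
  then obtain g where g: "AE x in I01. rep_L2 v x = g x" "\<forall>x\<in>{0<..<1}. g x > 0"
    unfolding positive_L2_def by blast
  have "AE x in I01. g x > 0" by (rule AE_I01_I) (use g(2) in simp)
  thus ?thesis using g(1) by eventually_elim simp
qed

section \<open>Comparison on the whole line and the strong solution property of
  \<open>upper\<close>\<close>

context forcing
begin

text \<open>The energy estimate shared by most comparisons: the reaction contributes at most
  \<omega>1, Poincare takes away pi^2, and \<open>g\<close> collects whatever source terms have a
  favourable sign.\<close>

lemma deriv_decay:
  assumes "w \<in> DA" "c \<le> \<omega>1" "inner g (pos w) \<le> 0"
  shows "inner (g + c *\<^sub>R w - A_op w) (pos w) \<le> - rate * (norm (pos w))\<^sup>2"
proof -
  have "inner (g + c *\<^sub>R w - A_op w) (pos w) = inner g (pos w) + c * (norm (pos w))\<^sup>2 - inner (A_op w) (pos w)"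
    by (simp add: inner_diff_left inner_add_left inner_pos_self)
  also have "\<dots> \<le> 0 + \<omega>1 * (norm (pos w))\<^sup>2 - pi\<^sup>2 * (norm (pos w))\<^sup>2"
    using assms DA_poincare_pos[OF assms(1)] by (intro diff_mono add_mono mult_right_mono) auto
  finally show ?thesis by (simp add: rate_def algebra_simps)
qed

text \<open>Maximum principle for bounded functions on the whole time line. It is used to place
  \<open>upper\<close> above 0 and the barrier, and below the positive stationary point.\<close>

lemma complete_nonpos:
  assumes lip: "\<And>x y. norm (w y - w x) \<le> C * \<bar>y - x\<bar>"
    and der: "\<And>r. (w has_vector_derivative w' r) (at r) \<and> inner (w' r) (pos (w r)) \<le> - rate * (norm (pos (w r)))\<^sup>2"
    and bd: "\<And>r. norm (w r) \<le> M"
  shows "w t \<le> 0"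
proof (rule exp_decay_imp_nonpos[OF rate_pos])
  fix s assume st: "s \<le> t"
  have "norm (pos (w t)) \<le> exp (- rate * (t - s)) * norm (pos (w s))"
  proof (rule pos_decay[OF _ _ _ st])
    show "continuous_on {s..t} w"
      by (intro continuous_at_imp_continuous_on ballI has_vector_derivative_continuous[OF conjunct1[OF der]])
    show "abs_continuous_on T t w" for T
    proof (rule abs_continuous_on_lipschitz[of T t w C])
      show "norm (w y - w x) \<le> C * (y - x)" if "x \<le> y" for x y using lip[of y x] that by simp
    qed
    show "AE r in lebesgue_on {s<..}. \<exists>w'. (w has_vector_derivative w') (at r) \<and>
      inner w' (pos (w r)) \<le> - rate * (norm (pos (w r)))\<^sup>2"
      by (rule AE_I2, rule exI, rule der)
  qed
  also have "\<dots> \<le> exp (- rate * (t - s)) * M"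
    using norm_pos_le[of "w s"] bd[of s] by (intro mult_left_mono) auto
  finally show "norm (pos (w t)) \<le> exp (- rate * (t - s)) * M" .
qed

lemma upper_nonneg: "0 \<le> upper t"
proof -
  have "- upper t \<le> 0"
  proof (rule complete_nonpos[where w = "\<lambda>t. - upper t" and C = dbound and M = zbound
        and w' = "\<lambda>t. - (b t *\<^sub>R one_L2 + \<omega> t *\<^sub>R upper t - A_op (upper t))"])
    show "norm (- upper y - - upper x) \<le> dbound * \<bar>y - x\<bar>" for x y
      using upper_lipschitz[of y x] by (simp add: norm_minus_commute)
    show "norm (- upper r) \<le> zbound" for r using upper_bounded by simp
    fix r
    let ?w = "- upper r"
    have "inner ((- b r) *\<^sub>R one_L2) (pos ?w) \<le> 0"
      using inner_pos_nonneg[OF one_nonneg, of ?w] b_ge[of r] b0_pos by simp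
    from deriv_decay[OF DA_minus(1)[OF upper_DA] \<omega>_le this]
    have "inner (- (b r *\<^sub>R one_L2 + \<omega> r *\<^sub>R upper r - A_op (upper r))) (pos ?w) \<le> - rate * (norm (pos ?w))\<^sup>2"
      by (simp add: DA_minus(2)[OF upper_DA] algebra_simps)
    thus "((\<lambda>t. - upper t) has_vector_derivative - (b r *\<^sub>R one_L2 + \<omega> r *\<^sub>R upper r - A_op (upper r))) (at r) \<and>
      inner (- (b r *\<^sub>R one_L2 + \<omega> r *\<^sub>R upper r - A_op (upper r))) (pos ?w) \<le> - rate * (norm (pos ?w))\<^sup>2"
      using has_vector_derivative_minus[OF upper_ode] by blast
  qed
  thus ?thesis using L2_neg_le[of "upper t" 0] by simp
qed

text \<open>A jointly continuous version of \<open>upper\<close>: a strong solution needs a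
  measurable representative on the product of time and space, which the L^2-valued series does not
  provide by itself.\<close>

definition upper_fun :: "real \<times> real \<Rightarrow> real" where
  "upper_fun z = (\<Sum>k. c_sine k * mode k (fst z) * sine k (snd z))"

text \<open>A mode is at most \<open>zbound\<close> over the squared frequency, which is zbound
  c^2/8 with c the sine coefficient. The crude bounds c \<le> 1 and |sine| \<le> 8 then leave a
  summable majorant independent of t and x.\<close>

lemma upper_fun_term_le: "\<bar>c_sine k * mode k t * sine k x\<bar> \<le> zbound * (c_sine k)\<^sup>2"
proof -
  have f: "0 < freq k" by (rule freq_pos)
  have "(sqrt 2)\<^sup>2 \<le> (3 / 2)\<^sup>2" by (simp add: power2_eq_square)
  hence s2: "sqrt 2 \<le> 3 / 2" by (rule power2_le_imp_le) simp
  have c: "0 \<le> c_sine k" "c_sine k \<le> 1"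
    using f freq_ge[of k] pi_gt3 s2 by (auto simp: c_sine_def)
  have "mode k t \<le> zbound / (freq k)\<^sup>2"
    using freq_mode_le[of k t] f by (simp add: le_divide_eq mult.commute)
  also have "\<dots> = zbound * ((c_sine k)\<^sup>2 / 8)"
    by (simp add: c_sine_def power_divide power_mult_distrib)
  finally have m: "mode k t \<le> zbound * ((c_sine k)\<^sup>2 / 8)" .
  have "\<bar>sine k x\<bar> \<le> (3 / 2) * 1"
    unfolding sine_def abs_mult using s2 by (intro mult_mono) auto
  hence s: "\<bar>sine k x\<bar> \<le> 8" by simp
  have "\<bar>c_sine k * mode k t * sine k x\<bar> = c_sine k * mode k t * \<bar>sine k x\<bar>"
    using c mode(2) by (simp add: abs_mult)
  also have "\<dots> \<le> 1 * (zbound * ((c_sine k)\<^sup>2 / 8)) * 8"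
    using c m s mode(2)[of k t] zbound_nonneg by (intro mult_mono) auto
  finally show ?thesis by simp
qed

lemma upper_fun_summable: "summable (\<lambda>k. zbound * (c_sine k)\<^sup>2)"
  by (intro summable_mult sums_summable[OF c_sine_sq_sums])

lemma upper_fun_continuous: "continuous_on S upper_fun"
proof (rule continuous_on_subset[OF _ subset_UNIV])
  have u: "uniform_limit UNIV (\<lambda>n z. \<Sum>k<n. c_sine k * mode k (fst z) * sine k (snd z))
      (\<lambda>z. \<Sum>k. c_sine k * mode k (fst z) * sine k (snd z)) sequentially"
    by (rule Weierstrass_m_test[OF _ upper_fun_summable]) (use upper_fun_term_le in simp)
  have cm: "continuous_on UNIV (mode k)" for k
    using DERIV_isCont[OF mode(1)] by (intro continuous_at_imp_continuous_on) auto
  have "continuous_on UNIV (\<lambda>z. \<Sum>k<n. c_sine k * mode k (fst z) * sine k (snd z))" for n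
    by (intro continuous_intros continuous_on_compose2[OF cm] continuous_on_compose2[OF smooth_continuous_on[OF smooth_sine]])
       auto
  hence "continuous_on UNIV (\<lambda>z. \<Sum>k. c_sine k * mode k (fst z) * sine k (snd z))"
    by (intro uniform_limit_theorem[OF _ u]) auto
  thus "continuous_on UNIV upper_fun" by (simp add: upper_fun_def[abs_def])
qed

lemma upper_fun_rep: "AE x in I01. rep_L2 (upper t) x = upper_fun (t, x)"
proof -
  let ?P = "\<lambda>n x. \<Sum>k<n. c_sine k * mode k t * sine k x"
  have sqk: "sq_int I01 (\<lambda>x. a * sine k x)" for a k by (intro sq_int_scale sq_int_smooth smooth_sine)
  have P: "sq_int I01 (?P n) \<and> abs_L2 (?P n) = (\<Sum>k<n. (c_sine k * mode k t) *\<^sub>R e_sine k)" for n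
  proof (induction n)
    case 0
    show ?case by (simp add: sq_int_zero zero_L2_def)
  next
    case (Suc n)
    thus ?case
      by (simp add: sq_int_add sqk abs_L2_scale[OF sq_int_smooth[OF smooth_sine]] e_sine_def
          flip: abs_L2_add)
  qed
  have sq: "sq_int I01 (\<lambda>x. upper_fun (t, x))"
    by (intro sq_int_continuous continuous_on_compose2[OF upper_fun_continuous[of UNIV]] continuous_intros) auto
  have tm: "\<bar>c_sine k * mode k t * sine k x\<bar> \<le> zbound * (c_sine k)\<^sup>2" for k x by (rule upper_fun_term_le)
  have "(\<lambda>n. abs_L2 (?P n)) \<longlonglongrightarrow> abs_L2 (\<lambda>x. upper_fun (t, x))"
  proof (rule tendsto_abs_L2_dominated[OF _ sq])
    show "sq_int I01 (?P n)" for n using P by blast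
    have "(\<lambda>n. ?P n x) \<longlonglongrightarrow> upper_fun (t, x)" for x
      unfolding upper_fun_def fst_conv snd_conv
      by (intro summable_LIMSEQ summable_comparison_test'[OF upper_fun_summable]) (use tm in simp)
    thus "AE x in I01. (\<lambda>n. ?P n x) \<longlonglongrightarrow> upper_fun (t, x)" by simp
    show "AE x in I01. \<bar>?P n x\<bar> \<le> (\<Sum>k. zbound * (c_sine k)\<^sup>2)" for n
    proof (rule AE_I2)
      fix x
      have "\<bar>?P n x\<bar> \<le> (\<Sum>k<n. \<bar>c_sine k * mode k t * sine k x\<bar>)" by (rule sum_abs)
      also have "\<dots> \<le> (\<Sum>k<n. zbound * (c_sine k)\<^sup>2)" by (intro sum_mono tm)
      also have "\<dots> \<le> (\<Sum>k. zbound * (c_sine k)\<^sup>2)"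
        using zbound_nonneg by (intro sum_le_suminf upper_fun_summable) auto
      finally show "\<bar>?P n x\<bar> \<le> (\<Sum>k. zbound * (c_sine k)\<^sup>2)" .
    qed
  qed
  moreover have "(\<lambda>n. abs_L2 (?P n)) \<longlonglongrightarrow> upper t" using upper_sums P by (simp add: sums_def)
  ultimately have "upper t = abs_L2 (\<lambda>x. upper_fun (t, x))" using LIMSEQ_unique by blast
  thus ?thesis using rep_abs_L2[OF sq] by simp
qed

lemma upper_strong_solution: "strong_solution b \<omega> \<tau> (upper \<tau>) upper"
  unfolding strong_solution_def
proof (intro conjI allI impI; (elim conjE)?)
  show "continuous_on {\<tau>..} upper" by (rule upper_continuous)
  show "abs_continuous_on T1 T2 upper" for T1 T2
  proof (rule abs_continuous_on_lipschitz[of T1 T2 upper dbound])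
    show "norm (upper y - upper x) \<le> dbound * (y - x)" if "x \<le> y" for x y
      using upper_lipschitz[of y x] that by simp
  qed
  show "AE t in lebesgue_on {T1<..<T2}. upper t \<in> DA" for T1 T2 using upper_DA by simp
  show "\<exists>f. L2loc \<tau> f \<and>
        (\<exists>F W. joint_rep \<tau> f F \<and> joint_rep \<tau> upper W \<and>
           (AE z in lebesgue_on ({\<tau><..} \<times> {0<..<1}). F z \<in> H0 (W z))) \<and>
        (AE t in lebesgue_on {\<tau><..}. \<exists>u'. (upper has_vector_derivative u') (at t) \<and>
           u' + A_op (upper t) = b t *\<^sub>R f t + \<omega> t *\<^sub>R upper t)"
  proof (rule exI[of _ "\<lambda>_. one_L2"], intro conjI)
    show "L2loc \<tau> (\<lambda>_. one_L2)" by (simp add: L2loc_def)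
    show "AE t in lebesgue_on {\<tau><..}. \<exists>u'. (upper has_vector_derivative u') (at t) \<and>
           u' + A_op (upper t) = b t *\<^sub>R one_L2 + \<omega> t *\<^sub>R upper t"
      by (rule AE_I2, rule exI, rule conjI, rule upper_ode) simp
    have AB: "{\<tau><..} \<times> {0<..<1::real} \<in> sets (borel :: (real \<times> real) measure)"
      by (simp add: borel_prod[symmetric])
    \<comment> \<open>Since \<open>upper\<close> is nonnegative, the truncation changes nothing
      almost everywhere. It makes the inclusion of 1 in \<open>H0\<close> hold at every point,
      including zeros, as \<open>H0 0\<close> contains 1.\<close>
    have "continuous_on UNIV (\<lambda>z. max 0 (upper_fun z))"
      by (intro continuous_intros upper_fun_continuous)
    hence "(\<lambda>z. max 0 (upper_fun z)) \<in> borel_measurable (lebesgue_on ({\<tau><..} \<times> {0<..<1}))"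
      using AB by (intro continuous_imp_measurable_on_sets_lebesgue) (auto intro: continuous_on_subset)
    moreover have "AE x in I01. max 0 (upper_fun (t, x)) = rep_L2 (upper t) x" for t
    proof -
      have "AE x in I01. rep_L2 0 x \<le> rep_L2 (upper t) x"
        using upper_nonneg[of t] by (simp add: less_eq_L2_iff)
      thus ?thesis using upper_fun_rep[of t] rep_L2_zero by eventually_elim simp
    qed
    ultimately have "joint_rep \<tau> upper (\<lambda>z. max 0 (upper_fun z))"
      by (simp add: joint_rep_def)
    moreover have "joint_rep \<tau> (\<lambda>_. one_L2) (\<lambda>_. 1)"
      unfolding joint_rep_def using rep_one_L2 by (auto elim: eventually_mono)
    ultimately show "\<exists>F W. joint_rep \<tau> (\<lambda>_. one_L2) F \<and> joint_rep \<tau> upper W \<and>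
           (AE z in lebesgue_on ({\<tau><..} \<times> {0<..<1}). F z \<in> H0 (W z))"
      by (intro exI conjI) (auto simp: H0_def)
  qed
qed simp

section \<open>Comparison of arbitrary solutions and of stationary points with
  \<open>upper\<close>\<close>

lemma solution_abs_continuous:
  assumes "strong_solution b \<omega> \<tau> v u" "\<tau> < T" "T < t"
  shows "abs_continuous_on T t u"
  using assms unfolding strong_solution_def by blast

lemma solution_upper_ac:
  assumes "strong_solution b \<omega> \<tau> v u" "\<tau> < T" "T < t"
  shows "abs_continuous_on T t (\<lambda>t. u t - upper t)"
proof (rule abs_continuous_on_dominated[OF solution_abs_continuous[OF assms], of _ "1 + dbound"])
  fix x y :: real assume xy: "x \<le> y"
  have "norm ((u y - upper y) - (u x - upper x)) \<le> norm (u y - u x) + norm (upper y - upper x)"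
    using norm_triangle_ineq4[of "u y - u x" "upper y - upper x"] by (simp add: algebra_simps)
  also have "\<dots> \<le> norm (u y - u x) + dbound * (y - x)" using upper_lipschitz[of y x] xy by simp
  also have "\<dots> \<le> (1 + dbound) * (norm (u y - u x) + (y - x))"
  proof -
    have "0 \<le> dbound * norm (u y - u x)" using dbound_nonneg by simp
    thus ?thesis using xy by (simp add: algebra_simps)
  qed
  finally show "norm ((u y - upper y) - (u x - upper x)) \<le> (1 + dbound) * (norm (u y - u x) + (y - x))" .
qed

lemma solution_continuous: "strong_solution b \<omega> \<tau> v u \<Longrightarrow> continuous_on {\<tau>..t} u"
  unfolding strong_solution_def using continuous_on_subset[of "{\<tau>..}" u "{\<tau>..t}"] by auto

lemma solution_initial: "strong_solution b \<omega> \<tau> v u \<Longrightarrow> u \<tau> = v"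
  by (simp add: strong_solution_def)

lemma below_upper:
  assumes u: "strong_solution b \<omega> \<tau> v u" and "\<tau> \<le> t"
  shows "norm (pos (u t - upper t)) \<le> exp (- rate * (t - \<tau>)) * norm (pos (v - upper \<tau>))"
proof -
  obtain f where f: "AE t in lebesgue_on {\<tau><..}. u t \<in> DA \<and>
     (u has_vector_derivative b t *\<^sub>R f t + \<omega> t *\<^sub>R u t - A_op (u t)) (at t) \<and>
     (AE x in I01. rep_L2 (f t) x \<in> H0 (rep_L2 (u t) x))"
    using strong_solution_AE[OF u] by blast
  have "norm (pos (u t - upper t)) \<le> exp (- rate * (t - \<tau>)) * norm (pos (u \<tau> - upper \<tau>))"
  proof (rule pos_decay[where w = "\<lambda>t. u t - upper t", OF _ solution_upper_ac[OF u] _ assms(2)])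
    show "continuous_on {\<tau>..t} (\<lambda>t. u t - upper t)"
      by (intro continuous_intros upper_continuous solution_continuous[OF u])
    show "AE r in lebesgue_on {\<tau><..}. \<exists>w'. ((\<lambda>t. u t - upper t) has_vector_derivative w') (at r) \<and>
      inner w' (pos (u r - upper r)) \<le> - rate * (norm (pos (u r - upper r)))\<^sup>2"
      using f
    proof eventually_elim
      case (elim r)
      let ?w = "u r - upper r"
      \<comment> \<open>All values of \<open>H0\<close> are at most 1 whatever the sign of the
        solution, so the difference of the sources has a sign although nothing is known about
        u.\<close>
      have "f r \<le> one_L2"
      proof -
        have "AE x in I01. rep_L2 (f r) x \<in> H0 (rep_L2 (u r) x)" using elim by blast
        thus ?thesis unfolding less_eq_L2_iff using rep_one_L2
          by eventually_elim (auto simp: H0_def split: if_splits)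
      qed
      hence "inner (f r - one_L2) (pos ?w) \<le> 0" by (intro inner_pos_nonpos) (simp add: L2_le_iff_diff[symmetric])
      hence g: "inner (b r *\<^sub>R (f r - one_L2)) (pos ?w) \<le> 0"
        using b_ge[of r] b0_pos by (simp add: mult_nonneg_nonpos)
      have wDA: "?w \<in> DA" "A_op ?w = A_op (u r) - A_op (upper r)" using DA_diff[OF _ upper_DA] elim by auto
      have "((\<lambda>t. u t - upper t) has_vector_derivative (b r *\<^sub>R f r + \<omega> r *\<^sub>R u r - A_op (u r))
          - (b r *\<^sub>R one_L2 + \<omega> r *\<^sub>R upper r - A_op (upper r))) (at r)"
        using elim upper_ode by (intro has_vector_derivative_diff) auto
      also have "(b r *\<^sub>R f r + \<omega> r *\<^sub>R u r - A_op (u r)) - (b r *\<^sub>R one_L2 + \<omega> r *\<^sub>R upper r - A_op (upper r))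
          = b r *\<^sub>R (f r - one_L2) + \<omega> r *\<^sub>R ?w - A_op ?w"
        unfolding wDA(2) by (simp add: algebra_simps)
      finally show ?case using deriv_decay[OF wDA(1) \<omega>_le g] by blast
    qed
  qed
  thus ?thesis by (simp add: solution_initial[OF u])
qed

lemma above_lower:
  assumes "strong_solution b \<omega> \<tau> v u" "\<tau> \<le> t"
  shows "norm (pos (- upper t - u t)) \<le> exp (- rate * (t - \<tau>)) * norm (pos (- upper \<tau> - v))"
proof -
  have e: "- x - y = - y - x" for x y :: L2 by (simp add: algebra_simps)
  show ?thesis
    using below_upper[OF strong_solution_uminus[OF assms(1)] assms(2)]
    by (simp only: e[of "u t" "upper t"] e[of v "upper \<tau>"])
qed

text \<open>Positivity forces the source of v to be b1, and then v is a supersolution for the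
  smaller coefficients b and \<omega>.\<close>

lemma upper_le_stationary:
  assumes v: "stationary_point b1 \<omega>1 v" and pv: "positive_L2 v"
  shows "upper t \<le> v"
proof -
  have "strong_solution (\<lambda>_. b1) (\<lambda>_. \<omega>1) 0 v (\<lambda>_. v)" using v by (simp add: stationary_point_def)
  from strong_solution_AE[OF this] obtain f where
    f: "AE t in lebesgue_on {0<..}. v \<in> DA \<and>
     ((\<lambda>_. v) has_vector_derivative b1 *\<^sub>R f t + \<omega>1 *\<^sub>R v - A_op v) (at t) \<and>
     (AE x in I01. rep_L2 (f t) x \<in> H0 (rep_L2 v x))" by blast
  have "AE t in lebesgue_on {0::real<..}. v \<in> DA \<and> A_op v = b1 *\<^sub>R one_L2 + \<omega>1 *\<^sub>R v"
    using f
  proof eventually_elim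
    case (elim t)
    have "f t = one_L2"
    proof (rule L2_eqI_AE)
      have "AE x in I01. rep_L2 (f t) x \<in> H0 (rep_L2 v x)" using elim by blast
      thus "AE x in I01. rep_L2 (f t) x = rep_L2 one_L2 x"
        using positive_L2_AE[OF pv] rep_one_L2 by eventually_elim (simp add: H0_def)
    qed
    moreover have "b1 *\<^sub>R f t + \<omega>1 *\<^sub>R v - A_op v = 0"
      using elim vector_derivative_unique_at[OF _ has_vector_derivative_const] by blast
    ultimately show ?case using elim by simp
  qed
  hence vA: "v \<in> DA \<and> A_op v = b1 *\<^sub>R one_L2 + \<omega>1 *\<^sub>R v" by (rule AE_lebesgue_on_const)
  have "upper t - v \<le> 0"
  proof (rule complete_nonpos[where w = "\<lambda>t. upper t - v" and C = dbound and M = "zbound + norm v"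
        and w' = "\<lambda>t. b t *\<^sub>R one_L2 + \<omega> t *\<^sub>R upper t - A_op (upper t)"])
    show "norm (upper y - v - (upper x - v)) \<le> dbound * \<bar>y - x\<bar>" for x y
      using upper_lipschitz[of y x] by simp
    show "norm (upper r - v) \<le> zbound + norm v" for r
      using norm_triangle_ineq4[of "upper r" v] upper_bounded[of r] by linarith
    fix r
    \<comment> \<open>The reaction on w is taken with \<omega>1; the remainder (\<omega> -
      \<omega>1) \<open>upper\<close> then has a sign because \<open>upper\<close> is
      nonnegative.\<close>
    let ?w = "upper r - v" and ?g = "(b r - b1) *\<^sub>R one_L2 + (\<omega> r - \<omega>1) *\<^sub>R upper r"
    have "inner ?g (pos ?w) \<le> 0"
      using inner_pos_nonneg[OF one_nonneg, of ?w] inner_pos_nonneg[OF upper_nonneg, of r ?w] b_le[of r] \<omega>_le[of r]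
      by (simp add: inner_add_left add_nonpos_nonpos mult_nonpos_nonneg)
    from deriv_decay[OF DA_diff(1)[OF upper_DA] order_refl this] vA
    have "inner (?g + \<omega>1 *\<^sub>R ?w - A_op ?w) (pos ?w) \<le> - rate * (norm (pos ?w))\<^sup>2" by blast
    moreover have "?g + \<omega>1 *\<^sub>R ?w - A_op ?w = b r *\<^sub>R one_L2 + \<omega> r *\<^sub>R upper r - A_op (upper r)"
      using DA_diff(2)[OF upper_DA, of v r] vA by (simp add: algebra_simps)
    moreover have "((\<lambda>t. upper t - v) has_vector_derivative (b r *\<^sub>R one_L2 + \<omega> r *\<^sub>R upper r - A_op (upper r)) - 0) (at r)"
      by (intro has_vector_derivative_diff upper_ode has_vector_derivative_const)
    ultimately show "((\<lambda>t. upper t - v) has_vector_derivative b r *\<^sub>R one_L2 + \<omega> r *\<^sub>R upper r - A_op (upper r)) (at r) \<and>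
      inner (b r *\<^sub>R one_L2 + \<omega> r *\<^sub>R upper r - A_op (upper r)) (pos ?w) \<le> - rate * (norm (pos ?w))\<^sup>2"
      by simp
  qed
  thus ?thesis by (simp add: L2_le_iff_diff[symmetric])
qed

section \<open>The barrier, positivity of solutions above it, and decay\<close>

definition barrier_fun :: "real \<Rightarrow> real" where
  "barrier_fun x = (b0 / 2) * (x * (1 - x))"

definition barrier :: L2 where "barrier = abs_L2 barrier_fun"

lemma smooth_barrier_fun: "smooth barrier_fun"
  unfolding barrier_fun_def[abs_def]
  by (intro smooth_cmult smooth_mult smooth_diff smooth_const smooth_ident)

lemma rep_barrier: "AE x in I01. rep_L2 barrier x = barrier_fun x"
  unfolding barrier_def by (rule rep_abs_L2[OF sq_int_smooth[OF smooth_barrier_fun]])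

lemma barrier_DA: "barrier \<in> DA" "A_op barrier = b0 *\<^sub>R one_L2"
proof -
  have "(barrier_fun has_real_derivative b0 / 2 * (1 - 2 * x)) (at x)" for x
    unfolding barrier_fun_def[abs_def] by (auto intro!: derivative_eq_intros simp: field_simps)
  hence d1: "deriv barrier_fun = (\<lambda>x. b0 / 2 * (1 - 2 * x))" by (intro ext DERIV_imp_deriv)
  have "((\<lambda>x. b0 / 2 * (1 - 2 * x)) has_real_derivative - b0) (at x)" for x
    by (auto intro!: derivative_eq_intros)
  hence d2: "deriv (deriv barrier_fun) = (\<lambda>x. (- b0) * 1)"
    unfolding d1 by (simp add: DERIV_imp_deriv fun_eq_iff)
  have z: "barrier_fun 0 = 0" "barrier_fun 1 = 0" by (simp_all add: barrier_fun_def)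
  show "barrier \<in> DA" unfolding barrier_def by (rule DA_smooth(1)[OF smooth_barrier_fun z])
  have "A_op barrier = - ((- b0) *\<^sub>R one_L2)"
    unfolding barrier_def DA_smooth(2)[OF smooth_barrier_fun z] d2 one_L2_def abs_L2_scale[OF sq_int_one] ..
  thus "A_op barrier = b0 *\<^sub>R one_L2" by simp
qed

lemma barrier_fun_pos: "0 < x \<Longrightarrow> x < 1 \<Longrightarrow> 0 < barrier_fun x"
  using b0_pos by (simp add: barrier_fun_def)

lemma barrier_nonneg: "0 \<le> barrier"
proof -
  have "AE x in I01. 0 < barrier_fun x" by (rule AE_I01_I) (rule barrier_fun_pos)
  thus ?thesis unfolding less_eq_L2_iff using rep_barrier rep_L2_zero by eventually_elim simp
qed

text \<open>The parabola satisfies A barrier = b0 \<le> b + \<omega> barrier at all times, so it is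
  a stationary subsolution of the linear equation.\<close>

lemma barrier_le_upper: "barrier \<le> upper t"
proof -
  have "barrier - upper t \<le> 0"
  proof (rule complete_nonpos[where w = "\<lambda>t. barrier - upper t" and C = dbound and M = "norm barrier + zbound"
        and w' = "\<lambda>t. - (b t *\<^sub>R one_L2 + \<omega> t *\<^sub>R upper t - A_op (upper t))"])
    show "norm (barrier - upper y - (barrier - upper x)) \<le> dbound * \<bar>y - x\<bar>" for x y
      using upper_lipschitz[of y x] by (simp add: norm_minus_commute)
    show "norm (barrier - upper r) \<le> norm barrier + zbound" for r
      using norm_triangle_ineq4[of barrier "upper r"] upper_bounded[of r] by linarith
    fix r
    let ?w = "barrier - upper r" and ?g = "(b0 - b r) *\<^sub>R one_L2 + (- \<omega> r) *\<^sub>R barrier"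
    have "(b0 - b r) * inner one_L2 (pos ?w) \<le> 0" "(- \<omega> r) * inner barrier (pos ?w) \<le> 0"
      using inner_pos_nonneg[OF one_nonneg, of ?w] inner_pos_nonneg[OF barrier_nonneg, of ?w] b_ge[of r] \<omega>_ge[of r]
      by (intro mult_nonpos_nonneg; simp)+
    hence "inner ?g (pos ?w) \<le> 0" by (simp only: inner_add_left inner_scaleR_left add_nonpos_nonpos)
    from deriv_decay[OF DA_diff(1)[OF barrier_DA(1) upper_DA] \<omega>_le this]
    have "inner (?g + \<omega> r *\<^sub>R ?w - A_op ?w) (pos ?w) \<le> - rate * (norm (pos ?w))\<^sup>2" .
    moreover have "?g + \<omega> r *\<^sub>R ?w - A_op ?w = - (b r *\<^sub>R one_L2 + \<omega> r *\<^sub>R upper r - A_op (upper r))"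
      using DA_diff(2)[OF barrier_DA(1) upper_DA, of r] barrier_DA(2) by (simp add: algebra_simps)
    moreover have "((\<lambda>t. barrier - upper t) has_vector_derivative 0 - (b r *\<^sub>R one_L2 + \<omega> r *\<^sub>R upper r - A_op (upper r))) (at r)"
      by (intro has_vector_derivative_diff upper_ode has_vector_derivative_const)
    ultimately show "((\<lambda>t. barrier - upper t) has_vector_derivative - (b r *\<^sub>R one_L2 + \<omega> r *\<^sub>R upper r - A_op (upper r))) (at r) \<and>
      inner (- (b r *\<^sub>R one_L2 + \<omega> r *\<^sub>R upper r - A_op (upper r))) (pos ?w) \<le> - rate * (norm (pos ?w))\<^sup>2"
      by simp
  qed
  thus ?thesis by (simp add: L2_le_iff_diff[symmetric])
qed

text \<open>Where \<open>u \<le> 0\<close>, the excess \<open>w = barrier - u\<close> is at least \<open>barrier\<close>, so the bad source term,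
  bounded by \<open>(b0 + b1) w\<close>, is at most \<open>(b0 + b1) w\<^sup>2 / barrier\<close>, which Hardy's inequality absorbs.\<close>

lemma barrier_le_solution:
  assumes u: "strong_solution b \<omega> \<tau> v u" and v: "barrier \<le> v" and "\<tau> \<le> t"
  shows "barrier \<le> u t"
proof -
  obtain f where f: "AE t in lebesgue_on {\<tau><..}. u t \<in> DA \<and>
     (u has_vector_derivative b t *\<^sub>R f t + \<omega> t *\<^sub>R u t - A_op (u t)) (at t) \<and>
     (AE x in I01. rep_L2 (f t) x \<in> H0 (rep_L2 (u t) x))"
    using strong_solution_AE[OF u] by blast
  \<comment> \<open>Chosen so that b0 + b1 equals K times the product of barrier and Hardy weight,
    that product being b0/2.\<close>
  define K where "K = 2 * (b0 + b1) / b0"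
  have K0: "0 \<le> K" using b0_pos b1_nonneg by (simp add: K_def)
  \<comment> \<open>\<omega>1 for the reaction plus the constant lost in Hardy's inequality. A
    positive growth rate does no harm, since the initial excess is 0.\<close>
  define \<kappa> where "\<kappa> = \<omega>1 + 2 * (K + 4) ^ 3"
  have "norm (pos (barrier - u t)) \<le> exp (\<kappa> * (t - \<tau>)) * norm (pos (barrier - u \<tau>))"
  proof (rule pos_decay[where w = "\<lambda>t. barrier - u t", OF _ _ _ assms(3)])
    show "continuous_on {\<tau>..t} (\<lambda>t. barrier - u t)"
      by (intro continuous_intros solution_continuous[OF u])
    show "abs_continuous_on T t (\<lambda>t. barrier - u t)" if "\<tau> < T" "T < t" for T
    proof (rule abs_continuous_on_dominated[OF solution_abs_continuous[OF u that], of _ 1])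
      show "norm (barrier - u y - (barrier - u x)) \<le> 1 * (norm (u y - u x) + (y - x))" if "x \<le> y" for x y
        using that by (simp add: norm_minus_commute)
    qed
    show "AE r in lebesgue_on {\<tau><..}. \<exists>w'. ((\<lambda>t. barrier - u t) has_vector_derivative w') (at r) \<and>
      inner w' (pos (barrier - u r)) \<le> \<kappa> * (norm (pos (barrier - u r)))\<^sup>2"
      using f
    proof eventually_elim
      case (elim r)
      let ?w = "barrier - u r"
      define G where "G = b0 *\<^sub>R one_L2 - (b r *\<^sub>R f r + \<omega> r *\<^sub>R u r)"
      have wDA: "?w \<in> DA" "A_op ?w = b0 *\<^sub>R one_L2 - A_op (u r)"
        using DA_diff[OF barrier_DA(1), of "u r"] barrier_DA(2) elim by auto
      have d: "((\<lambda>t. barrier - u t) has_vector_derivative 0 - (b r *\<^sub>R f r + \<omega> r *\<^sub>R u r - A_op (u r))) (at r)"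
        using elim by (intro has_vector_derivative_diff has_vector_derivative_const) auto
      have eq: "0 - (b r *\<^sub>R f r + \<omega> r *\<^sub>R u r - A_op (u r)) = G - A_op ?w"
        unfolding wDA(2) G_def by simp
      have fH: "AE x in I01. rep_L2 (f r) x \<in> H0 (rep_L2 (u r) x)" using elim by blast
      have sp: "AE x in I01. 0 < x \<and> x < 1" by (rule AE_I01_I) simp
      have "AE x in I01. rep_L2 G x * rep_L2 (pos ?w) x \<le> (K * hardy_weight x + \<omega>1) * (rep_L2 (pos ?w) x)\<^sup>2"
        using fH sp rep_pos[of ?w] rep_L2_diff[of barrier "u r"] rep_barrier
          rep_L2_diff[of "b0 *\<^sub>R one_L2" "b r *\<^sub>R f r + \<omega> r *\<^sub>R u r"] rep_L2_scale[of b0 one_L2] rep_one_L2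
          rep_L2_add[of "b r *\<^sub>R f r" "\<omega> r *\<^sub>R u r"] rep_L2_scale[of "b r" "f r"] rep_L2_scale[of "\<omega> r" "u r"]
      proof eventually_elim
        case (elim x)
        let ?u = "rep_L2 (u r) x" and ?f = "rep_L2 (f r) x"
        define w where "w = barrier_fun x - ?u"
        have hw: "0 < hardy_weight x" "barrier_fun x * hardy_weight x = b0 / 2"
          using elim(2) by (auto simp: hardy_weight_def barrier_fun_def field_simps)
        have bp: "0 < barrier_fun x" using elim(2) barrier_fun_pos by blast
        have Gx: "rep_L2 G x = b0 - (b r * ?f + \<omega> r * ?u)" using elim unfolding G_def by simp
        have Px: "rep_L2 (pos ?w) x = max 0 w" using elim by (simp add: w_def)
        have rhs: "0 \<le> (K * hardy_weight x + \<omega>1) * (max 0 w)\<^sup>2"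
          using K0 hw(1) \<omega>1_nonneg by simp
        consider "w \<le> 0" | "0 < w" "0 < ?u" | "0 < w" "?u \<le> 0" by linarith
        thus ?case
        proof cases
          case 1
          thus ?thesis unfolding Px by simp
        next
          \<comment> \<open>Where u > 0 the source is b \<ge> b0, so the comparison goes the right
            way.\<close>
          case 2
          hence "?f = 1" using elim(1) by (simp add: H0_def)
          moreover have "0 \<le> \<omega> r * ?u" using \<omega>_ge 2 by simp
          ultimately have "rep_L2 G x \<le> 0" unfolding Gx using b_ge[of r] by simp
          hence "rep_L2 G x * rep_L2 (pos ?w) x \<le> 0" unfolding Px by (intro mult_nonpos_nonneg) auto
          thus ?thesis using rhs unfolding Px by linarith
        next
          case 3
          have "-1 \<le> ?f" using elim(1) by (auto simp: H0_def split: if_splits)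
          hence "b r * (-1) \<le> b r * ?f" using b_ge[of r] b0_pos by (intro mult_left_mono) auto
          \<comment> \<open>Here -u \<le> w because the barrier is positive.\<close>
          moreover have "\<omega> r * (- ?u) \<le> \<omega>1 * w"
            using \<omega>_le[of r] \<omega>1_nonneg 3 bp by (intro mult_mono) (auto simp: w_def)
          ultimately have "rep_L2 G x \<le> (b0 + b1) + \<omega>1 * w" unfolding Gx using b_le[of r] by simp
          hence "rep_L2 G x * w \<le> ((b0 + b1) + \<omega>1 * w) * w" using 3 by (intro mult_right_mono) auto
          also have "\<dots> = (b0 + b1) * w + \<omega>1 * w\<^sup>2" by (simp add: power2_eq_square algebra_simps)
          also have "(b0 + b1) * w \<le> K * hardy_weight x * w\<^sup>2"
          proof -
            have "(b0 + b1) * 1 = K * (barrier_fun x * hardy_weight x)"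
              unfolding hw(2) K_def using b0_pos by simp
            also have "\<dots> \<le> K * (w * hardy_weight x)"
              using 3 hw(1) K0 by (intro mult_left_mono mult_right_mono) (auto simp: w_def)
            finally have "(b0 + b1) * w \<le> K * (w * hardy_weight x) * w"
              using 3 by (intro mult_right_mono) auto
            thus ?thesis by (simp add: power2_eq_square ac_simps)
          qed
          finally show ?thesis unfolding Px using 3 by (simp add: distrib_right)
        qed
      qed
      from hardy_absorb[OF wDA(1) K0 \<omega>1_nonneg this]
      have "inner (G - A_op ?w) (pos ?w) \<le> \<kappa> * (norm (pos ?w))\<^sup>2"
        by (simp add: inner_diff_left \<kappa>_def)
      thus ?case using d unfolding eq by blast
    qed
  qed
  also have "pos (barrier - u \<tau>) = 0"
    using v by (simp add: solution_initial[OF u] pos_eq_0_iff L2_le_iff_diff[symmetric])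
  finally have "pos (barrier - u t) = 0" by simp
  thus ?thesis by (simp add: pos_eq_0_iff L2_le_iff_diff[symmetric])
qed

text \<open>Staying above the barrier means staying positive, which fixes the source to be 1; the
  difference from \<open>upper\<close> then solves a linear homogeneous equation. Both of its signed
  parts decay, and adding them gives the factor 2.\<close>

lemma above_upper_decay:
  assumes u: "strong_solution b \<omega> \<tau> v u" and v: "upper \<tau> \<le> v" and t: "\<tau> \<le> t"
  shows "norm (u t - upper t) \<le> exp (- rate * (t - \<tau>)) * (2 * norm (v - upper \<tau>))"
proof -
  obtain f where f: "AE t in lebesgue_on {\<tau><..}. u t \<in> DA \<and>
     (u has_vector_derivative b t *\<^sub>R f t + \<omega> t *\<^sub>R u t - A_op (u t)) (at t) \<and>
     (AE x in I01. rep_L2 (f t) x \<in> H0 (rep_L2 (u t) x))"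
    using strong_solution_AE[OF u] by blast
  have bar: "barrier \<le> u r" if "\<tau> \<le> r" for r
    using barrier_le_solution[OF u order_trans[OF barrier_le_upper v] that] .
  have "norm (pos (- (u t - upper t))) \<le> exp (- rate * (t - \<tau>)) * norm (pos (- (u \<tau> - upper \<tau>)))"
  proof (rule pos_decay[where w = "\<lambda>t. - (u t - upper t)", OF _ _ _ t])
    show "continuous_on {\<tau>..t} (\<lambda>t. - (u t - upper t))"
      by (intro continuous_intros upper_continuous solution_continuous[OF u])
    show "abs_continuous_on T t (\<lambda>t. - (u t - upper t))" if "\<tau> < T" "T < t" for T
    proof (rule abs_continuous_on_dominated[OF solution_upper_ac[OF u that], of _ 1])
      show "norm (- (u y - upper y) - - (u x - upper x)) \<le> 1 * (norm (u y - upper y - (u x - upper x)) + (y - x))"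
        if "x \<le> y" for x y
      proof -
        have "- (u y - upper y) - - (u x - upper x) = - ((u y - upper y) - (u x - upper x))" by simp
        thus ?thesis using that by (simp only: norm_minus_cancel) simp
      qed
    qed
    have "AE r in lebesgue_on {\<tau><..}. \<tau> < r" by (rule AE_I2) simp
    with f show "AE r in lebesgue_on {\<tau><..}. \<exists>w'. ((\<lambda>t. - (u t - upper t)) has_vector_derivative w') (at r) \<and>
      inner w' (pos (- (u r - upper r))) \<le> - rate * (norm (pos (- (u r - upper r))))\<^sup>2"
    proof eventually_elim
      case (elim r)
      let ?w = "- (u r - upper r)"
      have "f r = one_L2"
      proof (rule L2_eqI_AE)
        have "AE x in I01. rep_L2 barrier x \<le> rep_L2 (u r) x"
          using bar[of r] elim(2) by (simp add: less_eq_L2_iff)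
        moreover have "AE x in I01. 0 < barrier_fun x" by (rule AE_I01_I) (rule barrier_fun_pos)
        moreover have "AE x in I01. rep_L2 (f r) x \<in> H0 (rep_L2 (u r) x)" using elim(1) by blast
        ultimately show "AE x in I01. rep_L2 (f r) x = rep_L2 one_L2 x"
          using rep_barrier rep_one_L2 by eventually_elim (simp add: H0_def)
      qed
      hence du: "(u has_vector_derivative b r *\<^sub>R one_L2 + \<omega> r *\<^sub>R u r - A_op (u r)) (at r)" using elim(1) by simp
      have wDA: "?w \<in> DA" "A_op ?w = - (A_op (u r) - A_op (upper r))"
        using DA_minus[OF DA_diff(1)[OF _ upper_DA]] DA_diff(2)[OF _ upper_DA] elim(1) by auto
      have "((\<lambda>t. - (u t - upper t)) has_vector_derivative - ((b r *\<^sub>R one_L2 + \<omega> r *\<^sub>R u r - A_op (u r))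
          - (b r *\<^sub>R one_L2 + \<omega> r *\<^sub>R upper r - A_op (upper r)))) (at r)"
        by (intro has_vector_derivative_minus has_vector_derivative_diff du upper_ode)
      also have "- ((b r *\<^sub>R one_L2 + \<omega> r *\<^sub>R u r - A_op (u r)) - (b r *\<^sub>R one_L2 + \<omega> r *\<^sub>R upper r - A_op (upper r)))
          = 0 + \<omega> r *\<^sub>R ?w - A_op ?w"
        unfolding wDA(2) by (simp add: algebra_simps)
      finally have d: "((\<lambda>t. - (u t - upper t)) has_vector_derivative 0 + \<omega> r *\<^sub>R ?w - A_op ?w) (at r)" .
      have "inner (0 :: L2) (pos ?w) \<le> 0" by simp
      from deriv_decay[OF wDA(1) \<omega>_le this] d show ?case by blast
    qed
  qed
  also have "\<dots> \<le> exp (- rate * (t - \<tau>)) * norm (v - upper \<tau>)"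
    using norm_pos_le[of "- (v - upper \<tau>)"] by (intro mult_left_mono) (auto simp: solution_initial[OF u] norm_minus_commute)
  finally have 1: "norm (pos (- (u t - upper t))) \<le> exp (- rate * (t - \<tau>)) * norm (v - upper \<tau>)" .
  have "norm (pos (u t - upper t)) \<le> exp (- rate * (t - \<tau>)) * norm (pos (v - upper \<tau>))"
    by (rule below_upper[OF u t])
  also have "\<dots> \<le> exp (- rate * (t - \<tau>)) * norm (v - upper \<tau>)"
    by (intro mult_left_mono norm_pos_le) auto
  finally have "norm (pos (u t - upper t)) \<le> exp (- rate * (t - \<tau>)) * norm (v - upper \<tau>)" .
  thus ?thesis using 1 norm_le_pos[of "u t - upper t"] by linarith
qed

section \<open>Extremality, attraction of the order interval, and stability\<close>

lemma trajectory_le_upper: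
  assumes \<gamma>: "complete_trajectory b \<omega> \<gamma>" and bd: "\<And>t. norm (\<gamma> t) \<le> M"
  shows "\<gamma> t \<le> upper t"
proof -
  have "\<gamma> t - upper t \<le> 0"
  proof (rule exp_decay_imp_nonpos[OF rate_pos, where w = "\<lambda>t. \<gamma> t - upper t"])
    fix s assume st: "s \<le> t"
    obtain v where v: "strong_solution b \<omega> s v \<gamma>"
      using \<gamma> by (auto simp: complete_trajectory_def solutions_def)
    have "norm (pos (\<gamma> t - upper t)) \<le> exp (- rate * (t - s)) * norm (pos (v - upper s))"
      by (rule below_upper[OF v st])
    also have "\<dots> \<le> exp (- rate * (t - s)) * (M + zbound)"
      using norm_pos_le[of "v - upper s"] norm_triangle_ineq4[of v "upper s"] bd[of s] upper_bounded[of s]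
        solution_initial[OF v] by (intro mult_left_mono) auto
    finally show "norm (pos (\<gamma> t - upper t)) \<le> exp (- rate * (t - s)) * (M + zbound)" .
  qed
  thus ?thesis by (simp add: L2_le_iff_diff[symmetric])
qed

lemma complete_trajectory_uminus:
  "complete_trajectory b \<omega> \<gamma> \<Longrightarrow> complete_trajectory b \<omega> (\<lambda>t. - \<gamma> t)"
  unfolding complete_trajectory_def solutions_def using strong_solution_uminus by blast

lemma upper_trajectory: "complete_trajectory b \<omega> upper"
  unfolding complete_trajectory_def solutions_def using upper_strong_solution by blast

text \<open>The witness is y truncated to the order interval; at most one of the two corrections is
  nonzero at a point, since - upper \<le> upper.\<close>

lemma interval_close:
  "\<exists>y'\<in>{y. - upper t \<le> y \<and> y \<le> upper t}.
     norm (y - y') \<le> norm (pos (y - upper t)) + norm (pos (- upper t - y))"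
proof (intro bexI)
  let ?y = "y - pos (y - upper t) + pos (- upper t - y)"
  show "norm (y - ?y) \<le> norm (pos (y - upper t)) + norm (pos (- upper t - y))"
    using norm_triangle_ineq4[of "pos (y - upper t)" "pos (- upper t - y)"] by (simp add: algebra_simps)
  have un: "AE x in I01. rep_L2 0 x \<le> rep_L2 (upper t) x"
    using upper_nonneg[of t] by (simp add: less_eq_L2_iff)
  have "AE x in I01. rep_L2 (- upper t) x \<le> rep_L2 ?y x \<and> rep_L2 ?y x \<le> rep_L2 (upper t) x"
    using un rep_L2_zero rep_L2_minus[of "upper t"] rep_L2_add[of "y - pos (y - upper t)" "pos (- upper t - y)"]
      rep_L2_diff[of y "pos (y - upper t)"] rep_pos[of "y - upper t"] rep_pos[of "- upper t - y"]
      rep_L2_diff[of y "upper t"] rep_L2_diff[of "- upper t" y]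
  proof eventually_elim
    case (elim x)
    define Y U where "Y = rep_L2 y x" and "U = rep_L2 (upper t) x"
    have "rep_L2 ?y x = Y - max 0 (Y - U) + max 0 (- U - Y)"
      unfolding elim(4-9) elim(3) Y_def U_def ..
    moreover have "0 \<le> U" using elim(1,2) by (simp add: U_def)
    ultimately show ?case unfolding elim(3) U_def[symmetric] by (auto simp: max_def)
  qed
  thus "?y \<in> {y. - upper t \<le> y \<and> y \<le> upper t}" unfolding less_eq_L2_iff mem_Collect_eq by (rule AE_conj_iff[THEN iffD1])
qed

lemma interval_attracting:
  "pullback_attracting (process b \<omega>) (\<lambda>t. {y. - upper t \<le> y \<and> y \<le> upper t})"
  unfolding pullback_attracting_def
proof (intro allI impI)
  fix t and B :: "L2 set" assume "bounded B"
  then obtain R where R: "\<forall>x\<in>B. norm x \<le> R" unfolding bounded_iff by (elim exE)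
  let ?C = "{y. - upper t \<le> y \<and> y \<le> upper t}"
  \<comment> \<open>One term of the factor 2 for each end of the interval; \<open>R\<close> bounds
    the data and \<open>zbound\<close> bounds \<open>upper\<close> at the initial time, both
    uniformly in s.\<close>
  let ?e = "\<lambda>s. exp (- rate * (t - s)) * (2 * (R + zbound))"
  have "\<forall>\<^sub>F s in at_bot. dist_X (\<Union>x\<in>B. process b \<omega> t s x) ?C \<le> ennreal (?e s)"
    using eventually_le_at_bot[of t]
  proof eventually_elim
    case (elim s)
    show ?case
      unfolding dist_X_def
    proof (rule SUP_least)
      fix y assume "y \<in> (\<Union>x\<in>B. process b \<omega> t s x)"
      then obtain x u v where x: "x \<in> B" "strong_solution b \<omega> s v u" "u s = x" "y = u t"
        unfolding process_def solutions_def UN_iff mem_Collect_eq by (elim bexE exE conjE) (rule that)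
      hence vx: "v = x" using solution_initial[of s v u] by simp
      have bd: "norm x + norm (upper s) \<le> R + zbound" using R[rule_format, OF x(1)] upper_bounded[of s] by linarith
      have "norm (pos (v - upper s)) \<le> R + zbound"
        using bd norm_pos_le[of "v - upper s"] norm_triangle_ineq4[of v "upper s"] unfolding vx by linarith
      from order_trans[OF below_upper[OF x(2) elim] mult_left_mono[OF this exp_ge_zero]]
      have "norm (pos (y - upper t)) \<le> exp (- rate * (t - s)) * (R + zbound)" unfolding x(4) .
      moreover have "norm (pos (- upper s - v)) \<le> R + zbound"
        using bd norm_pos_le[of "- upper s - v"] norm_triangle_ineq4[of "- upper s" v]
        unfolding vx norm_minus_cancel by linarith
      from order_trans[OF above_lower[OF x(2) elim] mult_left_mono[OF this exp_ge_zero]]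
      have "norm (pos (- upper t - y)) \<le> exp (- rate * (t - s)) * (R + zbound)" unfolding x(4) .
      moreover obtain y' where y': "y' \<in> ?C" "norm (y - y') \<le> norm (pos (y - upper t)) + norm (pos (- upper t - y))"
        using interval_close by blast
      ultimately have "dist y y' \<le> exp (- rate * (t - s)) * (R + zbound) + exp (- rate * (t - s)) * (R + zbound)"
        unfolding dist_norm by linarith
      also have "\<dots> = ?e s" by (simp only: mult_2 distrib_left)
      finally have "dist y y' \<le> ?e s" .
      have "(INF a\<in>?C. ennreal (dist y a)) \<le> ennreal (dist y y')" by (rule INF_lower[OF y'(1)])
      also have "\<dots> \<le> ennreal (?e s)" by (rule ennreal_leI) fact
      finally show "(INF a\<in>?C. ennreal (dist y a)) \<le> ennreal (?e s)" .
    qed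
  qed
  thus "((\<lambda>s. dist_X (\<Union>x\<in>B. process b \<omega> t s x) ?C) \<longlongrightarrow> 0) at_bot"
    by (rule ennreal_squeeze[OF _ exp_decay_tendsto[OF rate_pos]])
qed

lemma interval_closed: "closed {y. - upper t \<le> y \<and> y \<le> upper t}"
  unfolding closed_sequential_limits
proof (intro allI impI, elim conjE)
  fix X l assume X: "\<forall>n. X n \<in> {y. - upper t \<le> y \<and> y \<le> upper t}" "X \<longlonglongrightarrow> l"
  have "l \<le> upper t" by (rule L2_le_limit[OF X(2)]) (use X(1) in simp)
  moreover have "- l \<le> upper t"
    by (rule L2_le_limit[OF tendsto_minus[OF X(2)]]) (use X(1) L2_minus_le_iff[of "upper t"] in blast)
  ultimately show "l \<in> {y. - upper t \<le> y \<and> y \<le> upper t}"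
    using L2_minus_le_iff[of l "upper t"] by blast
qed

text \<open>The fixed ceiling \<open>p\<close> makes the initial distances bounded uniformly in the
  initial time, because 0 \<le> v - upper \<le> p - upper; without such a bound the exponential
  factor would not suffice. The second claim is the first one after reflection.\<close>

lemma upper_attracts_above:
  assumes v: "\<And>\<tau>. upper \<tau> \<le> v \<tau> \<and> v \<tau> \<le> p"
  shows "((\<lambda>\<tau>. dist_X (process b \<omega> t \<tau> (v \<tau>)) {upper t}) \<longlongrightarrow> 0) at_bot"
    and "((\<lambda>\<tau>. dist_X (process b \<omega> t \<tau> (- v \<tau>)) {- upper t}) \<longlongrightarrow> 0) at_bot"
proof -
  let ?e = "\<lambda>s. exp (- rate * (t - s)) * (2 * (norm p + zbound))"
  have "norm (v s - upper s) \<le> norm p + zbound" for s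
  proof -
    have "norm (v s - upper s) \<le> norm (p - upper s)"
    proof (rule norm_L2_mono)
      show "0 \<le> v s - upper s" using L2_diff_mono[of "upper s" "v s" "upper s" "upper s"] v[of s] by simp
      show "v s - upper s \<le> p - upper s" using v by (intro L2_diff_mono) auto
    qed
    thus ?thesis using norm_triangle_ineq4[of p "upper s"] upper_bounded[of s] by linarith
  qed
  hence le: "exp (- rate * (t - s)) * (2 * norm (v s - upper s)) \<le> ?e s" for s
    by (intro mult_left_mono) auto
  have sol: "norm (u t - upper t) \<le> ?e s" if "strong_solution b \<omega> s (v s) u" "s \<le> t" for u s
    using above_upper_decay[OF that(1) _ that(2)] v[of s] le[of s] by (meson order_trans)
  have "\<forall>\<^sub>F s in at_bot. dist_X (process b \<omega> t s (v s)) {upper t} \<le> ennreal (?e s)"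
    using eventually_le_at_bot[of t]
  proof eventually_elim
    case (elim s)
    show ?case
      unfolding dist_X_def
    proof (rule SUP_least)
      fix y assume "y \<in> process b \<omega> t s (v s)"
      then obtain u where "strong_solution b \<omega> s (v s) u" "y = u t"
        using solution_initial by (fastforce simp: process_def solutions_def)
      hence "dist y (upper t) \<le> ?e s" using sol elim by (simp add: dist_norm)
      thus "(INF a\<in>{upper t}. ennreal (dist y a)) \<le> ennreal (?e s)" by (simp add: ennreal_leI)
    qed
  qed
  thus "((\<lambda>\<tau>. dist_X (process b \<omega> t \<tau> (v \<tau>)) {upper t}) \<longlongrightarrow> 0) at_bot"
    by (rule ennreal_squeeze[OF _ exp_decay_tendsto[OF rate_pos]])
  have "\<forall>\<^sub>F s in at_bot. dist_X (process b \<omega> t s (- v s)) {- upper t} \<le> ennreal (?e s)"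
    using eventually_le_at_bot[of t]
  proof eventually_elim
    case (elim s)
    show ?case
      unfolding dist_X_def
    proof (rule SUP_least)
      fix y assume "y \<in> process b \<omega> t s (- v s)"
      then obtain u where u: "strong_solution b \<omega> s (- v s) u" "y = u t"
        using solution_initial by (fastforce simp: process_def solutions_def)
      have "norm (- u t - upper t) \<le> ?e s"
        using sol[of s "\<lambda>t. - u t"] strong_solution_uminus[OF u(1)] elim by simp
      moreover have "norm (- u t - upper t) = dist y (- upper t)"
        unfolding dist_norm u(2) using norm_minus_cancel[of "- u t - upper t"] by (simp add: algebra_simps)
      ultimately show "(INF a\<in>{- upper t}. ennreal (dist y a)) \<le> ennreal (?e s)" by (simp add: ennreal_leI)
    qed
  qed
  thus "((\<lambda>\<tau>. dist_X (process b \<omega> t \<tau> (- v \<tau>)) {- upper t}) \<longlongrightarrow> 0) at_bot"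
    by (rule ennreal_squeeze[OF _ exp_decay_tendsto[OF rate_pos]])
qed

end

theorem theorem12:
  fixes b \<omega> :: "real \<Rightarrow> real" and b0 b1 \<omega>0 \<omega>1 :: real
    and \<A> :: "real \<Rightarrow> L2 set" and v1p v1m :: L2
  assumes "continuous_on UNIV b" and "continuous_on UNIV \<omega>"
    and "0 < b0" and "\<And>t. b0 \<le> b t \<and> b t \<le> b1"
    and "0 \<le> \<omega>0" and "\<And>t. \<omega>0 \<le> \<omega> t \<and> \<omega> t \<le> \<omega>1" and "\<omega>1 < pi\<^sup>2"
    and "pullback_attractor (process b \<omega>) \<A>"
    and "stationary_point b1 \<omega>1 v1p" and "positive_L2 v1p"
    and "stationary_point b1 \<omega>1 v1m" and "negative_L2 v1m" and "v1m = - v1p"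
  shows "\<exists>\<gamma>low \<gamma>up.
    complete_trajectory b \<omega> \<gamma>low \<and> bounded (range \<gamma>low) \<and>
    complete_trajectory b \<omega> \<gamma>up \<and> bounded (range \<gamma>up) \<and>
    (\<forall>t. v1m \<le> \<gamma>low t \<and> \<gamma>low t \<le> \<gamma>up t \<and> \<gamma>up t \<le> v1p) \<and>
    (\<forall>t. \<A> t \<subseteq> {y. \<gamma>low t \<le> y \<and> y \<le> \<gamma>up t}) \<and>
    (\<not> (\<exists>\<gamma>. complete_trajectory b \<omega> \<gamma> \<and> \<gamma> \<noteq> \<gamma>low \<and> (\<forall>t. v1m \<le> \<gamma> t \<and> \<gamma> t \<le> \<gamma>low t))) \<and>
    (\<not> (\<exists>\<gamma>. complete_trajectory b \<omega> \<gamma> \<and> \<gamma> \<noteq> \<gamma>up \<and> (\<forall>t. \<gamma>up t \<le> \<gamma> t \<and> \<gamma> t \<le> v1p))) \<and>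
    (W12_loc b \<and> W12_loc \<omega> \<longrightarrow>
      (\<forall>t v. (\<forall>\<tau>. v1m \<le> v \<tau> \<and> v \<tau> \<le> \<gamma>low \<tau>) \<longrightarrow>
         ((\<lambda>\<tau>. dist_X (process b \<omega> t \<tau> (v \<tau>)) {\<gamma>low t}) \<longlongrightarrow> 0) at_bot) \<and>
      (\<forall>t v. (\<forall>\<tau>. \<gamma>up \<tau> \<le> v \<tau> \<and> v \<tau> \<le> v1p) \<longrightarrow>
         ((\<lambda>\<tau>. dist_X (process b \<omega> t \<tau> (v \<tau>)) {\<gamma>up t}) \<longlongrightarrow> 0) at_bot))"
proof -
  interpret forcing b \<omega> b0 b1 \<omega>1
  proof
    show "b0 \<le> b t" "b t \<le> b1" "0 \<le> \<omega> t" "\<omega> t \<le> \<omega>1" for t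
      using assms(4)[of t] assms(5) assms(6)[of t] by linarith+
  qed (fact assms)+
  have v1m: "v1m = - v1p" by fact
  have up: "upper t \<le> v1p" for t by (rule upper_le_stationary[OF assms(9,10)])
  have low: "v1m \<le> - upper t" for t using up[of t] L2_neg_le[of v1p "upper t"] by (simp add: v1m)
  have mid: "- upper t \<le> upper t" for t
  proof -
    have "- upper t \<le> 0" using upper_nonneg[of t] L2_neg_le[of "upper t" 0] by simp
    thus ?thesis using upper_nonneg[of t] by (rule order_trans)
  qed
  have bdd: "bounded (range upper)" "bounded (range (\<lambda>t. - upper t))"
    using upper_bounded unfolding bounded_iff by (intro exI[of _ zbound]; simp)+
  \<comment> \<open>A trajectory between \<open>upper\<close> and \<open>v1p\<close> is nonnegative
    and below \<open>v1p\<close>, hence automatically bounded, so the comparison for bounded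
    complete trajectories applies.\<close>
  have max: "\<gamma> = upper" if \<gamma>: "complete_trajectory b \<omega> \<gamma>" "\<And>t. upper t \<le> \<gamma> t \<and> \<gamma> t \<le> v1p" for \<gamma>
  proof
    fix t
    have "norm (\<gamma> t) \<le> norm v1p" for t
    proof (rule norm_L2_mono)
      show "0 \<le> \<gamma> t" using upper_nonneg[of t] \<gamma>(2)[of t] by (meson order_trans)
    qed (use \<gamma>(2) in blast)
    hence "\<gamma> t \<le> upper t" by (rule trajectory_le_upper[OF \<gamma>(1)])
    thus "\<gamma> t = upper t" using \<gamma>(2)[of t] by (meson order_antisym)
  qed
  have min: "\<gamma> = (\<lambda>t. - upper t)" if \<gamma>: "complete_trajectory b \<omega> \<gamma>" "\<And>t. v1m \<le> \<gamma> t \<and> \<gamma> t \<le> - upper t" for \<gamma>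
  proof -
    have "(\<lambda>t. - \<gamma> t) = upper"
    proof (rule max[OF complete_trajectory_uminus[OF \<gamma>(1)]])
      show "upper t \<le> - \<gamma> t \<and> - \<gamma> t \<le> v1p" for t
        using \<gamma>(2)[of t] L2_le_minus_iff[of "upper t" "\<gamma> t"] L2_minus_le_iff[of "\<gamma> t" v1p]
        unfolding v1m by blast
    qed
    hence "- \<gamma> t = upper t" for t by (rule fun_cong)
    note e = this[symmetric]
    show ?thesis unfolding e minus_minus ..
  qed
  have attr: "\<A> t \<subseteq> {y. - upper t \<le> y \<and> y \<le> upper t}" for t
  proof -
    have "\<forall>\<C>. (\<forall>t. closed (\<C> t)) \<and> pullback_attracting (process b \<omega>) \<C> \<longrightarrow> (\<forall>t. \<A> t \<subseteq> \<C> t)"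
      using assms(8) unfolding pullback_attractor_def by (elim conjE)
    from spec[OF mp[OF spec[OF this] conjI[OF allI[OF interval_closed] interval_attracting]]]
    show ?thesis .
  qed
  have stab_up: "((\<lambda>\<tau>. dist_X (process b \<omega> t \<tau> (v \<tau>)) {upper t}) \<longlongrightarrow> 0) at_bot"
    if "\<forall>\<tau>. upper \<tau> \<le> v \<tau> \<and> v \<tau> \<le> v1p" for t v
    by (rule upper_attracts_above(1)) (rule that[rule_format])
  have stab_low: "((\<lambda>\<tau>. dist_X (process b \<omega> t \<tau> (v \<tau>)) {- upper t}) \<longlongrightarrow> 0) at_bot"
    if v: "\<forall>\<tau>. v1m \<le> v \<tau> \<and> v \<tau> \<le> - upper \<tau>" for t v
  proof -
    have "upper \<tau> \<le> - v \<tau> \<and> - v \<tau> \<le> v1p" for \<tau>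
      using v L2_le_minus_iff[of "upper \<tau>" "v \<tau>"] L2_minus_le_iff[of "v \<tau>" v1p]
      unfolding v1m by blast
    from upper_attracts_above(2)[of "\<lambda>\<tau>. - v \<tau>" v1p t, OF this] show ?thesis by simp
  qed
  show ?thesis
  proof (rule exI[of _ "\<lambda>t. - upper t"], rule exI[of _ upper], intro conjI)
    show "complete_trajectory b \<omega> (\<lambda>t. - upper t)"
      by (rule complete_trajectory_uminus[OF upper_trajectory])
    show "complete_trajectory b \<omega> upper" by (rule upper_trajectory)
    show "\<forall>t. v1m \<le> - upper t \<and> - upper t \<le> upper t \<and> upper t \<le> v1p" using up low mid by blast
    show "\<forall>t. \<A> t \<subseteq> {y. - upper t \<le> y \<and> y \<le> upper t}" using attr by blast
    show "\<not> (\<exists>\<gamma>. complete_trajectory b \<omega> \<gamma> \<and> \<gamma> \<noteq> (\<lambda>t. - upper t) \<and> (\<forall>t. v1m \<le> \<gamma> t \<and> \<gamma> t \<le> - upper t))"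
      using min by blast
    show "\<not> (\<exists>\<gamma>. complete_trajectory b \<omega> \<gamma> \<and> \<gamma> \<noteq> upper \<and> (\<forall>t. upper t \<le> \<gamma> t \<and> \<gamma> t \<le> v1p))"
      using max by blast
    show "W12_loc b \<and> W12_loc \<omega> \<longrightarrow>
      (\<forall>t v. (\<forall>\<tau>. v1m \<le> v \<tau> \<and> v \<tau> \<le> - upper \<tau>) \<longrightarrow>
         ((\<lambda>\<tau>. dist_X (process b \<omega> t \<tau> (v \<tau>)) {- upper t}) \<longlongrightarrow> 0) at_bot) \<and>
      (\<forall>t v. (\<forall>\<tau>. upper \<tau> \<le> v \<tau> \<and> v \<tau> \<le> v1p) \<longrightarrow>
         ((\<lambda>\<tau>. dist_X (process b \<omega> t \<tau> (v \<tau>)) {upper t}) \<longlongrightarrow> 0) at_bot)"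
      using stab_low stab_up by blast
  qed (rule bdd)+
qed

end
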